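(* If $m_+(x)/m(x)\to0$ as $x\to\infty$, then both $a(x)$ and $a(-x)$ are asymptotically increasing as $x\to+\infty$; that is, there are increasing functions $f_1,f_2$ such that $a(x)=f_1(x)\{1+o(1)\}$ and $a(-x)=f_2(x)\{1+o(1)\}$ as $x\to+\infty$.
   Context: Let $X,X_1,X_2,\dots$ be i.i.d. integer-valued random variables and $S_n=X_1+\dots+X_n$, $S_0=0$. Standing assumptions: the random walk is irreducible on $\mathbb Z$, $EX=0$, $EX^2=\infty$, and $P[X\ge2]>0$. The potential function is $a(x)=\sum_{n=0}^\infty\big(P[S_n=0]-P[S_n=-x]\big)$, $x\in\mathbb Z$ (the series converges). For real $x\ge0$: $\mu_-(x)=P[X<-x]$, $\mu_+(x)=P[X>x]$; $\eta_\pm(x)=\int_x^\infty\mu_\pm(y)\,dy$; $m_\pm(x)=\int_0^x\eta_\pm(s)\,ds$, $m=m_++m_-$. "Increasing" is understood as non-decreasing. *)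

theory Defs
  imports "HOL-Probability.Probability" "HOL-Library.Landau_Symbols"
begin

text \<open>
  A random walk is given by a family \<open>X :: nat \<Rightarrow> 'a \<Rightarrow> int\<close> of random variables on \<open>M\<close>:
  \<open>X 0\<close> plays the role of the generic step and \<open>X 1, X 2, \<dots>\<close> are the steps of the walk.
\<close>

definition iid :: "'a measure \<Rightarrow> (nat \<Rightarrow> 'a \<Rightarrow> int) \<Rightarrow> bool" where
  "iid M X \<longleftrightarrow>
     prob_space.indep_vars M (\<lambda>_. count_space UNIV) X UNIV \<and>
     (\<forall>n. distr M (count_space UNIV) (X n) = distr M (count_space UNIV) (X 0))"

definition walk :: "(nat \<Rightarrow> 'a \<Rightarrow> int) \<Rightarrow> nat \<Rightarrow> 'a \<Rightarrow> int" where
  "walk X n \<omega> = (\<Sum>i=1..n. X i \<omega>)"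

definition irreducible_walk :: "'a measure \<Rightarrow> (nat \<Rightarrow> 'a \<Rightarrow> int) \<Rightarrow> bool" where
  "irreducible_walk M X \<longleftrightarrow>
     (\<forall>x y. \<exists>n. measure M {\<omega> \<in> space M. x + walk X n \<omega> = y} > 0)"

text \<open>The series below converges in the order of summation, in general only conditionally.\<close>

definition potential :: "'a measure \<Rightarrow> (nat \<Rightarrow> 'a \<Rightarrow> int) \<Rightarrow> int \<Rightarrow> real" where
  "potential M X x =
     (\<Sum>n. measure M {\<omega> \<in> space M. walk X n \<omega> = 0} - measure M {\<omega> \<in> space M. walk X n \<omega> = -x})"

definition mu_minus :: "'a measure \<Rightarrow> ('a \<Rightarrow> int) \<Rightarrow> real \<Rightarrow> real" where
  "mu_minus M Y x = measure M {\<omega> \<in> space M. real_of_int (Y \<omega>) < -x}"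

definition mu_plus :: "'a measure \<Rightarrow> ('a \<Rightarrow> int) \<Rightarrow> real \<Rightarrow> real" where
  "mu_plus M Y x = measure M {\<omega> \<in> space M. real_of_int (Y \<omega>) > x}"

text \<open>The tail integrals are finite whenever \<open>Y\<close> is integrable.\<close>

definition eta_minus :: "'a measure \<Rightarrow> ('a \<Rightarrow> int) \<Rightarrow> real \<Rightarrow> real" where
  "eta_minus M Y x = (LBINT y:{x..}. mu_minus M Y y)"

definition eta_plus :: "'a measure \<Rightarrow> ('a \<Rightarrow> int) \<Rightarrow> real \<Rightarrow> real" where
  "eta_plus M Y x = (LBINT y:{x..}. mu_plus M Y y)"

definition m_minus :: "'a measure \<Rightarrow> ('a \<Rightarrow> int) \<Rightarrow> real \<Rightarrow> real" where
  "m_minus M Y x = (LBINT s:{0..x}. eta_minus M Y s)"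

definition m_plus :: "'a measure \<Rightarrow> ('a \<Rightarrow> int) \<Rightarrow> real \<Rightarrow> real" where
  "m_plus M Y x = (LBINT s:{0..x}. eta_plus M Y s)"

definition m_total :: "'a measure \<Rightarrow> ('a \<Rightarrow> int) \<Rightarrow> real \<Rightarrow> real" where
  "m_total M Y x = m_plus M Y x + m_minus M Y x"

text \<open>
  \<open>g \<sim>[at_top] f\<close> is \<open>g x = f x * (1 + o(1))\<close>, also where \<open>f\<close> vanishes
  (see \<open>asymp_equiv_altdef\<close>).
\<close>

definition asymp_increasing :: "(int \<Rightarrow> real) \<Rightarrow> bool" where
  "asymp_increasing g \<longleftrightarrow> (\<exists>f. mono f \<and> g \<sim>[at_top] f)"

end

theory Submission
  imports Defs
begin

text \<open>
  Write \<open>a\<close> for the potential function, \<open>Y\<close> for the generic step, \<open>\<phi>\<close> for its characteristic function and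
  \<open>N t = E (Y\<^sup>2 / (1 + t |Y|))\<close>, so that \<open>N (1/x)\<close> is comparable to \<open>m x\<close>. The hypothesis makes the positive
  jumps negligible, which yields \<open>|1 - \<phi> t| \<ge> c t\<^sup>2 N t\<close> and hence
  \<open>a x = (1/\<pi>) \<integral> Re ((1 - e\<^sup>i\<^sup>x\<^sup>t) / (1 - \<phi> t)) dt\<close> over \<open>(0, \<pi>)\<close>. If the positive jumps are replaced by jumps \<open>+1\<close>
  of the same mean, the walk cannot jump over points upwards and the corresponding integral vanishes for
  \<open>x < 0\<close>. Since the two integrands are close, Fejer averages of \<open>a (- x)\<close> over \<open>[1, n]\<close> are of smaller order than
  \<open>n / N (1/n)\<close>, which is the order of those of \<open>a x\<close>. The derivatives of \<open>1 / N t\<close> and \<open>1 / (t N t)\<close> are, up to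
  constants, the bounds for the integrands, so that all integrals are estimated by primitives.

  The maximum principle for the walk killed at a geometric time gives \<open>a (x + y) \<le> a x + a y\<close> and
  \<open>a (- z) (a z - a x) \<le> a z a (x - z)\<close>. Averaging the first inequality turns the estimate of the means into
  \<open>a (- z) / a z \<longlonglongrightarrow> 0\<close> and \<open>a z \<longlonglongrightarrow> \<infinity>\<close>. Then \<open>a y \<le> a z + a (- (z - y))\<close> shows that \<open>a z\<close> is equivalent to its running
  maximum, and the second inequality in the form \<open>a (- (z + t)) \<ge> (1 - a (- t) / a z) a (- z)\<close> shows the
  same for \<open>a (- z)\<close> if this is unbounded; otherwise \<open>a (- z)\<close> is equivalent to its infimum over \<open>[z, \<infinity>)\<close>.
\<close>

section \<open>Truncated second moments\<close>

text \<open>The obstacle is that absolute values lose too much: \<open>1 - \<phi> t\<close> is of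
  order \<open>t\<^sup>2 * N t\<close>, and \<open>t / (t\<^sup>2 * N t)\<close> need not be
  integrable at 0. Real and imaginary parts are therefore bounded separately, the real part of
  \<open>1 - \<phi> t\<close> by \<open>t\<^sup>2 * (N t - t * N3 t)\<close> and the imaginary part
  by \<open>t ^ 3 * N3 t\<close>, where \<open>N3\<close> is minus the derivative of
  \<open>N\<close>. After inversion and multiplication by \<open>1 - cos (x * t)\<close> or
  \<open>sin (x * t)\<close>, what remains is bounded or a multiple of
  \<open>N3 / N\<^sup>2\<close>, the derivative of \<open>1 / N\<close>; infinite variance makes
  \<open>1 / N\<close> vanish at 0. The smooth cut-off \<open>z\<^sup>2 / (1 + t * z)\<close>
  replaces the integrated tails because it can be differentiated in \<open>t\<close> whatever the
  law is. Single values of the potential on the negative side cannot be read off an oscillating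
  integral. Averages with weights \<open>n - x\<close> can: they turn the sines into a nonnegative
  kernel, and subadditivity then recovers single values from averages.\<close>

definition reg2 :: "'a measure \<Rightarrow> ('a \<Rightarrow> real) \<Rightarrow> real \<Rightarrow> real" where
  "reg2 M Z t = (\<integral>\<omega>. (Z \<omega>)\<^sup>2 / (1 + t * Z \<omega>) \<partial>M)"

text \<open>Minus the derivative of \<open>reg2 M Z\<close>, so that
  \<open>reg2 M Z t - t * reg3 M Z t\<close> is the derivative of \<open>t * reg2 M Z t\<close>. The
  first quantity controls \<open>t * Z - sin (t * Z)\<close>, the second
  \<open>1 - cos (t * Z)\<close>.\<close>

definition reg3 :: "'a measure \<Rightarrow> ('a \<Rightarrow> real) \<Rightarrow> real \<Rightarrow> real" where
  "reg3 M Z t = (\<integral>\<omega>. (Z \<omega>)^3 / (1 + t * Z \<omega>)\<^sup>2 \<partial>M)"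

lemma frac2_le: "(z::real)\<^sup>2 / (1 + t * z) \<le> z / t" if "z \<ge> 0" "t > 0"
proof -
  have "1 + t * z > 0" using that by (simp add: add_pos_nonneg)
  moreover have "z\<^sup>2 * t \<le> z * (1 + t * z)" using that by (simp add: algebra_simps power2_eq_square)
  ultimately show ?thesis using that by (simp add: pos_divide_le_eq pos_le_divide_eq)
qed

lemma frac3_le: "(z::real)^3 / ((1 + s * z) * (1 + t * z)) \<le> z / (s * t)" if "z \<ge> 0" "s > 0" "t > 0"
proof -
  have "z^3 * (s * t) \<le> z * ((1 + s * z) * (1 + t * z))"
    using that by (simp add: algebra_simps power3_eq_cube)
  moreover have "(1 + s * z) * (1 + t * z) > 0" using that by (simp add: add_pos_nonneg)
  ultimately show ?thesis using that by (simp add: pos_divide_le_eq pos_le_divide_eq)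
qed

lemma frac2_squared: "(z::real)\<^sup>2 / (1 + t * z)\<^sup>2 = z\<^sup>2 / (1 + t * z) - t * (z^3 / (1 + t * z)\<^sup>2)"
  if "1 + t * z > 0"
proof -
  define d where "d = 1 + t * z"
  have d: "d \<noteq> 0" "t * z = d - 1" using that by (auto simp: d_def)
  have "z\<^sup>2 / d - t * (z^3 / d\<^sup>2) = (z\<^sup>2 * d - z\<^sup>2 * (t * z)) / d\<^sup>2"
    using d(1) by (simp add: diff_divide_distrib power2_eq_square power3_eq_cube)
  also have "\<dots> = z\<^sup>2 / d\<^sup>2" unfolding d(2) by (simp add: algebra_simps)
  finally show ?thesis by (simp add: d_def)
qed

lemma frac2_diff: "(z::real)\<^sup>2 / (1 + s * z) - z\<^sup>2 / (1 + t * z) = (s - t) * (- (z^3 / ((1 + s * z) * (1 + t * z))))"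
  if "1 + s * z > 0" "1 + t * z > 0"
proof -
  have "z\<^sup>2 / (1 + s * z) - z\<^sup>2 / (1 + t * z) = (z\<^sup>2 * (1 + t * z) - z\<^sup>2 * (1 + s * z)) / ((1 + s * z) * (1 + t * z))"
    using that by (simp add: diff_frac_eq)
  also have "z\<^sup>2 * (1 + t * z) - z\<^sup>2 * (1 + s * z) = (s - t) * (- (z^3))"
    by (simp add: algebra_simps power2_eq_square power3_eq_cube)
  finally show ?thesis by simp
qed

context
  fixes M :: "'a measure" and Z :: "'a \<Rightarrow> real"
  assumes Z_int: "integrable M Z" and Z_nonneg: "\<And>\<omega>. Z \<omega> \<ge> 0"
begin

lemma Z_meas [measurable]: "Z \<in> borel_measurable M" using Z_int by auto

lemma integrable_frac2: "integrable M (\<lambda>\<omega>. (Z \<omega>)\<^sup>2 / (1 + t * Z \<omega>))" if "t > 0"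
proof (rule Bochner_Integration.integrable_bound)
  show "integrable M (\<lambda>\<omega>. Z \<omega> / t)" using Z_int by simp
  show "AE \<omega> in M. norm ((Z \<omega>)\<^sup>2 / (1 + t * Z \<omega>)) \<le> norm (Z \<omega> / t)"
    using frac2_le[OF Z_nonneg that] Z_nonneg that by (auto simp: abs_of_nonneg)
qed measurable

lemma integrable_frac3: "integrable M (\<lambda>\<omega>. (Z \<omega>)^3 / ((1 + s * Z \<omega>) * (1 + t * Z \<omega>)))" if "s > 0" "t > 0"
proof (rule Bochner_Integration.integrable_bound)
  show "integrable M (\<lambda>\<omega>. Z \<omega> / (s * t))" using Z_int by simp
  show "AE \<omega> in M. norm ((Z \<omega>)^3 / ((1 + s * Z \<omega>) * (1 + t * Z \<omega>))) \<le> norm (Z \<omega> / (s * t))"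
    using frac3_le[OF Z_nonneg that] Z_nonneg that by (auto simp: abs_of_nonneg)
qed measurable

lemma integrable_reg3: "integrable M (\<lambda>\<omega>. (Z \<omega>)^3 / (1 + t * Z \<omega>)\<^sup>2)" if "t > 0"
  using integrable_frac3[OF that that] by (simp add: power2_eq_square)

lemma reg2_nonneg: "t \<ge> 0 \<Longrightarrow> reg2 M Z t \<ge> 0"
  unfolding reg2_def by (rule integral_nonneg_AE) (use Z_nonneg in auto)

lemma reg3_nonneg: "reg3 M Z t \<ge> 0"
  unfolding reg3_def by (rule integral_nonneg_AE) (use Z_nonneg in auto)

lemma reg2_antimono: "reg2 M Z t \<le> reg2 M Z s" if "0 < s" "s \<le> t"
  unfolding reg2_def using that Z_nonneg
  by (intro integral_mono integrable_frac2 divide_left_mono) (auto intro!: mult_right_mono add_pos_nonneg mult_pos_pos)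

text \<open>Together with \<open>reg2_antimono\<close> this allows \<open>reg2\<close> to vary
  between \<open>s\<close> and \<open>t\<close> by at most the factor \<open>t / s\<close>, so it
  can be frozen at an end of an interval.\<close>

lemma reg2_mult_mono: "s * reg2 M Z s \<le> t * reg2 M Z t" if "0 < s" "s \<le> t"
proof -
  have "s * ((Z \<omega>)\<^sup>2 / (1 + s * Z \<omega>)) \<le> t * ((Z \<omega>)\<^sup>2 / (1 + t * Z \<omega>))" for \<omega>
  proof -
    have "s * (Z \<omega>)\<^sup>2 * (1 + t * Z \<omega>) \<le> t * (Z \<omega>)\<^sup>2 * (1 + s * Z \<omega>)"
      using mult_right_mono[OF that(2), of "(Z \<omega>)\<^sup>2"] by (simp add: algebra_simps)
    thus ?thesis using that Z_nonneg[of \<omega>] by (simp add: divide_simps add_pos_nonneg)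
  qed
  hence "(\<integral>\<omega>. s * ((Z \<omega>)\<^sup>2 / (1 + s * Z \<omega>)) \<partial>M) \<le> (\<integral>\<omega>. t * ((Z \<omega>)\<^sup>2 / (1 + t * Z \<omega>)) \<partial>M)"
    using that by (intro integral_mono integrable_mult_right integrable_frac2) auto
  thus ?thesis unfolding reg2_def by (simp only: integral_mult_right_zero)
qed

lemma reg3_le_reg2: "t * reg3 M Z t \<le> reg2 M Z t" if "t > 0"
proof -
  have "t * ((Z \<omega>)^3 / (1 + t * Z \<omega>)\<^sup>2) \<le> (Z \<omega>)\<^sup>2 / (1 + t * Z \<omega>)" for \<omega>
    using that Z_nonneg[of \<omega>] by (simp add: divide_simps add_pos_nonneg power3_eq_cube power2_eq_square algebra_simps)
  hence "(\<integral>\<omega>. t * ((Z \<omega>)^3 / (1 + t * Z \<omega>)\<^sup>2) \<partial>M) \<le> (\<integral>\<omega>. (Z \<omega>)\<^sup>2 / (1 + t * Z \<omega>) \<partial>M)"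
    using that by (intro integral_mono integrable_mult_right integrable_frac2 integrable_reg3) auto
  thus ?thesis unfolding reg2_def reg3_def by (simp only: integral_mult_right_zero)
qed

text \<open>The difference is the mean of \<open>(Z / (1 + t * Z))\<^sup>2\<close>; hence it is
  nonnegative, and it has the shape in which \<open>1 - cos (t * Z)\<close> is bounded.\<close>

lemma reg2_minus_reg3:
  assumes "t > 0"
  shows "integrable M (\<lambda>\<omega>. (Z \<omega>)\<^sup>2 / (1 + t * Z \<omega>)\<^sup>2)"
    and "reg2 M Z t - t * reg3 M Z t = (\<integral>\<omega>. (Z \<omega>)\<^sup>2 / (1 + t * Z \<omega>)\<^sup>2 \<partial>M)"
proof -
  have *: "(Z \<omega>)\<^sup>2 / (1 + t * Z \<omega>)\<^sup>2 = (Z \<omega>)\<^sup>2 / (1 + t * Z \<omega>) - t * ((Z \<omega>)^3 / (1 + t * Z \<omega>)\<^sup>2)" for \<omega>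
    using frac2_squared assms Z_nonneg[of \<omega>] by (simp add: add_pos_nonneg)
  have i: "integrable M (\<lambda>\<omega>. (Z \<omega>)\<^sup>2 / (1 + t * Z \<omega>))" "integrable M (\<lambda>\<omega>. t * ((Z \<omega>)^3 / (1 + t * Z \<omega>)\<^sup>2))"
    by (intro integrable_frac2 integrable_mult_right integrable_reg3 assms)+
  show "integrable M (\<lambda>\<omega>. (Z \<omega>)\<^sup>2 / (1 + t * Z \<omega>)\<^sup>2)"
    unfolding * using i by (rule Bochner_Integration.integrable_diff)
  show "reg2 M Z t - t * reg3 M Z t = (\<integral>\<omega>. (Z \<omega>)\<^sup>2 / (1 + t * Z \<omega>)\<^sup>2 \<partial>M)"
    unfolding * using Bochner_Integration.integral_diff[OF i]
    by (simp only: reg2_def reg3_def integral_mult_right_zero)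
qed

text \<open>By \<open>frac2_diff\<close> the difference quotient is itself an expectation, so only
  dominated convergence is left.\<close>

lemma reg2_has_derivative:
  assumes t: "t > 0"
  shows "(reg2 M Z has_real_derivative - reg3 M Z t) (at t)"
proof -
  have "((\<lambda>s. (reg2 M Z s - reg2 M Z t) / (s - t)) \<longlongrightarrow> - reg3 M Z t) (at t)"
    unfolding tendsto_at_iff_sequentially
  proof (intro allI impI)
    fix X :: "nat \<Rightarrow> real"
    assume X: "\<forall>i. X i \<in> UNIV - {t}" and lim: "X \<longlonglongrightarrow> t"
    have ev: "\<forall>\<^sub>F n in sequentially. X n > t / 2"
      using order_tendstoD(1)[OF lim, of "t/2"] t by simp
    have eq: "(reg2 M Z s - reg2 M Z t) / (s - t) = (\<integral>\<omega>. - ((Z \<omega>)^3 / ((1 + s * Z \<omega>) * (1 + t * Z \<omega>))) \<partial>M)"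
      if s: "s > 0" "s \<noteq> t" for s
    proof -
      have "reg2 M Z s - reg2 M Z t = (\<integral>\<omega>. (Z \<omega>)\<^sup>2 / (1 + s * Z \<omega>) - (Z \<omega>)\<^sup>2 / (1 + t * Z \<omega>) \<partial>M)"
        unfolding reg2_def using s t integrable_frac2 by (subst Bochner_Integration.integral_diff) auto
      also have "\<dots> = (\<integral>\<omega>. (s - t) * (- ((Z \<omega>)^3 / ((1 + s * Z \<omega>) * (1 + t * Z \<omega>)))) \<partial>M)"
      proof (rule Bochner_Integration.integral_cong[OF refl])
        fix \<omega>
        have "1 + t * Z \<omega> > 0" "1 + s * Z \<omega> > 0" using s t Z_nonneg[of \<omega>] by (simp_all add: add_pos_nonneg)
        thus "(Z \<omega>)\<^sup>2 / (1 + s * Z \<omega>) - (Z \<omega>)\<^sup>2 / (1 + t * Z \<omega>) = (s - t) * (- ((Z \<omega>)^3 / ((1 + s * Z \<omega>) * (1 + t * Z \<omega>))))"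
          by (rule frac2_diff[rotated])
      qed
      also have "\<dots> = (s - t) * (\<integral>\<omega>. - ((Z \<omega>)^3 / ((1 + s * Z \<omega>) * (1 + t * Z \<omega>))) \<partial>M)"
        by (rule integral_mult_right_zero)
      finally show ?thesis using s by (metis nonzero_mult_div_cancel_left right_minus_eq)
    qed
    \<comment> \<open>Taking the maximum with \<open>t/2\<close> changes the sequence at finitely
      many places only and makes \<open>Z / (t/2 * t)\<close> dominate every term.\<close>
    have main: "(\<lambda>n. \<integral>\<omega>. - ((Z \<omega>)^3 / ((1 + (max (X n) (t/2)) * Z \<omega>) * (1 + t * Z \<omega>))) \<partial>M) \<longlonglongrightarrow>
        (\<integral>\<omega>. - ((Z \<omega>)^3 / ((1 + t * Z \<omega>) * (1 + t * Z \<omega>))) \<partial>M)"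
    proof (rule integral_dominated_convergence[where w="\<lambda>\<omega>. Z \<omega> / (t/2 * t)"])
      show "integrable M (\<lambda>\<omega>. Z \<omega> / (t/2 * t))" using Z_int by simp
      have lim': "(\<lambda>n. max (X n) (t/2)) \<longlonglongrightarrow> t"
        using tendsto_max[OF lim tendsto_const[of "t/2"]] t by simp
      show "AE \<omega> in M. (\<lambda>n. - ((Z \<omega>)^3 / ((1 + (max (X n) (t/2)) * Z \<omega>) * (1 + t * Z \<omega>)))) \<longlonglongrightarrow>
        - ((Z \<omega>)^3 / ((1 + t * Z \<omega>) * (1 + t * Z \<omega>)))"
      proof (rule AE_I2)
        fix \<omega>
        have "1 + t * Z \<omega> > 0" using t Z_nonneg[of \<omega>] by (simp add: add_pos_nonneg)
        thus "(\<lambda>n. - ((Z \<omega>)^3 / ((1 + (max (X n) (t/2)) * Z \<omega>) * (1 + t * Z \<omega>)))) \<longlonglongrightarrow>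
          - ((Z \<omega>)^3 / ((1 + t * Z \<omega>) * (1 + t * Z \<omega>)))"
          by (intro tendsto_intros lim') auto
      qed
      show "AE \<omega> in M. norm (- ((Z \<omega>)^3 / ((1 + (max (X n) (t/2)) * Z \<omega>) * (1 + t * Z \<omega>)))) \<le> Z \<omega> / (t/2 * t)" for n
      proof (rule AE_I2)
        fix \<omega>
        let ?s = "max (X n) (t/2)"
        have "(Z \<omega>)^3 / ((1 + ?s * Z \<omega>) * (1 + t * Z \<omega>)) \<le> Z \<omega> / (?s * t)"
          using frac3_le[OF Z_nonneg[of \<omega>], of ?s t] t by auto
        also have "\<dots> \<le> Z \<omega> / (t/2 * t)"
          using t Z_nonneg[of \<omega>] by (intro divide_left_mono mult_right_mono) (auto intro!: mult_pos_pos)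
        finally show "norm (- ((Z \<omega>)^3 / ((1 + ?s * Z \<omega>) * (1 + t * Z \<omega>)))) \<le> Z \<omega> / (t/2 * t)"
          using t Z_nonneg[of \<omega>] by (auto simp: abs_of_nonneg)
      qed
    qed measurable
    have "(\<lambda>n. (reg2 M Z (X n) - reg2 M Z t) / (X n - t)) \<longlonglongrightarrow> - reg3 M Z t"
    proof (rule Lim_transform_eventually)
      show "(\<lambda>n. \<integral>\<omega>. - ((Z \<omega>)^3 / ((1 + (max (X n) (t/2)) * Z \<omega>) * (1 + t * Z \<omega>))) \<partial>M) \<longlonglongrightarrow> - reg3 M Z t"
        using main by (simp add: reg3_def power2_eq_square)
      show "\<forall>\<^sub>F n in sequentially. (\<integral>\<omega>. - ((Z \<omega>)^3 / ((1 + (max (X n) (t/2)) * Z \<omega>) * (1 + t * Z \<omega>))) \<partial>M)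
          = (reg2 M Z (X n) - reg2 M Z t) / (X n - t)"
        using ev
      proof eventually_elim
        case (elim n)
        thus ?case using eq[of "X n"] X t by (simp add: max_def)
      qed
    qed
    thus "((\<lambda>s. (reg2 M Z s - reg2 M Z t) / (s - t)) \<circ> X) \<longlonglongrightarrow> - reg3 M Z t"
      by (simp add: o_def)
  qed
  thus ?thesis by (simp add: has_field_derivative_iff)
qed

lemma reg2_mult_tendsto_0: "((\<lambda>t. t * reg2 M Z t) \<longlongrightarrow> 0) (at_right 0)"
  unfolding tendsto_at_iff_sequentially
proof (intro allI impI)
  fix X :: "nat \<Rightarrow> real"
  assume X: "\<forall>i. X i \<in> {0<..} - {0}" and lim: "X \<longlonglongrightarrow> 0"
  have Xp: "X n > 0" for n using X by auto
  have "(\<lambda>n. \<integral>\<omega>. X n * ((Z \<omega>)\<^sup>2 / (1 + X n * Z \<omega>)) \<partial>M) \<longlonglongrightarrow> (\<integral>\<omega>. 0 \<partial>M)"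
  proof (rule integral_dominated_convergence[where w=Z])
    show "integrable M Z" by (rule Z_int)
    show "AE \<omega> in M. (\<lambda>n. X n * ((Z \<omega>)\<^sup>2 / (1 + X n * Z \<omega>))) \<longlonglongrightarrow> 0"
    proof (rule AE_I2)
      fix \<omega>
      have "(\<lambda>n. X n * ((Z \<omega>)\<^sup>2 / (1 + X n * Z \<omega>))) \<longlonglongrightarrow> 0 * ((Z \<omega>)\<^sup>2 / (1 + 0 * Z \<omega>))"
        by (intro tendsto_intros lim) auto
      thus "(\<lambda>n. X n * ((Z \<omega>)\<^sup>2 / (1 + X n * Z \<omega>))) \<longlonglongrightarrow> 0" by simp
    qed
    show "AE \<omega> in M. norm (X n * ((Z \<omega>)\<^sup>2 / (1 + X n * Z \<omega>))) \<le> Z \<omega>" for n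
      using frac2_le[OF Z_nonneg Xp[of n]] Xp[of n] Z_nonneg
      by (intro AE_I2) (simp add: abs_of_nonneg field_simps add_pos_nonneg)
  qed measurable
  thus "((\<lambda>t. t * reg2 M Z t) \<circ> X) \<longlonglongrightarrow> 0"
    unfolding o_def reg2_def integral_mult_right_zero by simp
qed

text \<open>Otherwise monotonicity bounds \<open>reg2\<close> on the whole positive axis, and
  Fatou's lemma along \<open>t = 1 / Suc n\<close> makes the second moment finite.\<close>

lemma reg2_at_top:
  assumes inf: "(\<integral>\<^sup>+\<omega>. ennreal ((Z \<omega>)\<^sup>2) \<partial>M) = \<infinity>"
  shows "filterlim (reg2 M Z) at_top (at_right 0)"
proof -
  have "\<exists>s>0. \<forall>t. 0 < t \<longrightarrow> t < s \<longrightarrow> reg2 M Z t \<ge> B" for B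
  proof (rule ccontr)
    assume "\<not> ?thesis"
    hence bad: "\<And>s. s > 0 \<Longrightarrow> \<exists>t. 0 < t \<and> t < s \<and> reg2 M Z t < B" by force
    have bd: "reg2 M Z s \<le> B" if "s > 0" for s
      using bad[OF that] reg2_antimono[of _ s] that by (meson less_imp_le order_trans)
    have le: "(\<integral>\<^sup>+\<omega>. ennreal ((Z \<omega>)\<^sup>2 / (1 + (1 / Suc n) * Z \<omega>)) \<partial>M) \<le> ennreal B" for n
    proof -
      have "(\<integral>\<^sup>+\<omega>. ennreal ((Z \<omega>)\<^sup>2 / (1 + (1 / Suc n) * Z \<omega>)) \<partial>M) = ennreal (reg2 M Z (1 / Suc n))"
        unfolding reg2_def using Z_nonneg by (intro nn_integral_eq_integral integrable_frac2) auto
      also have "\<dots> \<le> ennreal B" using bd[of "1 / Suc n"] by (intro ennreal_leI) auto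
      finally show ?thesis .
    qed
    have "(\<integral>\<^sup>+\<omega>. ennreal ((Z \<omega>)\<^sup>2) \<partial>M) = (\<integral>\<^sup>+\<omega>. liminf (\<lambda>n. ennreal ((Z \<omega>)\<^sup>2 / (1 + (1 / Suc n) * Z \<omega>))) \<partial>M)"
    proof (rule nn_integral_cong)
      fix \<omega>
      have "(\<lambda>n. 1 / real (Suc n)) \<longlonglongrightarrow> 0" using LIMSEQ_inverse_real_of_nat by (simp add: inverse_eq_divide)
      hence "(\<lambda>n. (Z \<omega>)\<^sup>2 / (1 + (1 / Suc n) * Z \<omega>)) \<longlonglongrightarrow> (Z \<omega>)\<^sup>2 / (1 + 0 * Z \<omega>)"
        by (intro tendsto_intros) auto
      hence "(\<lambda>n. ennreal ((Z \<omega>)\<^sup>2 / (1 + (1 / Suc n) * Z \<omega>))) \<longlonglongrightarrow> ennreal ((Z \<omega>)\<^sup>2)"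
        by (intro tendsto_ennrealI) simp
      from lim_imp_Liminf[OF _ this] show "ennreal ((Z \<omega>)\<^sup>2) = liminf (\<lambda>n. ennreal ((Z \<omega>)\<^sup>2 / (1 + (1 / Suc n) * Z \<omega>)))"
        by simp
    qed
    also have "\<dots> \<le> liminf (\<lambda>n. \<integral>\<^sup>+\<omega>. ennreal ((Z \<omega>)\<^sup>2 / (1 + (1 / Suc n) * Z \<omega>)) \<partial>M)"
      by (intro nn_integral_liminf) measurable
    also have "\<dots> \<le> ennreal B"
      using le by (intro Liminf_le) auto
    finally show False using inf by (simp add: top_unique)
  qed
  thus ?thesis
    unfolding filterlim_at_top eventually_at_right_field by blast
qed

end

section \<open>Trigonometric bounds and the step distribution\<close>

lemma abs_sin_diff_le: "\<bar>u - sin u\<bar> \<le> \<bar>u\<bar>^3 / 6" for u :: real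
proof -
  have "\<bar>sin u - (\<Sum>m<3. sin_coeff m * u ^ m)\<bar> \<le> inverse (fact 3) * \<bar>u\<bar> ^ 3"
    by (rule Maclaurin_sin_bound)
  thus ?thesis by (simp add: eval_nat_numeral sin_coeff_def abs_minus_commute)
qed

lemma minus_sin_cubic: "u - sin u \<le> u^3 / 6" if "u \<ge> 0" for u :: real
  using abs_sin_diff_le[of u] that by (metis abs_ge_self abs_of_nonneg order_trans)

lemma one_minus_cos_le: "1 - cos u \<le> u\<^sup>2 / 2" for u :: real
proof -
  have "\<bar>sin (u/2)\<bar> \<le> \<bar>u/2\<bar>" by (rule abs_sin_x_le_abs_x)
  hence "(sin (u/2))\<^sup>2 \<le> (u/2)\<^sup>2" by (subst (asm) abs_le_square_iff)
  moreover have "cos u = 1 - 2 * (sin (u/2))\<^sup>2" using cos_double_sin[of "u/2"] by simp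
  ultimately show ?thesis by (simp add: power_divide)
qed

lemma one_minus_cos_ge: "u\<^sup>2 / 3 \<le> 1 - cos u" if "\<bar>u\<bar> \<le> 1" for u :: real
proof -
  have *: "v\<^sup>2 / 3 \<le> 1 - cos v" if v: "0 \<le> v" "v \<le> 1" for v :: real
  proof -
    have "v/2 - sin (v/2) \<le> (v/2)^3/6" using minus_sin_cubic[of "v/2"] v by simp
    moreover have "(v/2)^3 \<le> v/8" using v power_decreasing[of 1 3 v] by (simp add: power_divide)
    ultimately have "sin (v/2) \<ge> 23/48 * v" by simp
    hence "(sin (v/2))\<^sup>2 \<ge> (23/48 * v)\<^sup>2" using v by (intro power_mono) auto
    moreover have "cos v = 1 - 2 * (sin (v/2))\<^sup>2" using cos_double_sin[of "v/2"] by simp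
    moreover have "2 * (23/48 * v)\<^sup>2 \<ge> v\<^sup>2/3" by (simp add: power_mult_distrib power2_eq_square)
    ultimately show ?thesis by simp
  qed
  show ?thesis
    using *[of "\<bar>u\<bar>"] that by (auto simp: abs_if split: if_splits)
qed

text \<open>The constant 8 comes from \<open>u > 1\<close>: there the fraction is only known to
  exceed \<open>1/4\<close>, while \<open>1 - cos u\<close> can reach 2.\<close>

lemma one_minus_cos_upper: "1 - cos u \<le> 8 * (u\<^sup>2 / (1 + u)\<^sup>2)" if "u \<ge> 0" for u :: real
proof (cases "u \<le> 1")
  case True
  have "(1 + u)\<^sup>2 \<le> 2\<^sup>2" using True that by (intro power_mono) auto
  hence "(1 + u)\<^sup>2 \<le> 16" by simp
  hence "u\<^sup>2 * (1 + u)\<^sup>2 \<le> u\<^sup>2 * 16" by (rule mult_left_mono) simp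
  hence "u\<^sup>2 / 2 \<le> 8 * (u\<^sup>2 / (1 + u)\<^sup>2)" using that by (simp add: field_simps)
  thus ?thesis using one_minus_cos_le[of u] by linarith
next
  case False
  hence "(1 + u)\<^sup>2 \<le> (2*u)\<^sup>2" by (intro power_mono) auto
  hence "(1 + u)\<^sup>2 \<le> 4 * u\<^sup>2" by (simp add: power_mult_distrib)
  hence "2 \<le> 8 * (u\<^sup>2 / (1 + u)\<^sup>2)" using that False by (simp add: field_simps)
  thus ?thesis using cos_ge_minus_one[of u] by linarith
qed

lemma minus_sin_nonneg: "0 \<le> u - sin u" if "u \<ge> 0" for u :: real
  using sin_x_le_x[OF that] by simp

text \<open>Again 8 is dictated by \<open>u > 1\<close>, where the fraction is at least
  \<open>u / 4\<close> and \<open>u - sin u\<close> at most \<open>2 * u\<close>.\<close>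

lemma minus_sin_upper: "u - sin u \<le> 8 * (u^3 / (1 + u)\<^sup>2)" if "u \<ge> 0" for u :: real
proof (cases "u \<le> 1")
  case True
  have "(1 + u)\<^sup>2 \<le> 2\<^sup>2" using True that by (intro power_mono) auto
  hence "u^3 * (1 + u)\<^sup>2 \<le> 4 * u^3" using mult_left_mono[of "(1+u)\<^sup>2" 4 "u^3"] that by simp
  hence "u^3 * (1 + u)\<^sup>2 \<le> 48 * u^3" using that zero_le_power[of u 3] by linarith
  hence "u^3 / 6 \<le> 8 * (u^3 / (1 + u)\<^sup>2)" using that by (simp add: field_simps)
  thus ?thesis using minus_sin_cubic[OF that] by linarith
next
  case False
  hence "(1 + u)\<^sup>2 \<le> (2*u)\<^sup>2" by (intro power_mono) auto
  hence "(1 + u)\<^sup>2 \<le> 4 * u\<^sup>2" by (simp add: power_mult_distrib)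
  hence "2 * u * (1 + u)\<^sup>2 \<le> 2 * u * (4 * u\<^sup>2)" using that by (intro mult_left_mono) auto
  also have "\<dots> = 8 * u^3" by (simp add: power3_eq_cube power2_eq_square)
  finally have "2 * u \<le> 8 * (u^3 / (1 + u)\<^sup>2)" using that False by (simp add: field_simps)
  moreover have "u - sin u \<le> 2 * u" using False sin_ge_minus_one[of u] by linarith
  ultimately show ?thesis by linarith
qed

text \<open>Neither summand suffices alone: \<open>1 - cos u\<close> vanishes at multiples of
  \<open>2 * pi\<close>, and \<open>u - sin u\<close> is only cubic at 0. The cosine is used up to
  2, the linear growth of \<open>u - sin u\<close> beyond.\<close>

lemma cos_sin_lower: "u\<^sup>2 / (1 + u) / 4 \<le> (1 - cos u) + (u - sin u)" if "u \<ge> 0" for u :: real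
proof -
  define q where "q = u\<^sup>2 / (1 + u)"
  consider "u \<le> 1" | "1 < u" "u \<le> 2" | "u > 2" by linarith
  hence "q / 4 \<le> (1 - cos u) + (u - sin u)"
  proof cases
    case 1
    have "q \<le> u\<^sup>2 / 1" unfolding q_def using that by (intro divide_left_mono) auto
    hence "q / 4 \<le> u\<^sup>2 / 3" using zero_le_power2[of u] by linarith
    thus ?thesis using one_minus_cos_ge[of u] minus_sin_nonneg[OF that] 1 that by linarith
  next
    case 2
    have "u\<^sup>2 \<le> 4/3 * (1 + u)"
    proof -
      have "(u - 2) * (3 * u + 2) \<le> 0" using 2 by (intro mult_nonpos_nonneg) auto
      thus ?thesis by (simp add: algebra_simps power2_eq_square)
    qed
    hence "q \<le> 4/3" unfolding q_def using that by (simp add: pos_divide_le_eq)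
    moreover have "cos u \<le> cos 1" using 2 pi_gt3 by (intro cos_monotone_0_pi_le) auto
    moreover have "1/3 \<le> 1 - cos (1::real)" using one_minus_cos_ge[of 1] by simp
    ultimately show ?thesis using minus_sin_nonneg[OF that] by linarith
  next
    case 3
    have "u\<^sup>2 \<le> u * (1 + u)" using that by (simp add: power2_eq_square algebra_simps)
    hence "q \<le> u" unfolding q_def using that by (simp add: pos_divide_le_eq)
    moreover have "u - sin u \<ge> u / 2" using sin_le_one[of u] 3 by linarith
    ultimately show ?thesis using cos_le_one[of u] 3 by linarith
  qed
  thus ?thesis by (simp add: q_def)
qed

context prob_space
begin

lemma cos_sin_bounds:
  assumes Z: "integrable M Z" "\<And>\<omega>. Z \<omega> \<ge> 0" and t: "t > 0"
  shows "integrable M (\<lambda>\<omega>. 1 - cos (t * Z \<omega>))"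
    and "integrable M (\<lambda>\<omega>. t * Z \<omega> - sin (t * Z \<omega>))"
    and "0 \<le> expectation (\<lambda>\<omega>. 1 - cos (t * Z \<omega>))"
    and "0 \<le> expectation (\<lambda>\<omega>. t * Z \<omega> - sin (t * Z \<omega>))"
    and "expectation (\<lambda>\<omega>. 1 - cos (t * Z \<omega>)) \<le> 8 * t\<^sup>2 * (reg2 M Z t - t * reg3 M Z t)"
    and "expectation (\<lambda>\<omega>. t * Z \<omega> - sin (t * Z \<omega>)) \<le> 8 * t^3 * reg3 M Z t"
    and "t\<^sup>2 * reg2 M Z t / 4 \<le> expectation (\<lambda>\<omega>. 1 - cos (t * Z \<omega>)) + expectation (\<lambda>\<omega>. t * Z \<omega> - sin (t * Z \<omega>))"
proof -
  have [measurable]: "Z \<in> borel_measurable M" using Z(1) by auto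
  have tz: "t * Z \<omega> \<ge> 0" for \<omega> using t Z(2)[of \<omega>] by simp
  show ic: "integrable M (\<lambda>\<omega>. 1 - cos (t * Z \<omega>))"
    by (rule integrable_const_bound[where B=2]) (auto intro!: AE_I2 simp: abs_if intro: order_trans[OF cos_le_one])
  have isn: "integrable M (\<lambda>\<omega>. sin (t * Z \<omega>))"
    by (rule integrable_const_bound[where B=1]) auto
  show is': "integrable M (\<lambda>\<omega>. t * Z \<omega> - sin (t * Z \<omega>))" using Z(1) isn by simp
  show "0 \<le> expectation (\<lambda>\<omega>. 1 - cos (t * Z \<omega>))" by (rule integral_nonneg_AE) simp
  show "0 \<le> expectation (\<lambda>\<omega>. t * Z \<omega> - sin (t * Z \<omega>))"
    by (rule integral_nonneg_AE) (use minus_sin_nonneg[OF tz] in simp)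
  have "expectation (\<lambda>\<omega>. 1 - cos (t * Z \<omega>)) \<le> expectation (\<lambda>\<omega>. 8 * t\<^sup>2 * ((Z \<omega>)\<^sup>2 / (1 + t * Z \<omega>)\<^sup>2))"
    using one_minus_cos_upper[OF tz] reg2_minus_reg3(1)[OF Z t] ic
    by (intro integral_mono integrable_mult_right) (auto simp: power_mult_distrib mult.assoc)
  thus "expectation (\<lambda>\<omega>. 1 - cos (t * Z \<omega>)) \<le> 8 * t\<^sup>2 * (reg2 M Z t - t * reg3 M Z t)"
    unfolding reg2_minus_reg3(2)[OF Z t] integral_mult_right_zero .
  have "expectation (\<lambda>\<omega>. t * Z \<omega> - sin (t * Z \<omega>)) \<le> expectation (\<lambda>\<omega>. 8 * t^3 * ((Z \<omega>)^3 / (1 + t * Z \<omega>)\<^sup>2))"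
    using minus_sin_upper[OF tz] integrable_reg3[OF Z t] is'
    by (intro integral_mono integrable_mult_right) (auto simp: power_mult_distrib mult.assoc)
  thus "expectation (\<lambda>\<omega>. t * Z \<omega> - sin (t * Z \<omega>)) \<le> 8 * t^3 * reg3 M Z t"
    unfolding reg3_def integral_mult_right_zero .
  have lower: "t\<^sup>2 / 4 * ((Z \<omega>)\<^sup>2 / (1 + t * Z \<omega>)) \<le> (1 - cos (t * Z \<omega>)) + (t * Z \<omega> - sin (t * Z \<omega>))" for \<omega>
  proof -
    have "t\<^sup>2 / 4 * ((Z \<omega>)\<^sup>2 / (1 + t * Z \<omega>)) = (t * Z \<omega>)\<^sup>2 / (1 + t * Z \<omega>) / 4"
      by (simp add: power_mult_distrib)
    thus ?thesis using cos_sin_lower[OF tz[of \<omega>]] by simp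
  qed
  have "expectation (\<lambda>\<omega>. t\<^sup>2 / 4 * ((Z \<omega>)\<^sup>2 / (1 + t * Z \<omega>))) \<le> expectation (\<lambda>\<omega>. (1 - cos (t * Z \<omega>)) + (t * Z \<omega> - sin (t * Z \<omega>)))"
    by (intro integral_mono integrable_mult_right Bochner_Integration.integrable_add integrable_frac2[OF Z t] is' ic lower)
  hence "t\<^sup>2 / 4 * reg2 M Z t \<le> expectation (\<lambda>\<omega>. (1 - cos (t * Z \<omega>)) + (t * Z \<omega> - sin (t * Z \<omega>)))"
    unfolding reg2_def integral_mult_right_zero .
  also have "\<dots> = expectation (\<lambda>\<omega>. 1 - cos (t * Z \<omega>)) + expectation (\<lambda>\<omega>. t * Z \<omega> - sin (t * Z \<omega>))"
    by (rule Bochner_Integration.integral_add[OF ic is'])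
  finally show "t\<^sup>2 * reg2 M Z t / 4 \<le> expectation (\<lambda>\<omega>. 1 - cos (t * Z \<omega>)) + expectation (\<lambda>\<omega>. t * Z \<omega> - sin (t * Z \<omega>))" by simp
qed

end

text \<open>All analytic arguments depend on the law of one step. \<open>ratio\<close> is the
  hypothesis on the integrated tails, rewritten at \<open>t = 1/x\<close>; \<open>nonlattice\<close>
  is what irreducibility says about the characteristic function.\<close>

locale step = prob_space M for M :: "'a measure" +
  fixes Y :: "'a \<Rightarrow> int"
  assumes Y_meas [measurable]: "Y \<in> measurable M (count_space UNIV)"
    and Y_int: "integrable M (\<lambda>\<omega>. real_of_int (Y \<omega>))"
    and Y_mean: "expectation (\<lambda>\<omega>. real_of_int (Y \<omega>)) = 0"
    and Y_sq: "(\<integral>\<^sup>+\<omega>. ennreal ((real_of_int (Y \<omega>))\<^sup>2) \<partial>M) = \<infinity>"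
    and ratio: "((\<lambda>t. reg2 M (\<lambda>\<omega>. max 0 (real_of_int (Y \<omega>))) t / reg2 M (\<lambda>\<omega>. \<bar>real_of_int (Y \<omega>)\<bar>) t) \<longlongrightarrow> 0) (at_right 0)"
    and pos: "prob {\<omega> \<in> space M. Y \<omega> \<ge> 1} > 0"
    and nonlattice: "\<And>t. 0 < t \<Longrightarrow> t \<le> pi \<Longrightarrow> (\<integral>\<omega>. cis (t * real_of_int (Y \<omega>)) \<partial>M) \<noteq> 1"
begin

definition Yp :: "'a \<Rightarrow> real" where "Yp \<omega> = max 0 (real_of_int (Y \<omega>))"
definition Ym :: "'a \<Rightarrow> real" where "Ym \<omega> = max 0 (- real_of_int (Y \<omega>))"
definition Ya :: "'a \<Rightarrow> real" where "Ya \<omega> = \<bar>real_of_int (Y \<omega>)\<bar>"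

lemma Y_meas' [measurable]: "(\<lambda>\<omega>. real_of_int (Y \<omega>)) \<in> borel_measurable M" using Y_int by auto

lemma Yp_int: "integrable M Yp" and Ym_int: "integrable M Ym" and Ya_int: "integrable M Ya"
  unfolding Yp_def[abs_def] Ym_def[abs_def] Ya_def[abs_def] using Y_int by auto

lemma Y_parts_meas [measurable]: "Yp \<in> borel_measurable M" "Ym \<in> borel_measurable M" "Ya \<in> borel_measurable M"
  using Yp_int Ym_int Ya_int by auto

lemma Yp_nonneg: "Yp \<omega> \<ge> 0" and Ym_nonneg: "Ym \<omega> \<ge> 0" and Ya_nonneg: "Ya \<omega> \<ge> 0"
  by (auto simp: Yp_def Ym_def Ya_def)

lemma Y_decomp: "real_of_int (Y \<omega>) = Yp \<omega> - Ym \<omega>" by (auto simp: Yp_def Ym_def)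

abbreviation "N \<equiv> reg2 M Ya"
abbreviation "Np \<equiv> reg2 M Yp"
abbreviation "Nm \<equiv> reg2 M Ym"
abbreviation "N3 \<equiv> reg3 M Ya"
abbreviation "N3p \<equiv> reg3 M Yp"
abbreviation "N3m \<equiv> reg3 M Ym"

lemma N_split: "N t = Np t + Nm t" if "t > 0"
proof -
  have "N t = (\<integral>\<omega>. (Yp \<omega>)\<^sup>2 / (1 + t * Yp \<omega>) + (Ym \<omega>)\<^sup>2 / (1 + t * Ym \<omega>) \<partial>M)"
    unfolding reg2_def by (rule Bochner_Integration.integral_cong) (auto simp: Yp_def Ym_def Ya_def max_def)
  also have "\<dots> = Np t + Nm t"
    unfolding reg2_def by (intro Bochner_Integration.integral_add integrable_frac2 Yp_int Ym_int Yp_nonneg Ym_nonneg that)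
  finally show ?thesis .
qed

lemma N3_split: "N3 t = N3p t + N3m t" if "t > 0"
proof -
  have "N3 t = (\<integral>\<omega>. (Yp \<omega>)^3 / (1 + t * Yp \<omega>)\<^sup>2 + (Ym \<omega>)^3 / (1 + t * Ym \<omega>)\<^sup>2 \<partial>M)"
    unfolding reg3_def by (rule Bochner_Integration.integral_cong) (auto simp: Yp_def Ym_def Ya_def max_def)
  also have "\<dots> = N3p t + N3m t"
    unfolding reg3_def by (intro Bochner_Integration.integral_add integrable_reg3 Yp_int Ym_int Yp_nonneg Ym_nonneg that)
  finally show ?thesis .
qed

lemmas N_nonneg = reg2_nonneg[OF Ya_int Ya_nonneg] and Np_nonneg = reg2_nonneg[OF Yp_int Yp_nonneg]
  and Nm_nonneg = reg2_nonneg[OF Ym_int Ym_nonneg]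
  and N3_nonneg = reg3_nonneg[OF Ya_int Ya_nonneg] and N3p_nonneg = reg3_nonneg[OF Yp_int Yp_nonneg]
  and N3m_nonneg = reg3_nonneg[OF Ym_int Ym_nonneg]

lemma N_at_top: "filterlim N at_top (at_right 0)"
  by (rule reg2_at_top[OF Ya_int Ya_nonneg]) (use Y_sq in \<open>simp add: Ya_def\<close>)

lemma ratio': "((\<lambda>t. Np t / N t) \<longlongrightarrow> 0) (at_right 0)"
  using ratio by (simp add: Yp_def[abs_def] Ya_def[abs_def])

definition e where "e = expectation Yp"

lemma e_eq: "e = expectation Ym"
proof -
  have "expectation (\<lambda>\<omega>. real_of_int (Y \<omega>)) = expectation Yp - expectation Ym"
    unfolding Y_decomp by (rule Bochner_Integration.integral_diff[OF Yp_int Ym_int])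
  thus ?thesis using Y_mean by (simp add: e_def)
qed

lemma not_AE_Yp_0: "\<not> (AE \<omega> in M. Yp \<omega> = 0)"
proof
  assume "AE \<omega> in M. Yp \<omega> = 0"
  hence "AE \<omega> in M. \<not> Y \<omega> \<ge> 1" by eventually_elim (auto simp: Yp_def max_def split: if_splits)
  hence "prob {\<omega> \<in> space M. Y \<omega> \<ge> 1} = 0" by (subst prob_eq_0) auto
  thus False using pos by simp
qed

lemma e_pos: "e > 0"
proof -
  have "e \<ge> 0" unfolding e_def by (rule integral_nonneg_AE) (simp add: Yp_nonneg)
  moreover have "e \<noteq> 0"
    unfolding e_def using integral_nonneg_eq_0_iff_AE[OF Yp_int] Yp_nonneg not_AE_Yp_0 by auto
  ultimately show ?thesis by simp
qed

text \<open>The quantity decreases in \<open>t\<close>, and its value at \<open>pi\<close> is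
  positive because positive jumps occur. With \<open>N3p_lower\<close> it allows the terms of order
  \<open>t\<^sup>2\<close> and \<open>t ^ 3\<close> contributed by jumps \<open>+1\<close> to be
  absorbed in bounds that involve positive jumps only.\<close>

lemma Np_minus_N3p_lower: "\<exists>c>0. \<forall>t. 0 < t \<longrightarrow> t \<le> pi \<longrightarrow> c \<le> Np t - t * N3p t"
proof (intro exI conjI allI impI)
  let ?f = "\<lambda>t \<omega>. (Yp \<omega>)\<^sup>2 / (1 + t * Yp \<omega>)\<^sup>2"
  note [simp] = add_pos_nonneg
  have i: "integrable M (?f t)" if "t > 0" for t by (rule reg2_minus_reg3(1)[OF Yp_int Yp_nonneg that])
  have "?f pi \<omega> = 0 \<longleftrightarrow> Yp \<omega> = 0" for \<omega>
  proof -
    have "1 + pi * Yp \<omega> > 0" using Yp_nonneg[of \<omega>] by (simp add: add_pos_nonneg)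
    thus ?thesis by simp
  qed
  hence "expectation (?f pi) \<noteq> 0"
    using integral_nonneg_eq_0_iff_AE[OF i[OF pi_gt_zero]] not_AE_Yp_0 by auto
  moreover have "expectation (?f pi) \<ge> 0" by (rule integral_nonneg_AE) simp
  ultimately show "expectation (?f pi) > 0" by (metis less_eq_real_def)
  fix t :: real assume t: "0 < t" "t \<le> pi"
  show "expectation (?f pi) \<le> Np t - t * N3p t"
    unfolding reg2_minus_reg3(2)[OF Yp_int Yp_nonneg t(1)]
  proof (intro integral_mono i t pi_gt_zero)
    fix \<omega>
    have "0 < 1 + t * Yp \<omega>" using t Yp_nonneg[of \<omega>] by simp
    moreover have "1 + t * Yp \<omega> \<le> 1 + pi * Yp \<omega>" using t Yp_nonneg[of \<omega>] by (simp add: mult_right_mono)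
    ultimately show "?f pi \<omega> \<le> ?f t \<omega>" by (intro divide_left_mono power_mono mult_pos_pos) auto
  qed
qed

lemma N3p_lower: "\<exists>c>0. \<forall>t. 0 < t \<longrightarrow> t \<le> pi \<longrightarrow> c \<le> N3p t"
proof (intro exI conjI allI impI)
  let ?f = "\<lambda>t \<omega>. (Yp \<omega>)^3 / (1 + t * Yp \<omega>)\<^sup>2"
  have i: "integrable M (?f t)" if "t > 0" for t by (rule integrable_reg3[OF Yp_int Yp_nonneg that])
  have "?f pi \<omega> = 0 \<longleftrightarrow> Yp \<omega> = 0" for \<omega>
  proof -
    have "1 + pi * Yp \<omega> > 0" using Yp_nonneg[of \<omega>] by (simp add: add_pos_nonneg)
    thus ?thesis by simp
  qed
  hence "expectation (?f pi) \<noteq> 0"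
    using integral_nonneg_eq_0_iff_AE[OF i[OF pi_gt_zero]] not_AE_Yp_0 Yp_nonneg by auto
  moreover have "expectation (?f pi) \<ge> 0" by (rule integral_nonneg_AE) (simp add: Yp_nonneg)
  ultimately show "expectation (?f pi) > 0" by (metis less_eq_real_def)
  fix t :: real assume t: "0 < t" "t \<le> pi"
  show "expectation (?f pi) \<le> N3p t"
    unfolding reg3_def
  proof (intro integral_mono i t pi_gt_zero)
    fix \<omega>
    have "0 < 1 + t * Yp \<omega>" using t Yp_nonneg[of \<omega>] by (simp add: add_pos_nonneg)
    moreover have "1 + t * Yp \<omega> \<le> 1 + pi * Yp \<omega>" using t Yp_nonneg[of \<omega>] by (simp add: mult_right_mono)
    ultimately show "?f pi \<omega> \<le> ?f t \<omega>" using Yp_nonneg by (intro divide_left_mono power_mono mult_pos_pos) auto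
  qed
qed

section \<open>Size of one minus the characteristic function\<close>

definition \<phi> :: "real \<Rightarrow> complex" where "\<phi> t = (\<integral>\<omega>. cis (t * real_of_int (Y \<omega>)) \<partial>M)"

abbreviation "w t \<equiv> 1 - \<phi> t"

definition "Cp t = expectation (\<lambda>\<omega>. 1 - cos (t * Yp \<omega>))"
definition "Cm t = expectation (\<lambda>\<omega>. 1 - cos (t * Ym \<omega>))"
definition "Sp t = expectation (\<lambda>\<omega>. t * Yp \<omega> - sin (t * Yp \<omega>))"
definition "Sm t = expectation (\<lambda>\<omega>. t * Ym \<omega> - sin (t * Ym \<omega>))"

text \<open>Up to the factor \<open>e + P(Y < 0)\<close>, \<open>b\<close> is \<open>1 -\<close> the characteristic function of the
  right-continuous walk with the same negative jumps whose only positive jump is \<open>+1\<close>.\<close>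
definition b :: "real \<Rightarrow> complex" where "b t = Complex (Cm t + e * (1 - cos t)) (e * (t - sin t) - Sm t)"

lemma cis_measurable [measurable (raw)]: "f \<in> borel_measurable K \<Longrightarrow> (\<lambda>x. cis (f x)) \<in> borel_measurable K"
  by (simp add: borel_measurable_complex_iff)

lemma integrable_cis: "integrable M (\<lambda>\<omega>. cis (f \<omega>))" if "f \<in> borel_measurable M"
  using that by (intro integrable_const_bound[where B=1]) auto

lemma \<phi>_eq_char: "\<phi> = char (distr M borel (\<lambda>\<omega>. real_of_int (Y \<omega>)))"
  by (rule ext) (simp add: \<phi>_def char_def integral_distr cis_conv_exp)

lemma isCont_\<phi>: "isCont \<phi> t"
  unfolding \<phi>_eq_char by (intro real_distribution.isCont_char real_distribution_distr) measurable

lemma \<phi>_meas [measurable]: "\<phi> \<in> borel_measurable borel"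
  by (intro borel_measurable_continuous_onI continuous_at_imp_continuous_on ballI isCont_\<phi>)

lemma norm_\<phi>: "norm (\<phi> t) \<le> 1"
proof -
  have "norm (\<phi> t) \<le> (\<integral>\<omega>. norm (cis (t * real_of_int (Y \<omega>))) \<partial>M)"
    unfolding \<phi>_def by (rule integral_norm_bound)
  thus ?thesis by (simp add: prob_space)
qed

lemma Re_\<phi>: "Re (\<phi> t) = expectation (\<lambda>\<omega>. cos (t * real_of_int (Y \<omega>)))"
  and Im_\<phi>: "Im (\<phi> t) = expectation (\<lambda>\<omega>. sin (t * real_of_int (Y \<omega>)))"
  unfolding \<phi>_def by (simp_all add: integral_Re[symmetric] integral_Im[symmetric] integrable_cis)

lemmas Yp_bounds = cos_sin_bounds[OF Yp_int Yp_nonneg] and Ym_bounds = cos_sin_bounds[OF Ym_int Ym_nonneg]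

lemma Re_w: "Re (w t) = Cp t + Cm t" if t: "t > 0"
proof -
  have "Re (w t) = expectation (\<lambda>\<omega>. 1 - cos (t * real_of_int (Y \<omega>)))"
    unfolding Re_\<phi> minus_complex.sel one_complex.sel
    by (subst Bochner_Integration.integral_diff) (auto simp: prob_space intro!: integrable_const_bound[where B=1])
  also have "\<dots> = expectation (\<lambda>\<omega>. (1 - cos (t * Yp \<omega>)) + (1 - cos (t * Ym \<omega>)))"
    by (rule Bochner_Integration.integral_cong) (auto simp: Yp_def Ym_def max_def)
  also have "\<dots> = Cp t + Cm t"
    unfolding Cp_def Cm_def by (intro Bochner_Integration.integral_add Yp_bounds Ym_bounds t)
  finally show ?thesis .
qed

text \<open>Mean zero permits inserting the linear term \<open>t * Y\<close>, which replaces the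
  sine by its cubic remainder.\<close>

lemma Im_w: "Im (w t) = Sp t - Sm t" if t: "t > 0"
proof -
  have "expectation (\<lambda>\<omega>. t * real_of_int (Y \<omega>)) = 0" by (simp add: Y_mean)
  hence "Im (w t) = expectation (\<lambda>\<omega>. t * real_of_int (Y \<omega>)) - expectation (\<lambda>\<omega>. sin (t * real_of_int (Y \<omega>)))"
    by (simp add: Im_\<phi>)
  also have "\<dots> = expectation (\<lambda>\<omega>. t * real_of_int (Y \<omega>) - sin (t * real_of_int (Y \<omega>)))"
    using Y_int by (intro Bochner_Integration.integral_diff[symmetric]) (auto intro!: integrable_const_bound[where B=1])
  also have "\<dots> = expectation (\<lambda>\<omega>. (t * Yp \<omega> - sin (t * Yp \<omega>)) - (t * Ym \<omega> - sin (t * Ym \<omega>)))"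
    by (rule Bochner_Integration.integral_cong) (auto simp: Yp_def Ym_def max_def)
  also have "\<dots> = Sp t - Sm t"
    unfolding Sp_def Sm_def by (intro Bochner_Integration.integral_diff Yp_bounds Ym_bounds t)
  finally show ?thesis .
qed

lemma CS_nonneg: "0 \<le> Cp t" "0 \<le> Cm t" "0 \<le> Sp t" "0 \<le> Sm t" if "t > 0"
  unfolding Cp_def Cm_def Sp_def Sm_def using Yp_bounds Ym_bounds that by auto

lemma CS_upper:
  assumes "t > 0"
  shows "Cp t \<le> 8 * t\<^sup>2 * (Np t - t * N3p t)" "Cm t \<le> 8 * t\<^sup>2 * (Nm t - t * N3m t)"
    "Sp t \<le> 8 * t^3 * N3p t" "Sm t \<le> 8 * t^3 * N3m t"
  unfolding Cp_def Cm_def Sp_def Sm_def using Yp_bounds Ym_bounds assms by auto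

lemma CS_lower: "t\<^sup>2 * Nm t / 4 \<le> Cm t + Sm t" if "t > 0"
  unfolding Cm_def Sm_def using Ym_bounds that by auto

lemmas N3p_le = reg3_le_reg2[OF Yp_int Yp_nonneg] and N3m_le = reg3_le_reg2[OF Ym_int Ym_nonneg]
  and N3_le = reg3_le_reg2[OF Ya_int Ya_nonneg]

lemma N_pos: "N t > 0" if "0 < t" "t \<le> pi"
proof -
  obtain c where c: "c > 0" "\<forall>t. 0 < t \<longrightarrow> t \<le> pi \<longrightarrow> c \<le> Np t - t * N3p t" using Np_minus_N3p_lower by (elim exE conjE)
  have "c \<le> Np t - t * N3p t" using c(2) that by simp
  moreover have "t * N3p t \<ge> 0" using N3p_nonneg that by simp
  moreover have "Nm t \<ge> 0" using that by (intro Nm_nonneg) simp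
  ultimately show ?thesis using N_split[OF that(1)] c(1) by linarith
qed

lemma Np_le_N: "Np t \<le> N t" and N3p_le_N3: "N3p t \<le> N3 t"
  and N2p_le_N2: "Np t - t * N3p t \<le> N t - t * N3 t" if "t > 0"
proof -
  have nm: "Nm t \<ge> 0" using that by (intro Nm_nonneg) simp
  show "Np t \<le> N t" "N3p t \<le> N3 t" using N_split[OF that] N3_split[OF that] nm N3m_nonneg[of t] by linarith+
  have "t * N3 t = t * N3p t + t * N3m t" unfolding N3_split[OF that] by (rule distrib_left)
  thus "Np t - t * N3p t \<le> N t - t * N3 t" using N_split[OF that] N3m_le[OF that] by linarith
qed

lemma Np_small: "\<exists>\<delta>>0. \<delta> \<le> pi \<and> (\<forall>t. 0 < t \<longrightarrow> t \<le> \<delta> \<longrightarrow> Np t \<le> \<eta> * N t)" if "\<eta> > 0"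
proof -
  have "\<forall>\<^sub>F t in at_right 0. Np t / N t < \<eta>" by (rule order_tendstoD(2)[OF ratio' that])
  then obtain d where d: "d > 0" "\<And>t. 0 < t \<Longrightarrow> t < d \<Longrightarrow> Np t / N t < \<eta>"
    unfolding eventually_at_right_field by auto
  show ?thesis
  proof (intro exI[of _ "min (d/2) pi"] conjI allI impI)
    fix t :: real assume t: "0 < t" "t \<le> min (d/2) pi"
    hence "Np t / N t < \<eta>" using d by auto
    thus "Np t \<le> \<eta> * N t" using N_pos[of t] t by (simp add: pos_divide_less_eq)
  qed (use d in auto)
qed

text \<open>The bound for the imaginary part may be much smaller than
  \<open>t\<^sup>2 * N t\<close>; it is what produces the integrable \<open>N3 / N\<^sup>2\<close>
  after division by \<open>(norm (w t))\<^sup>2\<close>.\<close>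

lemma w_upper:
  assumes t: "t > 0"
  shows "0 \<le> Re (w t)" "Re (w t) \<le> 8 * t\<^sup>2 * (N t - t * N3 t)" "\<bar>Im (w t)\<bar> \<le> 8 * t^3 * N3 t" "norm (w t) \<le> 8 * t\<^sup>2 * N t"
proof -
  show re0: "0 \<le> Re (w t)" unfolding Re_w[OF t] using CS_nonneg[OF t] by simp
  have "8 * t\<^sup>2 * (Np t - t * N3p t) + 8 * t\<^sup>2 * (Nm t - t * N3m t) = 8 * t\<^sup>2 * (N t - t * N3 t)"
    unfolding N_split[OF t] N3_split[OF t] by (simp add: algebra_simps)
  thus re: "Re (w t) \<le> 8 * t\<^sup>2 * (N t - t * N3 t)"
    unfolding Re_w[OF t] using CS_upper[OF t] by linarith
  have n3: "8 * t^3 * N3p t + 8 * t^3 * N3m t = 8 * t^3 * N3 t"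
    unfolding N3_split[OF t] by (simp add: algebra_simps)
  thus im: "\<bar>Im (w t)\<bar> \<le> 8 * t^3 * N3 t"
    unfolding Im_w[OF t] using CS_upper[OF t] CS_nonneg[OF t] by linarith
  have "8 * t\<^sup>2 * (N t - t * N3 t) + 8 * t^3 * N3 t = 8 * t\<^sup>2 * N t"
    by (simp add: algebra_simps power2_eq_square power3_eq_cube)
  thus "norm (w t) \<le> 8 * t\<^sup>2 * N t" using cmod_le[of "w t"] re im re0 by linarith
qed

lemma tN_bounded: "t\<^sup>2 * N t \<le> pi * (pi * N pi)" if "0 < t" "t \<le> pi"
proof -
  have h: "t * N t \<le> pi * N pi" by (rule reg2_mult_mono[OF Ya_int Ya_nonneg that])
  have "t * (t * N t) \<le> pi * (pi * N pi)" by (rule mult_mono[OF that(2) h]) (use that N_nonneg[of t] in auto)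
  thus ?thesis by (simp add: power2_eq_square)
qed

text \<open>The negative jumps supply at least \<open>99/400\<close> of
  \<open>t\<^sup>2 * N t\<close>, and \<open>Sp\<close> removes at most \<open>8/100\<close> of it;
  more than \<open>1/8\<close> is left.\<close>

lemma small_t_lower:
  assumes t: "0 < t" and small: "Np t \<le> 1/100 * N t"
  shows "t\<^sup>2 * N t / 8 \<le> Cm t + Sm t - Sp t"
proof -
  have "Sp t \<le> 8 * t\<^sup>2 * (t * N3p t)" using CS_upper(3)[OF t] by (simp add: power3_eq_cube power2_eq_square mult_ac)
  also have "\<dots> \<le> 8 * t\<^sup>2 * (1/100 * N t)" using N3p_le[OF t] small by (intro mult_left_mono) auto
  finally have "Sp t \<le> 8/100 * (t\<^sup>2 * N t)" by (simp add: mult_ac)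
  moreover have "t\<^sup>2 * N t = t\<^sup>2 * Np t + t\<^sup>2 * Nm t" unfolding N_split[OF t] by (simp add: algebra_simps)
  moreover have "t\<^sup>2 * Np t \<le> t\<^sup>2 * (1/100 * N t)" using small by (intro mult_left_mono) auto
  hence "t\<^sup>2 * Np t \<le> 1/100 * (t\<^sup>2 * N t)" by simp
  moreover have "0 \<le> t\<^sup>2 * N t" using N_nonneg[of t] t by simp
  ultimately show ?thesis using CS_lower[OF t] by linarith
qed

text \<open>Away from 0 any positive constant is enough, because \<open>t\<^sup>2 * N t\<close> does
  not exceed its value at \<open>pi\<close>.\<close>

lemma lower_from_compact:
  fixes f :: "real \<Rightarrow> complex"
  assumes small: "\<And>t. 0 < t \<Longrightarrow> Np t \<le> 1/100 * N t \<Longrightarrow> t \<le> 1 \<Longrightarrow> t\<^sup>2 * N t / 16 \<le> norm (f t)"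
    and large: "\<And>\<delta>. 0 < \<delta> \<Longrightarrow> \<exists>c>0. \<forall>t. \<delta> \<le> t \<longrightarrow> t \<le> pi \<longrightarrow> c \<le> norm (f t)"
  shows "\<exists>c>0. \<forall>t. 0 < t \<longrightarrow> t \<le> pi \<longrightarrow> c * (t\<^sup>2 * N t) \<le> norm (f t)"
proof -
  obtain \<delta> where \<delta>: "\<delta> > 0" "\<delta> \<le> pi" "\<And>t. 0 < t \<Longrightarrow> t \<le> \<delta> \<Longrightarrow> Np t \<le> 1/100 * N t"
    using Np_small[of "1/100"] by auto
  obtain c where c: "c > 0" "\<And>t. min \<delta> 1 \<le> t \<Longrightarrow> t \<le> pi \<Longrightarrow> c \<le> norm (f t)"
    using large[of "min \<delta> 1"] \<delta> by auto
  define B where "B = pi * (pi * N pi)"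
  have B: "B > 0" unfolding B_def using N_pos[of pi] by simp
  show ?thesis
  proof (intro exI[of _ "min (1/16) (c / B)"] conjI allI impI)
    fix t :: real assume t: "0 < t" "t \<le> pi"
    have q: "0 \<le> t\<^sup>2 * N t" "t\<^sup>2 * N t \<le> B" using N_nonneg[of t] t tN_bounded[OF t] by (auto simp: B_def)
    show "min (1/16) (c / B) * (t\<^sup>2 * N t) \<le> norm (f t)"
    proof (cases "t \<le> min \<delta> 1")
      case True
      have "min (1/16) (c / B) * (t\<^sup>2 * N t) \<le> 1/16 * (t\<^sup>2 * N t)" by (rule mult_right_mono[OF min.cobounded1 q(1)])
      also have "\<dots> \<le> norm (f t)" using small[of t] \<delta>(3)[of t] True t by simp
      finally show ?thesis .
    next
      case False
      have "min (1/16) (c / B) * (t\<^sup>2 * N t) \<le> c / B * B" using q c B by (intro mult_mono) auto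
      also have "\<dots> \<le> norm (f t)" using c(2)[of t] False t B by simp
      finally show ?thesis .
    qed
  qed (use c B in auto)
qed

lemma w_nonzero: "w t \<noteq> 0" if "0 < t" "t \<le> pi"
  using nonlattice[OF that] by (simp add: \<phi>_def)

text \<open>Negative jumps put \<open>Cm\<close> into the real part and \<open>- Sm\<close> into the
  imaginary part, so \<open>Re (w t) - Im (w t)\<close> collects them without cancellation. Away
  from 0 the bound is compactness and absence of zeros.\<close>

lemma w_lower: "\<exists>c>0. \<forall>t. 0 < t \<longrightarrow> t \<le> pi \<longrightarrow> c * (t\<^sup>2 * N t) \<le> norm (w t)"
proof (rule lower_from_compact)
  fix t :: real assume t: "0 < t" "Np t \<le> 1/100 * N t"
  have "t\<^sup>2 * N t / 8 \<le> Re (w t) - Im (w t)"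
    unfolding Re_w[OF t(1)] Im_w[OF t(1)] using small_t_lower[OF t] CS_nonneg[OF t(1)] by linarith
  also have "\<dots> \<le> 2 * norm (w t)" using abs_Re_le_cmod[of "w t"] abs_Im_le_cmod[of "w t"] by linarith
  finally show "t\<^sup>2 * N t / 16 \<le> norm (w t)" by simp
next
  fix \<delta> :: real assume \<delta>: "0 < \<delta>"
  show "\<exists>c>0. \<forall>t. \<delta> \<le> t \<longrightarrow> t \<le> pi \<longrightarrow> c \<le> norm (w t)"
  proof (cases "\<delta> \<le> pi")
    case True
    have "continuous_on {\<delta>..pi} (\<lambda>t. norm (w t))"
      by (intro continuous_intros continuous_at_imp_continuous_on ballI isCont_\<phi>)
    from continuous_attains_inf[OF compact_Icc _ this] True obtain s where
      s: "s \<in> {\<delta>..pi}" "\<And>t. t \<in> {\<delta>..pi} \<Longrightarrow> norm (w s) \<le> norm (w t)" by auto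
    show ?thesis using s w_nonzero[of s] \<delta> by (intro exI[of _ "norm (w s)"]) auto
  next
    case False
    thus ?thesis by (intro exI[of _ 1]) auto
  qed
qed

text \<open>Same combination as for \<open>w\<close>. For \<open>t \<le> 1\<close> the contribution
  of the jumps \<open>+1\<close> has the right sign, since \<open>t - sin t \<le> 1 - cos t\<close>;
  for larger \<open>t\<close> their cosine part alone bounds the real part from below.\<close>

lemma b_lower: "\<exists>c>0. \<forall>t. 0 < t \<longrightarrow> t \<le> pi \<longrightarrow> c * (t\<^sup>2 * N t) \<le> norm (b t)"
proof (rule lower_from_compact)
  fix t :: real assume t: "0 < t" "Np t \<le> 1/100 * N t" "t \<le> 1"
  have "t - sin t \<le> t^3 / 6" using minus_sin_cubic[of t] t by simp
  also have "t^3 \<le> t\<^sup>2" using t by (intro power_decreasing) auto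
  finally have "t - sin t \<le> 1 - cos t" using one_minus_cos_ge[of t] t zero_le_power2[of t] by linarith
  hence "e * (t - sin t) \<le> e * (1 - cos t)" using e_pos by (intro mult_left_mono) auto
  hence "Cm t + Sm t \<le> Re (b t) - Im (b t)" by (simp add: b_def)
  hence "t\<^sup>2 * N t / 8 \<le> Re (b t) - Im (b t)"
    using small_t_lower[OF t(1,2)] CS_nonneg[OF t(1)] by linarith
  also have "\<dots> \<le> 2 * norm (b t)" using abs_Re_le_cmod[of "b t"] abs_Im_le_cmod[of "b t"] by linarith
  finally show "t\<^sup>2 * N t / 16 \<le> norm (b t)" by simp
next
  fix \<delta> :: real assume \<delta>: "0 < \<delta>"
  show "\<exists>c>0. \<forall>t. \<delta> \<le> t \<longrightarrow> t \<le> pi \<longrightarrow> c \<le> norm (b t)"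
  proof (cases "\<delta> \<le> pi")
    case True
    show ?thesis
    proof (intro exI[of _ "e * (1 - cos \<delta>)"] conjI allI impI)
      have "cos \<delta> < cos 0" using \<delta> True by (intro cos_monotone_0_pi) auto
      thus "e * (1 - cos \<delta>) > 0" using e_pos by simp
      fix t assume t: "\<delta> \<le> t" "t \<le> pi"
      have "cos t \<le> cos \<delta>" using t \<delta> by (intro cos_monotone_0_pi_le) auto
      hence "e * (1 - cos \<delta>) \<le> e * (1 - cos t)" using e_pos by (intro mult_left_mono) auto
      also have "\<dots> \<le> Re (b t)" using CS_nonneg[of t] t \<delta> by (simp add: b_def)
      also have "\<dots> \<le> norm (b t)" by (rule complex_Re_le_cmod)
      finally show "e * (1 - cos \<delta>) \<le> norm (b t)" .
    qed
  next
    case False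
    thus ?thesis by (intro exI[of _ 1]) auto
  qed
qed

text \<open>The negative jumps cancel. What the jumps \<open>+1\<close> add is absorbed by the lower
  bounds \<open>c2\<close> and \<open>c3\<close>, at the price of \<open>e / c2\<close> and
  \<open>e / c3\<close>.\<close>

lemma b_minus_w:
  "\<exists>C\<ge>1. \<forall>t. 0 < t \<longrightarrow> t \<le> pi \<longrightarrow> \<bar>Re (b t - w t)\<bar> \<le> C * (t\<^sup>2 * (Np t - t * N3p t)) \<and> \<bar>Im (b t - w t)\<bar> \<le> C * (t^3 * N3p t)"
proof -
  obtain c2 where c2: "c2 > 0" "\<And>t. 0 < t \<Longrightarrow> t \<le> pi \<Longrightarrow> c2 \<le> Np t - t * N3p t" using Np_minus_N3p_lower by auto
  obtain c3 where c3: "c3 > 0" "\<And>t. 0 < t \<Longrightarrow> t \<le> pi \<Longrightarrow> c3 \<le> N3p t" using N3p_lower by auto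
  define C where "C = 8 + e / c2 + e / c3"
  have C: "C \<ge> 1" "8 + e / c2 \<le> C" "8 + e / c3 \<le> C" using e_pos c2(1) c3(1) by (auto simp: C_def)
  show ?thesis
  proof (intro exI[of _ C] conjI allI impI C(1))
    fix t :: real assume t: "0 < t" "t \<le> pi"
    have "e * (1 - cos t) \<le> e * t\<^sup>2" using one_minus_cos_le[of t] zero_le_power2[of t] e_pos by (intro mult_left_mono) linarith+
    also have "\<dots> = e / c2 * (t\<^sup>2 * c2)" using c2(1) by simp
    also have "\<dots> \<le> e / c2 * (t\<^sup>2 * (Np t - t * N3p t))" using c2 t e_pos by (intro mult_left_mono) auto
    finally have 1: "e * (1 - cos t) \<le> e / c2 * (t\<^sup>2 * (Np t - t * N3p t))" .
    have 2: "0 \<le> e * (1 - cos t)" using e_pos by simp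
    have "\<bar>Re (b t - w t)\<bar> = \<bar>e * (1 - cos t) - Cp t\<bar>"
      unfolding minus_complex.sel(1)[of "b t"] Re_w[OF t(1)] by (simp add: b_def)
    also have "\<dots> \<le> (8 + e / c2) * (t\<^sup>2 * (Np t - t * N3p t))"
      using 1 2 CS_upper(1)[OF t(1)] CS_nonneg(1)[OF t(1)] by (simp add: algebra_simps)
    also have "\<dots> \<le> C * (t\<^sup>2 * (Np t - t * N3p t))"
      using C c2(2)[OF t] c2(1) by (intro mult_right_mono) auto
    finally show "\<bar>Re (b t - w t)\<bar> \<le> C * (t\<^sup>2 * (Np t - t * N3p t))" .
    have "e * (t - sin t) \<le> e * t^3" using minus_sin_cubic[of t] zero_le_power[of t 3] t e_pos by (intro mult_left_mono) linarith+
    also have "\<dots> = e / c3 * (t^3 * c3)" using c3(1) by simp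
    also have "\<dots> \<le> e / c3 * (t^3 * N3p t)" using c3 t e_pos by (intro mult_left_mono) auto
    finally have 1: "e * (t - sin t) \<le> e / c3 * (t^3 * N3p t)" .
    have 2: "0 \<le> e * (t - sin t)" using e_pos minus_sin_nonneg[of t] t by simp
    have "\<bar>Im (b t - w t)\<bar> = \<bar>e * (t - sin t) - Sp t\<bar>"
      unfolding minus_complex.sel(2)[of "b t"] Im_w[OF t(1)] by (simp add: b_def)
    also have "\<dots> \<le> (8 + e / c3) * (t^3 * N3p t)"
      using 1 2 CS_upper(3)[OF t(1)] CS_nonneg(3)[OF t(1)] by (simp add: algebra_simps)
    also have "\<dots> \<le> C * (t^3 * N3p t)"
      using C N3p_nonneg t by (intro mult_right_mono) auto
    finally show "\<bar>Im (b t - w t)\<bar> \<le> C * (t^3 * N3p t)" .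
  qed
qed

end

section \<open>Integrals over the half circle\<close>

text \<open>Real parts of the integrands are even in \<open>t\<close>, so half of the circle
  suffices. The open interval omits the singularity at 0, and the measure is finite, so bounded
  measurable functions are integrable and Fubini applies.\<close>

definition LL :: "real measure" where "LL = restrict_space lborel {0<..<pi}"

lemma space_LL: "space LL = {0<..<pi}" by (simp add: LL_def)

lemma LL_meas: "f \<in> borel_measurable borel \<Longrightarrow> f \<in> borel_measurable LL"
  unfolding LL_def by (rule measurable_restrict_space1) simp

lemma finite_measure_LL: "finite_measure LL"
  by (rule finite_measureI) (simp add: LL_def emeasure_restrict_space)

lemma integrable_LL_bounded:
  fixes f :: "real \<Rightarrow> 'b::{banach,second_countable_topology}"
  assumes "f \<in> borel_measurable borel" "\<And>t. 0 < t \<Longrightarrow> t < pi \<Longrightarrow> norm (f t) \<le> B"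
  shows "integrable LL f"
  by (rule finite_measure.integrable_const_bound[OF finite_measure_LL, of _ B])
     (auto intro!: AE_I2 LL_meas assms simp: space_LL)

lemma LL_HK:
  fixes f :: "real \<Rightarrow> real"
  assumes "integrable LL f"
  shows "f integrable_on {0..pi}" "(\<integral>t. f t \<partial>LL) = integral {0..pi} f"
proof -
  have s: "set_integrable lborel {0<..<pi} f"
    using assms unfolding LL_def set_integrable_def by (subst (asm) integrable_restrict_space) auto
  show "f integrable_on {0..pi}"
    using set_borel_integral_eq_integral(1)[OF s] by (simp add: integrable_on_open_interval_real)
  have "(\<integral>t. f t \<partial>LL) = (LINT t:{0<..<pi}|lborel. f t)"
    unfolding LL_def set_lebesgue_integral_def by (subst integral_restrict_space) auto
  also have "\<dots> = integral {0<..<pi} f" by (rule set_borel_integral_eq_integral(2)[OF s])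
  also have "\<dots> = integral {0..pi} f" by (rule integral_open_interval_real[symmetric])
  finally show "(\<integral>t. f t \<partial>LL) = integral {0..pi} f" .
qed

text \<open>Meant for bounds \<open>F'\<close> with an explicit primitive. Only interior points are
  asked for, since the functions may be unbounded at 0.\<close>

lemma FTC_bound:
  fixes f F F' :: "real \<Rightarrow> real"
  assumes "a \<le> b" "f integrable_on {a..b}" "continuous_on {a..b} F"
    and "\<And>t. a < t \<Longrightarrow> t < b \<Longrightarrow> (F has_real_derivative F' t) (at t)"
    and "\<And>t. a < t \<Longrightarrow> t < b \<Longrightarrow> \<bar>f t\<bar> \<le> F' t"
  shows "\<bar>integral {a..b} f\<bar> \<le> F b - F a"
proof -
  have h: "(F' has_integral F b - F a) {a..b}"
    using assms by (intro fundamental_theorem_of_calculus_interior)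
      (auto simp: has_real_derivative_iff_has_vector_derivative[symmetric])
  have "norm (integral {a<..<b} f) \<le> integral {a<..<b} F'"
    using assms h by (intro Henstock_Kurzweil_Integration.integral_norm_bound_integral)
      (auto simp: integrable_on_open_interval_real has_integral_integrable)
  thus ?thesis using h by (simp add: integral_open_interval_real[symmetric] integral_unique)
qed

lemma FTC_integrable_LL:
  fixes F F' :: "real \<Rightarrow> real"
  assumes "continuous_on {0..pi} F" "F' \<in> borel_measurable borel"
    and "\<And>t. 0 < t \<Longrightarrow> t < pi \<Longrightarrow> (F has_real_derivative F' t) (at t)"
    and "\<And>t. 0 < t \<Longrightarrow> t < pi \<Longrightarrow> 0 \<le> F' t"
  shows "integrable LL F'"
proof -
  have "(F' has_integral F pi - F 0) {0..pi}"
    using assms by (intro fundamental_theorem_of_calculus_interior)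
      (auto simp: has_real_derivative_iff_has_vector_derivative[symmetric])
  hence "F' integrable_on {0<..<pi}" by (simp add: integrable_on_open_interval_real has_integral_integrable)
  hence "F' absolutely_integrable_on {0<..<pi}" using assms by (intro nonnegative_absolutely_integrable_1) auto
  hence "integrable lebesgue (\<lambda>x. indicator {0<..<pi} x *\<^sub>R F' x)" by (simp add: set_integrable_def)
  hence "integrable lborel (\<lambda>x. indicator {0<..<pi} x *\<^sub>R F' x)"
    using assms(2) by (subst (asm) integrable_completion) auto
  thus ?thesis unfolding LL_def by (subst integrable_restrict_space) auto
qed

text \<open>The last of \<open>n\<close> decreasing powers is at most their average, and
  \<open>y\<close> times their sum telescopes.\<close>

lemma geometric_bound: "real n * (1 - y) ^ (n - 1) * y \<le> 1" if "0 \<le> y" "y \<le> 1" for y :: real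
proof -
  have "real n * (1 - y) ^ (n - 1) = (\<Sum>j<n. (1 - y) ^ (n - 1))" by simp
  also have "\<dots> \<le> (\<Sum>j<n. (1 - y) ^ j)" using that by (intro sum_mono power_decreasing) auto
  finally have "real n * (1 - y) ^ (n - 1) * y \<le> (\<Sum>j<n. (1 - y) ^ j) * y" using that by (intro mult_right_mono)
  also have "\<dots> = 1 - (1 - y) ^ n"
    using one_diff_power_eq[of "1 - y" n] by (simp add: mult.commute)
  also have "\<dots> \<le> 1" using that by simp
  finally show ?thesis .
qed

text \<open>The gain over the trivial bound by the norm is the factor
  \<open>\<bar>Im z\<bar>\<close>: powers of \<open>\<phi> t\<close> inherit the smallness of its
  imaginary part.\<close>

lemma Im_power_bound: "\<bar>Im (z ^ n)\<bar> \<le> real n * norm z ^ (n - 1) * \<bar>Im z\<bar>"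
proof (induction n)
  case (Suc n)
  have "\<bar>Im (z ^ Suc n)\<bar> = \<bar>Re z * Im (z ^ n) + Im z * Re (z ^ n)\<bar>" by simp
  also have "\<dots> \<le> \<bar>Re z\<bar> * \<bar>Im (z ^ n)\<bar> + \<bar>Im z\<bar> * \<bar>Re (z ^ n)\<bar>"
    by (metis abs_mult abs_triangle_ineq)
  also have "\<dots> \<le> norm z * (real n * norm z ^ (n - 1) * \<bar>Im z\<bar>) + \<bar>Im z\<bar> * norm z ^ n"
    using Suc abs_Re_le_cmod[of z] abs_Re_le_cmod[of "z ^ n"]
    by (intro add_mono mult_mono) (auto simp: norm_power)
  also have "norm z * (real n * norm z ^ (n - 1) * \<bar>Im z\<bar>) = real n * norm z ^ n * \<bar>Im z\<bar>"
    by (cases n) auto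
  finally show ?case by (simp add: algebra_simps)
qed simp

context step
begin

lemma N_meas [measurable]: "N \<in> borel_measurable borel" and N3_meas [measurable]: "N3 \<in> borel_measurable borel"
  unfolding reg2_def[abs_def] reg3_def[abs_def] by measurable

lemma inverse_N_derivative: "((\<lambda>t. 1 / N t) has_real_derivative N3 t / (N t)\<^sup>2) (at t)" if "0 < t" "t \<le> pi"
  using N_pos[OF that] that
  by (auto intro!: derivative_eq_intros reg2_has_derivative Ya_int Ya_nonneg simp: power2_eq_square)

lemma inverse_N_tendsto: "((\<lambda>t. 1 / N t) \<longlongrightarrow> 0) (at_right 0)"
  using tendsto_inverse_0_at_top[OF N_at_top] by (simp add: inverse_eq_divide)

text \<open>The primitive of \<open>N3 / N\<^sup>2\<close>, extended continuously to \<open>0\<close>.\<close>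
definition recip_N :: "real \<Rightarrow> real" where "recip_N t = (if t \<le> 0 then 0 else 1 / N t)"

lemma recip_N_derivative: "(recip_N has_real_derivative N3 t / (N t)\<^sup>2) (at t)" if "0 < t" "t \<le> pi"
proof (rule has_field_derivative_transform_within_open[OF inverse_N_derivative[OF that] open_greaterThan])
  show "t \<in> {0<..}" using that by simp
qed (auto simp: recip_N_def)

lemma continuous_at_0_if:
  fixes f g :: "real \<Rightarrow> real"
  assumes "0 < c" "(g \<longlongrightarrow> 0) (at_right 0)" "\<And>t. 0 < t \<Longrightarrow> t \<le> c \<Longrightarrow> isCont f t" "f 0 = 0" "\<And>t. t > 0 \<Longrightarrow> f t = g t"
  shows "continuous_on {0..c} f"
  unfolding continuous_on_eq_continuous_within
proof
  fix t assume t: "t \<in> {0..c}"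
  show "continuous (at t within {0..c}) f"
  proof (cases "t = 0")
    case True
    have "(f \<longlongrightarrow> 0) (at_right 0)"
      by (rule Lim_transform_eventually[OF assms(2)]) (auto simp: assms(5) eventually_at_right_less eventually_at_filter)
    hence "(f \<longlongrightarrow> 0) (at 0 within {0..c})" using \<open>0 < c\<close> by (simp add: at_within_Icc_at_right)
    thus ?thesis using True assms(4) by (simp add: continuous_within)
  next
    case False
    thus ?thesis using assms(3)[of t] t by (auto intro: continuous_at_imp_continuous_at_within)
  qed
qed

lemma recip_N_continuous: "continuous_on {0..pi} recip_N"
  by (rule continuous_at_0_if[OF pi_gt_zero inverse_N_tendsto])
     (auto intro!: DERIV_isCont[OF recip_N_derivative] simp: recip_N_def)

text \<open>This is where infinite variance makes the Fourier integrals converge: the function is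
  the derivative of \<open>1 / N\<close>, which extends continuously by 0. It serves as dominating
  function in all limits below.\<close>

lemma dom_integrable: "integrable LL (\<lambda>t. N3 t / (N t)\<^sup>2)"
  by (rule FTC_integrable_LL[OF recip_N_continuous])
     (auto intro!: recip_N_derivative divide_nonneg_nonneg N3_nonneg)

section \<open>Atoms of the step law and the modulus of its characteristic function\<close>

lemma prob_Y_eq_0_iff: "prob {\<omega> \<in> space M. Y \<omega> = y} = 0 \<longleftrightarrow> (AE \<omega> in M. Y \<omega> \<noteq> y)"
  by (subst prob_eq_0) auto

lemma exists_value_pos: "\<exists>y\<ge>1. prob {\<omega> \<in> space M. Y \<omega> = y} > 0"
proof (rule ccontr)
  assume "\<not> ?thesis"
  hence "prob {\<omega> \<in> space M. Y \<omega> = y} = 0" if "y \<ge> 1" for y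
    using that by (auto simp: not_less measure_le_0_iff)
  hence "AE \<omega> in M. y \<ge> 1 \<longrightarrow> Y \<omega> \<noteq> y" for y
    by (cases "y \<ge> 1") (simp_all add: prob_Y_eq_0_iff)
  hence "AE \<omega> in M. \<forall>y. y \<ge> 1 \<longrightarrow> Y \<omega> \<noteq> y" by (simp add: AE_all_countable)
  hence "AE \<omega> in M. Yp \<omega> = 0"
  proof eventually_elim
    case (elim \<omega>)
    hence "\<not> Y \<omega> \<ge> 1" by blast
    thus ?case by (simp add: Yp_def)
  qed
  thus False using not_AE_Yp_0 by simp
qed

lemma exists_value_neg: "\<exists>y\<le>-1. prob {\<omega> \<in> space M. Y \<omega> = y} > 0"
proof (rule ccontr)
  assume "\<not> ?thesis"
  hence "prob {\<omega> \<in> space M. Y \<omega> = y} = 0" if "y \<le> -1" for y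
    using that by (auto simp: not_less measure_le_0_iff)
  hence "AE \<omega> in M. y \<le> -1 \<longrightarrow> Y \<omega> \<noteq> y" for y
    by (cases "y \<le> -1") (simp_all add: prob_Y_eq_0_iff)
  hence "AE \<omega> in M. \<forall>y. y \<le> -1 \<longrightarrow> Y \<omega> \<noteq> y" by (simp add: AE_all_countable)
  hence "AE \<omega> in M. Ym \<omega> = 0"
  proof eventually_elim
    case (elim \<omega>)
    hence "\<not> Y \<omega> \<le> -1" by blast
    thus ?case by (simp add: Ym_def)
  qed
  hence "expectation Ym = expectation (\<lambda>_. 0)" by (intro integral_cong_AE) auto
  thus False using e_pos e_eq by simp
qed

text \<open>Equality case of the triangle inequality: the mean of
  \<open>Re (cis (t * Y) * cnj (\<phi> t))\<close> is 1 and its values are at most 1, so it equals 1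
  almost surely, in particular at every atom.\<close>

lemma norm_\<phi>_eq_1_D:
  assumes "norm (\<phi> t) = 1" "prob {\<omega> \<in> space M. Y \<omega> = y} > 0"
  shows "cis (t * real_of_int y) = \<phi> t"
proof -
  have "integrable M (\<lambda>\<omega>. cis (t * real_of_int (Y \<omega>)))" by (rule integrable_cis) measurable
  hence ii: "integrable M (\<lambda>\<omega>. cis (t * real_of_int (Y \<omega>)) * cnj (\<phi> t))" by simp
  have "expectation (\<lambda>\<omega>. Re (cis (t * real_of_int (Y \<omega>)) * cnj (\<phi> t))) = Re (\<phi> t * cnj (\<phi> t))"
    using ii by (subst integral_Re) (auto simp: \<phi>_def)
  also have "\<dots> = 1" using assms(1) by (simp add: complex_norm_square[symmetric] mult.commute)
  finally have E: "expectation (\<lambda>\<omega>. Re (cis (t * real_of_int (Y \<omega>)) * cnj (\<phi> t))) = 1" .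
  have le: "Re (cis (t * real_of_int k) * cnj (\<phi> t)) \<le> 1" for k
    using complex_Re_le_cmod[of "cis (t * real_of_int k) * cnj (\<phi> t)"] assms(1) by (simp add: norm_mult)
  have "integrable M (\<lambda>\<omega>. Re (cis (t * real_of_int (Y \<omega>)) * cnj (\<phi> t)))" using ii by (rule integrable_Re)
  hence i1: "integrable M (\<lambda>\<omega>. 1 - Re (cis (t * real_of_int (Y \<omega>)) * cnj (\<phi> t)))" by simp
  have "expectation (\<lambda>\<omega>. 1 - Re (cis (t * real_of_int (Y \<omega>)) * cnj (\<phi> t))) = 0"
    using E \<open>integrable M (\<lambda>\<omega>. Re (cis (t * real_of_int (Y \<omega>)) * cnj (\<phi> t)))\<close>
    by (subst Bochner_Integration.integral_diff) (auto simp: prob_space)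
  hence "AE \<omega> in M. 1 - Re (cis (t * real_of_int (Y \<omega>)) * cnj (\<phi> t)) = 0"
    using integral_nonneg_eq_0_iff_AE[OF i1] le by auto
  note AE1 = this
  have "\<exists>\<omega>. 1 - Re (cis (t * real_of_int (Y \<omega>)) * cnj (\<phi> t)) = 0 \<and> Y \<omega> = y"
  proof (rule ccontr)
    assume "\<not> ?thesis"
    hence imp: "Y \<omega> \<noteq> y" if "1 - Re (cis (t * real_of_int (Y \<omega>)) * cnj (\<phi> t)) = 0" for \<omega> using that by blast
    from AE1 have "AE \<omega> in M. Y \<omega> \<noteq> y" by eventually_elim (rule imp)
    thus False using assms(2) prob_Y_eq_0_iff[of y] by simp
  qed
  then obtain \<omega> where "Re (cis (t * real_of_int (Y \<omega>)) * cnj (\<phi> t)) = 1" "Y \<omega> = y"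
    by (metis eq_iff_diff_eq_0)
  hence re: "Re (cis (t * real_of_int y) * cnj (\<phi> t)) = 1" by simp
  define z where "z = cis (t * real_of_int y) * cnj (\<phi> t)"
  have nz: "norm z = 1" using assms(1) by (simp add: z_def norm_mult)
  have "(Re z)\<^sup>2 + (Im z)\<^sup>2 = 1" using nz by (metis cmod_power2 one_power2)
  hence "Im z = 0" using re by (simp add: z_def)
  hence "z = 1" using re by (simp add: z_def complex_eq_iff)
  hence "cis (t * real_of_int y) * (cnj (\<phi> t) * \<phi> t) = \<phi> t" by (simp add: z_def mult.assoc[symmetric])
  moreover have "cnj (\<phi> t) * \<phi> t = 1" using assms(1) by (simp add: complex_norm_square[symmetric] mult.commute)
  ultimately show ?thesis by simp
qed

text \<open>A periodic walk may have \<open>norm (\<phi> t) = 1\<close> inside the interval,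
  although \<open>\<phi> t \<noteq> 1\<close>. Modulus one makes \<open>t * (y1 - y2)\<close> a
  multiple of \<open>2 * pi\<close> for two atoms of opposite sign, which leaves countably many
  \<open>t\<close>.\<close>

lemma AE_norm_\<phi>_less_1: "AE t in LL. norm (\<phi> t) < 1"
proof -
  obtain y1 y2 where y: "y1 \<ge> 1" "prob {\<omega> \<in> space M. Y \<omega> = y1} > 0" "y2 \<le> -1" "prob {\<omega> \<in> space M. Y \<omega> = y2} > 0"
    using exists_value_pos exists_value_neg by blast
  let ?A = "range (\<lambda>k::int. (of_int k * 2 * pi) / real_of_int (y1 - y2))"
  have "AE t in lborel. t \<notin> ?A"
    by (intro AE_not_in countable_imp_null_set_lborel) auto
  hence "AE t in lborel. t \<in> {0<..<pi} \<longrightarrow> norm (\<phi> t) < 1"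
  proof eventually_elim
    case (elim t)
    have "norm (\<phi> t) \<noteq> 1"
    proof
      assume n1: "norm (\<phi> t) = 1"
      have "cis (t * real_of_int y1) = cis (t * real_of_int y2)"
        using norm_\<phi>_eq_1_D[OF n1 y(2)] norm_\<phi>_eq_1_D[OF n1 y(4)] by simp
      hence "cis (t * real_of_int y1) / cis (t * real_of_int y2) = 1" by simp
      hence "cis (t * real_of_int (y1 - y2)) = 1" by (simp add: cis_divide algebra_simps)
      hence "cos (t * real_of_int (y1 - y2)) = 1" by (metis cis.sel(1) one_complex.sel(1))
      then obtain k :: int where "t * real_of_int (y1 - y2) = of_int k * 2 * pi" by (auto simp: cos_one_2pi_int)
      hence "t = (of_int k * 2 * pi) / real_of_int (y1 - y2)" using y by (simp add: field_simps)
      thus False using elim by blast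
    qed
    thus ?case using norm_\<phi>[of t] by simp
  qed
  thus ?thesis unfolding LL_def by (subst AE_restrict_space_iff) auto
qed

lemma Re_w_ge_square: "\<exists>c>0. \<exists>\<delta>>0. \<forall>t. 0 < t \<longrightarrow> t \<le> \<delta> \<longrightarrow> c * t\<^sup>2 \<le> Re (w t)"
proof -
  obtain y where y: "y \<ge> 1" "prob {\<omega> \<in> space M. Y \<omega> = y} > 0" using exists_value_pos by auto
  define p where "p = prob {\<omega> \<in> space M. Y \<omega> = y}"
  have "\<forall>t. 0 < t \<longrightarrow> t \<le> 1 / real_of_int y \<longrightarrow> p / 3 * t\<^sup>2 \<le> Re (w t)"
  proof (intro allI impI)
    fix t :: real assume t: "0 < t" "t \<le> 1 / real_of_int y"
    have ty: "0 \<le> t * real_of_int y" "t * real_of_int y \<le> 1" using t y by (auto simp: field_simps)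
    have "p / 3 * t\<^sup>2 \<le> p / 3 * (t * real_of_int y)\<^sup>2"
      using y t by (intro mult_left_mono power_mono) (auto simp: p_def)
    also have "\<dots> = expectation (\<lambda>\<omega>. indicator {\<omega> \<in> space M. Y \<omega> = y} \<omega> * ((t * real_of_int y)\<^sup>2 / 3))"
      by (subst integral_mult_left_zero) (simp add: p_def)
    also have "\<dots> \<le> Cp t"
      unfolding Cp_def
    proof (rule integral_mono)
      show "integrable M (\<lambda>\<omega>. indicator {\<omega> \<in> space M. Y \<omega> = y} \<omega> * ((t * real_of_int y)\<^sup>2 / 3))"
        by (intro integrable_mult_left) (simp add: emeasure_eq_measure)
      show "integrable M (\<lambda>\<omega>. 1 - cos (t * Yp \<omega>))" by (rule Yp_bounds(1)[OF t(1)])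
      fix \<omega> assume "\<omega> \<in> space M"
      show "indicator {\<omega> \<in> space M. Y \<omega> = y} \<omega> * ((t * real_of_int y)\<^sup>2 / 3) \<le> 1 - cos (t * Yp \<omega>)"
        using one_minus_cos_ge[of "t * real_of_int y"] ty y by (auto simp: indicator_def Yp_def)
    qed
    also have "\<dots> \<le> Re (w t)" unfolding Re_w[OF t(1)] using CS_nonneg[OF t(1)] by simp
    finally show "p / 3 * t\<^sup>2 \<le> Re (w t)" .
  qed
  hence "\<exists>\<delta>>0. \<forall>t. 0 < t \<longrightarrow> t \<le> \<delta> \<longrightarrow> p / 3 * t\<^sup>2 \<le> Re (w t)"
    using y by (intro exI[of _ "1 / real_of_int y"]) simp
  moreover have "p / 3 > 0" using y by (simp add: p_def)
  ultimately show ?thesis by (intro exI[of _ "p / 3"]) simp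
qed

lemma \<phi>_0: "\<phi> 0 = 1" by (simp add: \<phi>_def prob_space)

text \<open>Near 0 the squared imaginary part is at most half of \<open>Re (w t)\<close>, hence
  \<open>norm (\<phi> t) \<le> 1 - Re (w t) / 2\<close>, and \<open>geometric_bound\<close> applies.
  The bound is uniform in \<open>n\<close>, as domination of partial sums requires.\<close>

lemma small_t_power_bound:
  "\<exists>\<delta>>0. \<forall>t n. 0 < t \<longrightarrow> t \<le> \<delta> \<longrightarrow> real n * norm (\<phi> t) ^ (n - 1) * Re (w t) \<le> 2"
proof -
  obtain c \<delta>1 where c: "c > 0" "\<delta>1 > 0" "\<And>t. 0 < t \<Longrightarrow> t \<le> \<delta>1 \<Longrightarrow> c * t\<^sup>2 \<le> Re (w t)"
    using Re_w_ge_square by auto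
  have "((\<lambda>t. Re (w t)) \<longlongrightarrow> Re (w 0)) (at 0)"
    using isCont_\<phi>[of 0] unfolding isCont_def by (intro tendsto_intros)
  hence "((\<lambda>t. Re (w t)) \<longlongrightarrow> 0) (at_right 0)" by (simp add: \<phi>_0 filterlim_at_split)
  hence "\<forall>\<^sub>F t in at_right 0. Re (w t) < 1/2" by (rule order_tendstoD) simp
  \<comment> \<open>With \<open>\<bar>I\<bar> \<le> 8 * t * (t * N t)\<close>, the constant 128
    gives \<open>I\<^sup>2 \<le> c * t\<^sup>2 / 2 \<le> R / 2\<close>.\<close>
  moreover have "\<forall>\<^sub>F t in at_right 0. t * N t < sqrt (c / 128)"
    by (rule order_tendstoD[OF reg2_mult_tendsto_0[OF Ya_int Ya_nonneg]]) (use c in simp)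
  ultimately have "\<forall>\<^sub>F t in at_right 0. Re (w t) < 1/2 \<and> t * N t < sqrt (c / 128)" by eventually_elim simp
  then obtain d where d: "d > 0" "\<And>t. 0 < t \<Longrightarrow> t < d \<Longrightarrow> Re (w t) < 1/2 \<and> t * N t < sqrt (c / 128)"
    unfolding eventually_at_right_field by auto
  show ?thesis
  proof (intro exI[of _ "min \<delta>1 (d/2)"] conjI allI impI)
    fix t :: real and n :: nat assume t: "0 < t" "t \<le> min \<delta>1 (d/2)"
    define R I where "R = Re (w t)" and "I = Im (w t)"
    have R: "0 \<le> R" "R < 1/2" "c * t\<^sup>2 \<le> R" "t * N t < sqrt (c / 128)"
      using w_upper(1)[OF t(1)] c(3)[of t] d t by (auto simp: R_def simp del: minus_complex.sel)
    have "\<bar>I\<bar> \<le> 8 * t\<^sup>2 * (t * N3 t)" using w_upper(3)[OF t(1)] by (simp add: I_def power2_eq_square power3_eq_cube mult_ac)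
    also have "\<dots> \<le> 8 * t\<^sup>2 * N t" using N3_le[OF t(1)] by (intro mult_left_mono) auto
    also have "\<dots> = 8 * t * (t * N t)" by (simp add: power2_eq_square)
    also have "\<dots> \<le> 8 * t * sqrt (c / 128)" using R t by (intro mult_left_mono) auto
    finally have "I\<^sup>2 \<le> (8 * t * sqrt (c / 128))\<^sup>2" by (metis abs_ge_zero power2_abs power_mono)
    also have "\<dots> = c * t\<^sup>2 / 2" using c by (simp add: power_mult_distrib)
    also have "\<dots> \<le> R / 2" using R by simp
    finally have I2: "I\<^sup>2 \<le> R / 2" .
    have "R\<^sup>2 \<le> R / 2" using R mult_left_mono[of R "1/2" R] by (simp add: power2_eq_square)
    moreover have "(norm (\<phi> t))\<^sup>2 = (1 - R)\<^sup>2 + I\<^sup>2" by (simp add: cmod_power2 R_def I_def)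
    ultimately have "(norm (\<phi> t))\<^sup>2 \<le> 1 - R" using I2 by (simp add: power2_diff)
    also have "\<dots> \<le> (1 - R/2)\<^sup>2" by (simp add: power2_diff)
    finally have "norm (\<phi> t) \<le> 1 - R/2" by (rule power2_le_imp_le) (use R(2) in simp)
    hence "norm (\<phi> t) ^ (n - 1) \<le> (1 - R/2) ^ (n - 1)" by (intro power_mono) auto
    hence "real n * norm (\<phi> t) ^ (n - 1) * (R/2) \<le> real n * (1 - R/2) ^ (n - 1) * (R/2)"
      using R by (intro mult_right_mono mult_left_mono) auto
    also have "\<dots> \<le> 1" using R by (intro geometric_bound) auto
    finally show "real n * norm (\<phi> t) ^ (n - 1) * Re (w t) \<le> 2" by (simp add: R_def)
  qed (use c d in auto)
qed

end

section \<open>Fourier representation of the potential function\<close>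

lemma Re_one_minus_cis_mult: "Re ((1 - cis a) * z) = (1 - cos a) * Re z + sin a * Im z"
  by (simp add: algebra_simps)

lemma Im_divide_cnj: "Im (u / v) = Im (u * cnj v) / (norm v)\<^sup>2" and Re_divide_cnj: "Re (u / v) = Re (u * cnj v) / (norm v)\<^sup>2"
proof -
  have "u / v = u * cnj v / of_real ((norm v)\<^sup>2)" by (subst complex_div_cnj) simp
  thus "Im (u / v) = Im (u * cnj v) / (norm v)\<^sup>2" "Re (u / v) = Re (u * cnj v) / (norm v)\<^sup>2"
    by (metis Im_divide_of_real, metis Re_divide_of_real)
qed

context step
begin

lemma N_ge: "N pi \<le> N t" if "0 < t" "t \<le> pi"
  by (rule reg2_antimono[OF Ya_int Ya_nonneg that])

text \<open>A bound uniform in the number \<open>K\<close> of summed terms. The factor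
  \<open>1 - cos\<close> cancels \<open>t\<^sup>2\<close> in the denominator; the factor
  \<open>sin\<close> supplies only one power of \<open>t\<close> and has to be paired with the
  imaginary part of the quotient.\<close>

lemma kernel_dominated:
  "\<exists>C. \<forall>K t. 0 < t \<longrightarrow> t < pi \<longrightarrow> \<bar>Re ((1 - cis (x * t)) * ((1 - \<phi> t ^ K) / w t))\<bar> \<le> C * (1 + N3 t / (N t)\<^sup>2)"
proof -
  obtain c where c: "c > 0" "\<And>t. 0 < t \<Longrightarrow> t \<le> pi \<Longrightarrow> c * (t\<^sup>2 * N t) \<le> norm (w t)" using w_lower by auto
  obtain \<delta> where \<delta>: "\<delta> > 0" "\<And>t n. 0 < t \<Longrightarrow> t \<le> \<delta> \<Longrightarrow> real n * norm (\<phi> t) ^ (n - 1) * Re (w t) \<le> 2"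
    using small_t_power_bound by blast
  define c1 c2 c3 where "c1 = x\<^sup>2 / (c * N pi)" and "c2 = 32 * \<bar>x\<bar> / c\<^sup>2" and "c3 = 4 / (c * \<delta>\<^sup>2 * N pi)"
  have Npi: "N pi > 0" using N_pos[of pi] by simp
  have c123: "0 \<le> c1" "0 \<le> c2" "0 \<le> c3" using c(1) Npi by (auto simp: c1_def c2_def c3_def)
  have gen: "c1 + c2 * d + c3 \<le> (c1 + c2 + c3) * (1 + d)" if "0 \<le> d" for d
  proof -
    have "(c1 + c2 + c3) * (1 + d) = c1 + c2 * d + c3 + (c1 * d + c2 + c3 * d)" by (simp add: algebra_simps)
    moreover have "0 \<le> c1 * d + c2 + c3 * d" using c123 that by simp
    ultimately show ?thesis by linarith
  qed
  show ?thesis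
  proof (intro exI[of _ "c1 + c2 + c3"] allI impI)
    fix K :: nat and t :: real assume t: "0 < t" "t < pi"
    define z where "z = (1 - \<phi> t ^ K) / w t"
    define a where "a = x * t"
    have Nt: "N t > 0" "N pi \<le> N t" using N_pos[of t] N_ge[of t] t by auto
    have N3: "0 \<le> N3 t / (N t)\<^sup>2" using N3_nonneg[of t] by simp
    have wl: "c * (t\<^sup>2 * N t) \<le> norm (w t)" using c(2)[of t] t by simp
    have pos: "0 < c * (t\<^sup>2 * N t)" using c t Nt by simp
    have nw: "norm (w t) > 0" using wl pos by linarith
    have \<Phi>: "norm (\<phi> t ^ K) \<le> 1" using norm_\<phi>[of t] by (simp add: norm_power power_le_one)
    have "norm (1 - \<phi> t ^ K) \<le> 2" using norm_triangle_ineq4[of 1 "\<phi> t ^ K"] \<Phi> by simp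
    hence nz: "norm z \<le> 2 / (c * (t\<^sup>2 * N t))"
      unfolding z_def norm_divide using wl pos by (intro frac_le) auto
    have target: "\<bar>Re ((1 - cis a) * z)\<bar> \<le> c1 + c2 * (N3 t / (N t)\<^sup>2) + c3"
    proof (cases "t \<le> \<delta>")
      case True
      define I where "I = Im (w t)"
      have Im\<phi>: "Im (\<phi> t) = - I" by (simp add: I_def)
      have R0: "0 \<le> Re (w t)" using w_upper(1)[OF t(1)] .
      have 1: "\<bar>Im (\<phi> t ^ K)\<bar> * Re (w t) \<le> 2 * \<bar>I\<bar>"
      proof -
        have "\<bar>Im (\<phi> t ^ K)\<bar> * Re (w t) \<le> (real K * norm (\<phi> t) ^ (K - 1) * \<bar>Im (\<phi> t)\<bar>) * Re (w t)"
          by (rule mult_right_mono[OF Im_power_bound R0])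
        also have "\<dots> = (real K * norm (\<phi> t) ^ (K - 1) * Re (w t)) * \<bar>I\<bar>" unfolding Im\<phi> by (simp only: mult_ac abs_minus)
        also have "\<dots> \<le> 2 * \<bar>I\<bar>" by (rule mult_right_mono[OF \<delta>(2)[OF t(1) True]]) simp
        finally show ?thesis .
      qed
      have 2: "\<bar>Re (\<phi> t ^ K) * I\<bar> \<le> \<bar>I\<bar>"
        unfolding abs_mult using abs_Re_le_cmod[of "\<phi> t ^ K"] \<Phi> by (intro mult_left_le_one_le) auto
      \<comment> \<open>Every term is at most a constant times \<open>\<bar>I\<bar>\<close>; for the
        middle one this is the uniform bound on powers of \<open>\<phi> t\<close>.\<close>
      have "Im ((1 - \<phi> t ^ K) * cnj (w t)) = - I - Im (\<phi> t ^ K) * Re (w t) + Re (\<phi> t ^ K) * I"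
        by (simp add: I_def algebra_simps)
      moreover have "\<bar>Im (\<phi> t ^ K) * Re (w t)\<bar> \<le> 2 * \<bar>I\<bar>" using 1 R0 by (simp only: abs_mult abs_of_nonneg)
      ultimately have "\<bar>Im ((1 - \<phi> t ^ K) * cnj (w t))\<bar> \<le> 4 * \<bar>I\<bar>" using 2 by linarith
      also have "\<dots> \<le> 32 * t^3 * N3 t" using w_upper(3)[OF t(1)] unfolding I_def by linarith
      finally have "\<bar>Im z\<bar> \<le> (32 * t^3 * N3 t) / (c * (t\<^sup>2 * N t))\<^sup>2"
        unfolding z_def Im_divide_cnj abs_divide using wl pos nw t N3_nonneg[of t]
        by (intro frac_le power_mono) (auto simp del: minus_complex.sel)
      also have "\<dots> = 32 / c\<^sup>2 / t * (N3 t / (N t)\<^sup>2)"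
        using t c Nt by (simp add: power_mult_distrib field_simps power2_eq_square power3_eq_cube)
      finally have Imz: "\<bar>Im z\<bar> \<le> 32 / c\<^sup>2 / t * (N3 t / (N t)\<^sup>2)" .
      have "\<bar>Re ((1 - cis a) * z)\<bar> \<le> \<bar>(1 - cos a) * Re z\<bar> + \<bar>sin a * Im z\<bar>"
        unfolding Re_one_minus_cis_mult by (rule abs_triangle_ineq)
      also have "\<bar>(1 - cos a) * Re z\<bar> \<le> (a\<^sup>2 / 2) * (2 / (c * (t\<^sup>2 * N t)))"
        unfolding abs_mult using one_minus_cos_le[of a] cos_le_one[of a] abs_Re_le_cmod[of z] nz by (intro mult_mono) linarith+
      also have "\<dots> = x\<^sup>2 / (c * N t)" using t c Nt by (simp add: a_def power_mult_distrib)
      also have "\<dots> \<le> c1" unfolding c1_def using Nt Npi c by (intro divide_left_mono mult_left_mono mult_pos_pos) auto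
      also have "\<bar>sin a * Im z\<bar> \<le> (\<bar>x\<bar> * t) * (32 / c\<^sup>2 / t * (N3 t / (N t)\<^sup>2))"
        unfolding abs_mult using abs_sin_x_le_abs_x[of a] Imz t by (intro mult_mono) (auto simp: a_def abs_mult)
      also have "\<dots> = c2 * (N3 t / (N t)\<^sup>2)" using t by (simp add: c2_def)
      finally show ?thesis using c123 by linarith
    next
      case False
      have "\<bar>Re ((1 - cis a) * z)\<bar> \<le> norm ((1 - cis a) * z)" by (rule abs_Re_le_cmod)
      also have "\<dots> \<le> 2 * (2 / (c * (t\<^sup>2 * N t)))"
        unfolding norm_mult using nz norm_triangle_ineq4[of 1 "cis a"] by (intro mult_mono) auto
      also have "\<dots> = 4 / (c * (t\<^sup>2 * N t))" by simp
      also have "\<dots> \<le> 4 / (c * (\<delta>\<^sup>2 * N pi))"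
        using c False \<delta> Nt Npi t by (intro divide_left_mono mult_left_mono mult_mono power_mono mult_pos_pos) auto
      also have "\<dots> = c3" by (simp add: c3_def mult.assoc)
      finally show ?thesis using c123 mult_nonneg_nonneg[OF c123(2) N3] by linarith
    qed
    also have "\<dots> \<le> (c1 + c2 + c3) * (1 + N3 t / (N t)\<^sup>2)"
      by (rule gen[OF N3])
    finally show "\<bar>Re ((1 - cis (x * t)) * ((1 - \<phi> t ^ K) / w t))\<bar> \<le> (c1 + c2 + c3) * (1 + N3 t / (N t)\<^sup>2)"
      by (simp add: z_def a_def)
  qed
qed

lemma dom_integrable': "integrable LL (\<lambda>t. C * (1 + N3 t / (N t)\<^sup>2))"
  by (intro integrable_mult_right Bochner_Integration.integrable_add dom_integrable integrable_LL_bounded[where B=1]) auto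

text \<open>Fourier inversion for the \<open>n\<close>-step probabilities. With the integral as
  definition the analysis needs no walk; \<open>prob_walk\<close> makes the identification at the
  end.\<close>

definition step_prob :: "nat \<Rightarrow> int \<Rightarrow> real" where
  "step_prob n k = (1 / pi) * (\<integral>t. Re (\<phi> t ^ n * cis (- (of_int k * t))) \<partial>LL)"

definition pot :: "int \<Rightarrow> real" where
  "pot x = (1 / pi) * (\<integral>t. Re ((1 - cis (of_int x * t)) / w t) \<partial>LL)"

lemma step_prob_integrable: "integrable LL (\<lambda>t. Re (\<phi> t ^ n * cis (- (of_int k * t))))"
proof (rule integrable_LL_bounded[where B=1])
  fix t :: real
  have "norm (\<phi> t ^ n * cis (- (of_int k * t))) \<le> 1" using norm_\<phi>[of t] by (simp add: norm_mult norm_power power_le_one)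
  thus "norm (Re (\<phi> t ^ n * cis (- (of_int k * t)))) \<le> 1"
    using abs_Re_le_cmod[of "\<phi> t ^ n * cis (- (of_int k * t))"] by simp
qed measurable

lemma pot_kernel_limit:
  shows "integrable LL (\<lambda>t. Re ((1 - cis (of_int x * t)) / w t))"
    and "(\<lambda>K. \<integral>t. Re ((1 - cis (of_int x * t)) * ((1 - \<phi> t ^ K) / w t)) \<partial>LL) \<longlonglongrightarrow> (\<integral>t. Re ((1 - cis (of_int x * t)) / w t) \<partial>LL)"
proof -
  obtain C where C: "\<And>K t. 0 < t \<Longrightarrow> t < pi \<Longrightarrow>
      \<bar>Re ((1 - cis (of_int x * t)) * ((1 - \<phi> t ^ K) / w t))\<bar> \<le> C * (1 + N3 t / (N t)\<^sup>2)"
    using kernel_dominated[of "of_int x"] by blast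
  have lim: "AE t in LL. (\<lambda>K. Re ((1 - cis (of_int x * t)) * ((1 - \<phi> t ^ K) / w t))) \<longlonglongrightarrow> Re ((1 - cis (of_int x * t)) / w t)"
    using AE_norm_\<phi>_less_1
  proof eventually_elim
    case (elim t)
    hence "(\<lambda>K. Re ((1 - cis (of_int x * t)) * ((1 - \<phi> t ^ K) / w t))) \<longlonglongrightarrow> Re ((1 - cis (of_int x * t)) * ((1 - 0) / w t))"
      unfolding divide_inverse by (intro tendsto_intros LIMSEQ_power_zero)
    thus ?case by simp
  qed
  have m1: "(\<lambda>t. Re ((1 - cis (of_int x * t)) / w t)) \<in> borel_measurable LL" by (rule LL_meas) measurable
  have m2: "(\<lambda>t. Re ((1 - cis (of_int x * t)) * ((1 - \<phi> t ^ K) / w t))) \<in> borel_measurable LL" for K by (rule LL_meas) measurable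
  have bd: "AE t in LL. norm (Re ((1 - cis (of_int x * t)) * ((1 - \<phi> t ^ K) / w t))) \<le> C * (1 + N3 t / (N t)\<^sup>2)" for K
    using C by (intro AE_I2) (auto simp: space_LL)
  note args = m1 m2 dom_integrable'[of C] lim bd
  show "integrable LL (\<lambda>t. Re ((1 - cis (of_int x * t)) / w t))"
    by (rule integrable_dominated_convergence[OF args])
  show "(\<lambda>K. \<integral>t. Re ((1 - cis (of_int x * t)) * ((1 - \<phi> t ^ K) / w t)) \<partial>LL) \<longlonglongrightarrow> (\<integral>t. Re ((1 - cis (of_int x * t)) / w t) \<partial>LL)"
    by (rule integral_dominated_convergence[OF args])
qed

text \<open>The geometric sum in \<open>\<phi> t\<close> turns partial sums into the dominated
  kernels above.\<close>

lemma step_prob_sums: "(\<lambda>n. step_prob n 0 - step_prob n (- x)) sums pot x"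
proof -
  have eq: "(\<Sum>n<K. step_prob n 0 - step_prob n (- x)) = (1 / pi) * (\<integral>t. Re ((1 - cis (of_int x * t)) * ((1 - \<phi> t ^ K) / w t)) \<partial>LL)" for K
  proof -
    have "(\<Sum>n<K. step_prob n 0 - step_prob n (- x)) =
      (\<Sum>n<K. (1 / pi) * (\<integral>t. Re (\<phi> t ^ n * cis (- (of_int 0 * t))) - Re (\<phi> t ^ n * cis (- (of_int (- x) * t))) \<partial>LL))"
      unfolding step_prob_def by (intro sum.cong refl) (simp only: right_diff_distrib[symmetric] Bochner_Integration.integral_diff[OF step_prob_integrable step_prob_integrable])
    also have "\<dots> = (1 / pi) * (\<Sum>n<K. \<integral>t. Re (\<phi> t ^ n * cis (- (of_int 0 * t))) - Re (\<phi> t ^ n * cis (- (of_int (- x) * t))) \<partial>LL)"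
      by (rule sum_distrib_left[symmetric])
    also have "(\<Sum>n<K. \<integral>t. Re (\<phi> t ^ n * cis (- (of_int 0 * t))) - Re (\<phi> t ^ n * cis (- (of_int (- x) * t))) \<partial>LL)
      = (\<integral>t. (\<Sum>n<K. Re (\<phi> t ^ n * cis (- (of_int 0 * t))) - Re (\<phi> t ^ n * cis (- (of_int (- x) * t)))) \<partial>LL)"
      by (intro Bochner_Integration.integral_sum[symmetric] Bochner_Integration.integrable_diff step_prob_integrable)
    also have "\<dots> = (\<integral>t. Re ((1 - cis (of_int x * t)) * ((1 - \<phi> t ^ K) / w t)) \<partial>LL)"
    proof (rule Bochner_Integration.integral_cong[OF refl])
      fix t assume "t \<in> space LL"
      hence t: "w t \<noteq> 0" using w_nonzero[of t] by (auto simp: space_LL)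
      have "(\<Sum>n<K. Re (\<phi> t ^ n * cis (- (of_int 0 * t))) - Re (\<phi> t ^ n * cis (- (of_int (- x) * t))))
          = Re (\<Sum>n<K. (1 - cis (of_int x * t)) * \<phi> t ^ n)"
        unfolding Re_sum by (intro sum.cong refl) (simp add: algebra_simps)
      also have "(\<Sum>n<K. (1 - cis (of_int x * t)) * \<phi> t ^ n) = (1 - cis (of_int x * t)) * ((1 - \<phi> t ^ K) / w t)"
        using sum_gp_strict[of "\<phi> t" K] t by (simp add: sum_distrib_left[symmetric])
      finally show "(\<Sum>n<K. Re (\<phi> t ^ n * cis (- (of_int 0 * t))) - Re (\<phi> t ^ n * cis (- (of_int (- x) * t))))
          = Re ((1 - cis (of_int x * t)) * ((1 - \<phi> t ^ K) / w t))" .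
    qed
    finally show ?thesis .
  qed
  thus ?thesis unfolding sums_def pot_def eq by (intro tendsto_intros pot_kernel_limit(2))
qed

end

section \<open>Green functions and the maximum principle\<close>

lemma Abel_sum_by_parts:
  fixes b :: "nat \<Rightarrow> real"
  assumes b: "b sums s" and r: "0 < r" "r < 1"
  shows "summable (\<lambda>n. r ^ n * b n)"
    and "summable (\<lambda>n. r ^ n * \<bar>(\<Sum>k\<le>n. b k) - s\<bar>)"
    and "(\<Sum>n. r ^ n * b n) - s = (1 - r) * (\<Sum>n. r ^ n * ((\<Sum>k\<le>n. b k) - s))"
proof -
  define B where "B n = (\<Sum>k\<le>n. b k) - s" for n
  have B: "B \<longlonglongrightarrow> 0" using b unfolding sums_def_le B_def by (simp add: LIM_zero)
  hence "Bseq B" by (intro convergent_imp_Bseq convergentI)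
  then obtain C where C: "\<And>n. \<bar>B n\<bar> \<le> C" by (auto simp: Bseq_def)
  have sB: "summable (\<lambda>n. r ^ n * \<bar>B n\<bar>)"
  proof (rule summable_comparison_test')
    show "summable (\<lambda>n. C * r ^ n)" using r by (intro summable_mult summable_geometric) auto
    show "norm (r ^ n * \<bar>B n\<bar>) \<le> C * r ^ n" if "n \<ge> 0" for n using C[of n] r by (simp add: abs_mult mult.commute mult_right_mono)
  qed
  thus "summable (\<lambda>n. r ^ n * \<bar>(\<Sum>k\<le>n. b k) - s\<bar>)" by (simp add: B_def)
  have sB': "summable (\<lambda>n. r ^ n * B n)"
    by (rule summable_norm_cancel) (use sB r in \<open>simp add: abs_mult\<close>)
  have b': "r ^ Suc n * b (Suc n) = r ^ Suc n * B (Suc n) - r * (r ^ n * B n)" for n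
    by (simp add: B_def algebra_simps)
  have b0: "b 0 = B 0 + s" by (simp add: B_def)
  have "(\<lambda>n. r ^ Suc n * B (Suc n)) sums ((\<Sum>n. r ^ n * B n) - B 0)"
    using summable_sums[OF sB'] by (subst sums_Suc_iff) simp
  hence "(\<lambda>n. r ^ Suc n * b (Suc n)) sums ((\<Sum>n. r ^ n * B n) - B 0 - r * (\<Sum>n. r ^ n * B n))"
    unfolding b' by (intro sums_diff sums_mult summable_sums sB')
  hence *: "(\<lambda>n. r ^ n * b n) sums ((\<Sum>n. r ^ n * B n) - B 0 - r * (\<Sum>n. r ^ n * B n) + b 0)"
    by (subst (asm) sums_Suc_iff) simp
  show "summable (\<lambda>n. r ^ n * b n)" using * by (rule sums_summable)
  show "(\<Sum>n. r ^ n * b n) - s = (1 - r) * (\<Sum>n. r ^ n * ((\<Sum>k\<le>n. b k) - s))"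
    using sums_unique[OF *, symmetric] b0 by (simp add: B_def[symmetric] algebra_simps)
qed

text \<open>Abel's theorem. The potential series may converge only conditionally, so discounting by
  \<open>r ^ n\<close> cannot be removed by dominated convergence. The first \<open>n0\<close>
  remainders contribute at most \<open>(1 - r) * S\<close>, the later ones at most
  \<open>\<epsilon> / 2\<close>.\<close>

lemma Abel_limit:
  fixes b :: "nat \<Rightarrow> real"
  assumes b: "b sums s"
  shows "((\<lambda>r. \<Sum>n. r ^ n * b n) \<longlongrightarrow> s) (at_left 1)"
proof (rule tendstoI)
  fix \<epsilon> :: real assume \<epsilon>: "\<epsilon> > 0"
  define B where "B n = (\<Sum>k\<le>n. b k) - s" for n
  have "B \<longlonglongrightarrow> 0" using b unfolding sums_def_le B_def by (simp add: LIM_zero)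
  then obtain n0 where n0: "\<And>n. n \<ge> n0 \<Longrightarrow> \<bar>B n\<bar> < \<epsilon> / 2"
    using LIMSEQ_D[of B 0 "\<epsilon>/2"] \<epsilon> by auto
  define S where "S = (\<Sum>n<n0. \<bar>B n\<bar>)"
  have S: "S \<ge> 0" by (simp add: S_def sum_nonneg)
  have main: "\<bar>(\<Sum>n. r ^ n * b n) - s\<bar> \<le> (1 - r) * S + \<epsilon> / 2" if r: "0 < r" "r < 1" for r
  proof -
    note ab = Abel_sum_by_parts[OF b r, folded B_def]
    have g: "(\<lambda>n. \<epsilon>/2 * r ^ n) sums (\<epsilon>/2 * (1 / (1 - r)))" using r by (intro sums_mult geometric_sums) simp
    have f: "(\<lambda>n. if n < n0 then \<bar>B n\<bar> else 0) sums S"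
      using sums_If_finite_set[of "{..<n0}" "\<lambda>n. \<bar>B n\<bar>"] by (simp add: S_def)
    have "r ^ n * \<bar>B n\<bar> \<le> (if n < n0 then \<bar>B n\<bar> else 0) + \<epsilon>/2 * r ^ n" for n
    proof (cases "n < n0")
      case True
      have "r ^ n * \<bar>B n\<bar> \<le> \<bar>B n\<bar>" using r by (intro mult_left_le_one_le) (auto simp: power_le_one)
      moreover have "0 \<le> \<epsilon>/2 * r ^ n" using \<epsilon> r by simp
      ultimately show ?thesis using True by (simp del: mult_nonneg_nonneg)
    next
      case False
      thus ?thesis using n0[of n] r mult_left_mono[of "\<bar>B n\<bar>" "\<epsilon>/2" "r ^ n"] by (simp add: mult.commute)
    qed
    hence "(\<Sum>n. r ^ n * \<bar>B n\<bar>) \<le> S + \<epsilon>/2 * (1 / (1 - r))"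
      using sums_add[OF f g] ab(2) by (intro sums_le[OF _ summable_sums[OF ab(2)] sums_add[OF f g]])
    moreover have "\<bar>\<Sum>n. r ^ n * B n\<bar> \<le> (\<Sum>n. r ^ n * \<bar>B n\<bar>)"
      using summable_rabs[of "\<lambda>n. r ^ n * B n"] ab(2) r by (simp add: abs_mult)
    ultimately have "\<bar>(\<Sum>n. r ^ n * b n) - s\<bar> \<le> (1 - r) * (S + \<epsilon>/2 * (1 / (1 - r)))"
      unfolding ab(3) abs_mult using r by (simp add: mult_left_mono)
    also have "\<dots> = (1 - r) * S + \<epsilon> / 2" using r by (simp add: field_simps)
    finally show ?thesis .
  qed
  show "\<forall>\<^sub>F r in at_left 1. dist (\<Sum>n. r ^ n * b n) s < \<epsilon>"
    unfolding eventually_at_left_field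
  proof (intro exI[of _ "max (1/2) (1 - \<epsilon> / (4 * (S + 1)))"] conjI allI impI)
    show "max (1/2) (1 - \<epsilon> / (4 * (S + 1))) < 1" using \<epsilon> S by simp
    fix r :: real assume r: "max (1/2) (1 - \<epsilon> / (4 * (S + 1))) < r" "r < 1"
    have "1 - r \<le> \<epsilon> / (4 * (S + 1))" using r by simp
    hence "(1 - r) * S \<le> \<epsilon> / (4 * (S + 1)) * S" using S by (intro mult_right_mono)
    also have "\<dots> \<le> \<epsilon> / 4" using S \<epsilon> by (simp add: field_simps)
    finally have "(1 - r) * S < \<epsilon> / 2" using \<epsilon> by linarith
    thus "dist (\<Sum>n. r ^ n * b n) s < \<epsilon>" using main[of r] r by (simp add: dist_real_def)
  qed
qed

lemma LL_integral_cos: "(\<integral>t. cos (of_int k * t) \<partial>LL) = (if k = 0 then pi else 0)" for k :: int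
proof -
  have i: "integrable LL (\<lambda>t. cos (of_int k * t))" by (rule integrable_LL_bounded[where B=1]) auto
  have "((\<lambda>t. cos (of_int k * t)) has_integral (if k = 0 then pi else 0)) {0..pi}"
  proof (cases "k = 0")
    case True
    thus ?thesis using has_integral_const_real[of "1::real" 0 pi] by simp
  next
    case False
    have "((\<lambda>t. cos (of_int k * t)) has_integral (sin (of_int k * pi) / of_int k - sin (of_int k * 0) / of_int k)) {0..pi}"
      using False by (intro fundamental_theorem_of_calculus)
        (auto intro!: derivative_eq_intros simp: has_real_derivative_iff_has_vector_derivative[symmetric])
    thus ?thesis using False by (simp add: mult.commute sin_int_times_real)
  qed
  thus ?thesis using LL_HK(2)[OF i] by (simp add: integral_unique)
qed

section \<open>Discounted Green functions\<close>

context step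
begin

sublocale LL: finite_measure LL by (rule finite_measure_LL)
sublocale pair_LL: pair_sigma_finite M LL
  by (intro pair_sigma_finite.intro sigma_finite_measure_axioms LL.sigma_finite_measure_axioms)

lemma step_prob_0: "step_prob 0 k = (if k = 0 then 1 else 0)"
  by (simp add: step_prob_def LL_integral_cos)

lemma measurable_prod_LL: "f \<in> borel_measurable (M \<Otimes>\<^sub>M borel) \<Longrightarrow> f \<in> borel_measurable (M \<Otimes>\<^sub>M LL)"
  for f :: "'a \<times> real \<Rightarrow> 'b::topological_space"
proof -
  assume f: "f \<in> borel_measurable (M \<Otimes>\<^sub>M borel)"
  have "(\<lambda>x. x) \<in> measurable LL borel" by (rule LL_meas) simp
  hence "(\<lambda>x. (fst x, snd x)) \<in> measurable (M \<Otimes>\<^sub>M LL) (M \<Otimes>\<^sub>M (borel :: real measure))"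
    by (intro measurable_Pair measurable_fst measurable_compose[OF measurable_snd])
  from measurable_compose[OF this f] show ?thesis by simp
qed

text \<open>Fubini: averaging over one more step multiplies the integrand by
  \<open>\<phi> t\<close>. The recursion also shows that the integrals lie in the unit interval,
  which is not visible from their definition.\<close>

lemma step_prob_Suc: "step_prob (Suc n) k = expectation (\<lambda>\<omega>. step_prob n (k - Y \<omega>))"
proof -
  let ?f = "\<lambda>\<omega> t. Re (\<phi> t ^ n * cis (- (of_int (k - Y \<omega>) * t)))"
  have m: "case_prod ?f \<in> borel_measurable (M \<Otimes>\<^sub>M LL)"
    by (rule measurable_prod_LL) (unfold of_int_diff, measurable)
  have bd: "norm (?f \<omega> t) \<le> 1" for \<omega> t
  proof -
    have "norm (\<phi> t ^ n * cis (- (of_int (k - Y \<omega>) * t))) \<le> 1" using norm_\<phi>[of t] by (simp add: norm_mult norm_power power_le_one)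
    thus ?thesis using abs_Re_le_cmod[of "\<phi> t ^ n * cis (- (of_int (k - Y \<omega>) * t))"] by simp
  qed
  interpret P: finite_measure "M \<Otimes>\<^sub>M LL"
    by (intro finite_measure_pair_measure finite_measure_axioms LL.finite_measure_axioms)
  have i: "integrable (M \<Otimes>\<^sub>M LL) (case_prod ?f)"
    by (rule P.integrable_const_bound[where B=1]) (use bd m in auto)
  have "expectation (\<lambda>\<omega>. step_prob n (k - Y \<omega>)) = (1/pi) * (\<integral>\<omega>. (\<integral>t. ?f \<omega> t \<partial>LL) \<partial>M)"
    unfolding step_prob_def by (rule integral_mult_right_zero)
  also have "(\<integral>\<omega>. (\<integral>t. ?f \<omega> t \<partial>LL) \<partial>M) = (\<integral>t. (\<integral>\<omega>. ?f \<omega> t \<partial>M) \<partial>LL)"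
    by (rule pair_LL.Fubini_integral[OF i, symmetric])
  also have "\<dots> = (\<integral>t. Re (\<phi> t ^ Suc n * cis (- (of_int k * t))) \<partial>LL)"
  proof (rule Bochner_Integration.integral_cong[OF refl])
    fix t
    have ic: "integrable M (\<lambda>\<omega>. cis (t * of_int (Y \<omega>)))" by (rule integrable_cis) measurable
    have "(\<integral>\<omega>. ?f \<omega> t \<partial>M) = (\<integral>\<omega>. Re ((\<phi> t ^ n * cis (- (of_int k * t))) * cis (t * of_int (Y \<omega>))) \<partial>M)"
    proof (rule Bochner_Integration.integral_cong[OF refl])
      fix \<omega>
      have "cis (- (of_int (k - Y \<omega>) * t)) = cis (- (of_int k * t)) * cis (t * of_int (Y \<omega>))"
        by (simp add: cis_mult algebra_simps)
      thus "?f \<omega> t = Re ((\<phi> t ^ n * cis (- (of_int k * t))) * cis (t * of_int (Y \<omega>)))" by (simp only: mult.assoc)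
    qed
    also have "\<dots> = Re (\<integral>\<omega>. (\<phi> t ^ n * cis (- (of_int k * t))) * cis (t * of_int (Y \<omega>)) \<partial>M)"
      using ic by (intro integral_Re integrable_mult_right)
    also have "(\<integral>\<omega>. (\<phi> t ^ n * cis (- (of_int k * t))) * cis (t * of_int (Y \<omega>)) \<partial>M) = (\<phi> t ^ n * cis (- (of_int k * t))) * \<phi> t"
      unfolding \<phi>_def by (rule integral_mult_right_zero)
    finally show "(\<integral>\<omega>. ?f \<omega> t \<partial>M) = Re (\<phi> t ^ Suc n * cis (- (of_int k * t)))" by (simp only: power_Suc mult_ac)
  qed
  finally show ?thesis by (simp only: step_prob_def)
qed

lemma int_fun_Y_meas [measurable]: "(\<lambda>\<omega>. f (Y \<omega>)) \<in> borel_measurable M" for f :: "int \<Rightarrow> real"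
  by (rule measurable_compose[OF Y_meas]) simp

lemma integrable_Y_bounded: "integrable M (\<lambda>\<omega>. f (Y \<omega>))" if "\<And>k. \<bar>f k\<bar> \<le> B" for f :: "int \<Rightarrow> real"
  by (rule integrable_const_bound[where B=B]) (use that in auto)

lemma step_prob_bounds: "0 \<le> step_prob n k \<and> step_prob n k \<le> 1"
proof (induction n arbitrary: k)
  case 0
  show ?case by (simp add: step_prob_0)
next
  case (Suc n)
  have "0 \<le> expectation (\<lambda>\<omega>. step_prob n (k - Y \<omega>))" by (rule integral_nonneg_AE) (simp add: Suc)
  moreover have "expectation (\<lambda>\<omega>. step_prob n (k - Y \<omega>)) \<le> expectation (\<lambda>_. 1)"
    by (rule integral_mono) (use Suc integrable_Y_bounded[of "\<lambda>y. step_prob n (k - y)" 1] in \<open>auto simp: abs_le_iff intro: order_trans[of _ 0]\<close>)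
  ultimately show ?case by (simp add: step_prob_Suc prob_space)
qed

text \<open>The Green function of the walk killed with probability \<open>1 - r\<close> at each
  step. Unlike the undiscounted series it is bounded, as the maximum principle demands.\<close>

definition green :: "real \<Rightarrow> int \<Rightarrow> real" where "green r k = (\<Sum>n. r ^ n * step_prob n k)"

context
  fixes r :: real
  assumes r: "0 < r" "r < 1"
begin

lemma green_summable: "summable (\<lambda>n. r ^ n * step_prob n k)"
proof (rule summable_comparison_test')
  show "summable (\<lambda>n. r ^ n)" using r by (intro summable_geometric) auto
  show "norm (r ^ n * step_prob n k) \<le> r ^ n" if "n \<ge> 0" for n
    using step_prob_bounds[of n k] r by (simp add: abs_mult mult_left_le)
qed

lemma green_bounds: "0 \<le> green r k" "green r k \<le> 1 / (1 - r)"
proof -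
  show "0 \<le> green r k" unfolding green_def using step_prob_bounds r by (intro suminf_nonneg green_summable) auto
  have "green r k \<le> (\<Sum>n. r ^ n)" unfolding green_def
    using step_prob_bounds r by (intro suminf_le green_summable summable_geometric) (auto simp: mult_left_le)
  thus "green r k \<le> 1 / (1 - r)" using r by (simp add: suminf_geometric)
qed

lemma green_abs_le: "\<bar>green r k\<bar> \<le> 1 / (1 - r)" using green_bounds[of k] by simp

lemma green_equation: "green r k = (if k = 0 then 1 else 0) + r * expectation (\<lambda>\<omega>. green r (k - Y \<omega>))"
proof -
  have i: "integrable M (\<lambda>\<omega>. r ^ n * step_prob n (k - Y \<omega>))" for n
    by (intro integrable_mult_right integrable_Y_bounded[of "\<lambda>y. step_prob n (k - y)" 1])
       (use step_prob_bounds in \<open>auto simp: abs_le_iff intro: order_trans[of _ 0]\<close>)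
  have s: "summable (\<lambda>n. expectation (\<lambda>\<omega>. r ^ n * step_prob n (k - Y \<omega>)))"
  proof -
    have "(\<lambda>n. expectation (\<lambda>\<omega>. r ^ n * step_prob n (k - Y \<omega>))) = (\<lambda>n. r ^ n * step_prob (Suc n) k)"
      by (simp add: step_prob_Suc)
    moreover have "summable (\<lambda>n. r ^ n * step_prob (Suc n) k)"
    proof (rule summable_comparison_test')
      show "summable (\<lambda>n. r ^ n)" using r by (intro summable_geometric) auto
      show "norm (r ^ n * step_prob (Suc n) k) \<le> r ^ n" if "n \<ge> 0" for n
        using step_prob_bounds[of "Suc n" k] r by (simp add: abs_mult mult_left_le)
    qed
    ultimately show ?thesis by simp
  qed
  have ab: "norm (r ^ n * step_prob n j) = r ^ n * step_prob n j" for n j using step_prob_bounds[of n j] r by (simp add: abs_mult)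
  have "(\<Sum>n. expectation (\<lambda>\<omega>. r ^ n * step_prob n (k - Y \<omega>))) = expectation (\<lambda>\<omega>. green r (k - Y \<omega>))"
    unfolding green_def using i s green_summable by (intro integral_suminf[symmetric]) (auto simp only: ab intro!: AE_I2)
  hence "(\<Sum>n. r ^ n * step_prob (Suc n) k) = expectation (\<lambda>\<omega>. green r (k - Y \<omega>))" by (simp add: step_prob_Suc)
  hence "r * expectation (\<lambda>\<omega>. green r (k - Y \<omega>)) = (\<Sum>n. r * (r ^ n * step_prob (Suc n) k))"
    using s by (subst suminf_mult) (auto simp: step_prob_Suc)
  also have "\<dots> = (\<Sum>n. r ^ Suc n * step_prob (Suc n) k)" by (simp add: mult.assoc)
  also have "\<dots> = green r k - step_prob 0 k" unfolding green_def by (subst suminf_split_head[OF green_summable]) simp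
  finally show ?thesis by (simp add: step_prob_0)
qed

text \<open>Killing replaces compactness: a negative infimum \<open>m\<close> would satisfy
  \<open>m \<ge> r * m > m\<close>. The infimum need not be attained.\<close>

lemma maximum_principle:
  fixes h :: "int \<Rightarrow> real"
  assumes bdd: "\<And>x. \<bar>h x\<bar> \<le> B" and F: "\<And>x. x \<in> F \<Longrightarrow> h x \<ge> 0"
    and super: "\<And>x. x \<notin> F \<Longrightarrow> r * expectation (\<lambda>\<omega>. h (x + Y \<omega>)) \<le> h x"
  shows "h x \<ge> 0"
proof -
  define m where "m = (INF x. h x)"
  have bb: "bdd_below (range h)" using bdd by (intro bdd_belowI2[of _ "- B"]) (metis abs_le_iff minus_le_iff)
  have mle: "m \<le> h x" for x unfolding m_def by (rule cINF_lower[OF bb]) simp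
  have "min 0 (r * m) \<le> m"
    unfolding m_def
  proof (rule cINF_greatest)
    fix x
    show "min 0 (r * (INF x. h x)) \<le> h x"
    proof (cases "x \<in> F")
      case True
      thus ?thesis using F[of x] by simp
    next
      case False
      have "m = expectation (\<lambda>_. m)" by (simp add: prob_space)
      also have "\<dots> \<le> expectation (\<lambda>\<omega>. h (x + Y \<omega>))"
        using mle bdd by (intro integral_mono integrable_Y_bounded[of "\<lambda>y. h (x + y)"]) auto
      finally have "r * m \<le> r * expectation (\<lambda>\<omega>. h (x + Y \<omega>))" using r by (intro mult_left_mono) auto
      thus ?thesis using super[OF False] unfolding m_def by simp
    qed
  qed simp
  hence "m \<ge> 0"
  proof (rule contrapos_pp)
    assume "\<not> 0 \<le> m"
    hence "m < 0" by simp
    hence "m < r * m" using mult_strict_right_mono_neg[OF r(2), of m] by simp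
    thus "\<not> min 0 (r * m) \<le> m" using \<open>m < 0\<close> unfolding min_le_iff_disj by linarith
  qed
  thus ?thesis using mle[of x] by simp
qed

definition "pot_r x = green r 0 - green r (- x)"

lemma green_eq_ar: "green r k = green r 0 - pot_r (- k)" by (simp add: pot_r_def)

lemma int_gr: "integrable M (\<lambda>\<omega>. green r (k - (x + Y \<omega>)))"
  by (rule integrable_Y_bounded[of "\<lambda>y. green r (k - (x + y))"]) (rule green_abs_le)

lemma green_equation': "r * expectation (\<lambda>\<omega>. green r (k - (x + Y \<omega>))) = green r (k - x) - (if x = k then 1 else 0)"
  using green_equation[of "k - x"] by (auto simp: algebra_simps)

lemma expectation_affine:
  "r * expectation (\<lambda>\<omega>. c0 + c1 * green r (k - (x + Y \<omega>)) + c2 * green r (l - (x + Y \<omega>))) =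
    r * c0 + c1 * (green r (k - x) - (if x = k then 1 else 0)) + c2 * (green r (l - x) - (if x = l then 1 else 0))"
proof -
  have "expectation (\<lambda>\<omega>. c0 + c1 * green r (k - (x + Y \<omega>)) + c2 * green r (l - (x + Y \<omega>)))
    = c0 + c1 * expectation (\<lambda>\<omega>. green r (k - (x + Y \<omega>))) + c2 * expectation (\<lambda>\<omega>. green r (l - (x + Y \<omega>)))"
    using int_gr by (simp add: prob_space)
  thus ?thesis unfolding green_equation'[symmetric] by (simp add: algebra_simps)
qed

lemma affine_bounded: "\<bar>c0 + c1 * green r i + c2 * green r j\<bar> \<le> \<bar>c0\<bar> + \<bar>c1\<bar> * (1 / (1 - r)) + \<bar>c2\<bar> * (1 / (1 - r))"
proof -
  have "\<bar>c1 * green r i\<bar> \<le> \<bar>c1\<bar> * (1 / (1 - r))" "\<bar>c2 * green r j\<bar> \<le> \<bar>c2\<bar> * (1 / (1 - r))"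
    unfolding abs_mult by (intro mult_left_mono green_abs_le; simp)+
  thus ?thesis by linarith
qed

lemma pot_r_nonneg: "pot_r x \<ge> 0"
proof -
  have "0 \<le> green r 0 + (-1) * green r (0 - x) + 0 * green r (0 - x)"
  proof (rule maximum_principle[where F="{0}" and h="\<lambda>x. green r 0 + (-1) * green r (0 - x) + 0 * green r (0 - x)"])
    fix x :: int assume "x \<notin> {0}"
    thus "r * expectation (\<lambda>\<omega>. green r 0 + - 1 * green r (0 - (x + Y \<omega>)) + 0 * green r (0 - (x + Y \<omega>))) \<le> green r 0 + - 1 * green r (0 - x) + 0 * green r (0 - x)"
      unfolding expectation_affine using r green_bounds(1)[of 0] by (simp add: mult_left_le_one_le)
  qed (use affine_bounded[of "green r 0" "-1" _ 0] in auto)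
  thus ?thesis by (simp add: pot_r_def)
qed

lemma green_0_ge_1: "green r 0 \<ge> 1"
proof -
  have "expectation (\<lambda>\<omega>. green r (0 - Y \<omega>)) \<ge> 0" by (rule integral_nonneg_AE) (simp add: green_bounds)
  thus ?thesis using green_equation[of 0] r by simp
qed

text \<open>\<open>green r 0\<close> times the Green function of the walk killed at \<open>0\<close> and at rate \<open>1 - r\<close>.\<close>
definition "killed_green z x = green r 0 * green r (z - x) - green r (- x) * green r z"

lemma killed_green_alt: "killed_green z x = 0 + green r 0 * green r (z - x) + (- green r z) * green r (0 - x)"
  by (simp add: killed_green_def)

lemma killed_green_expectation: "r * expectation (\<lambda>\<omega>. killed_green z (x + Y \<omega>)) =
    killed_green z x - green r 0 * (if x = z then 1 else 0) + green r z * (if x = 0 then 1 else 0)"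
  unfolding killed_green_alt expectation_affine by (auto simp: algebra_simps)

lemma killed_green_bounded: "\<exists>B. \<forall>x. \<bar>killed_green z x\<bar> \<le> B"
  unfolding killed_green_alt using affine_bounded by blast

text \<open>It vanishes at 0, and the only source outside 0 is a positive one at
  \<open>z\<close>.\<close>

lemma killed_green_nonneg: "killed_green z x \<ge> 0"
proof -
  obtain B where "\<And>x. \<bar>killed_green z x\<bar> \<le> B" using killed_green_bounded by blast
  thus ?thesis
  proof (rule maximum_principle[where F="{0}"])
    fix x :: int assume "x \<notin> {0}"
    thus "r * expectation (\<lambda>\<omega>. killed_green z (x + Y \<omega>)) \<le> killed_green z x"
      unfolding killed_green_expectation using green_bounds(1)[of 0] by simp
  qed (simp add: killed_green_def)
qed

lemma killed_green_eq: "killed_green z x = green r 0 * (pot_r x + pot_r (- z) - pot_r (x - z)) - pot_r x * pot_r (- z)"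
  unfolding killed_green_def green_eq_ar[of "z - x"] green_eq_ar[of "- x"] green_eq_ar[of z] by (simp add: algebra_simps)

text \<open>In \<open>killed_green_eq\<close> the subtracted product is nonnegative and may be
  dropped; then the positive factor \<open>green r 0\<close> cancels.\<close>

lemma pot_r_subadditive: "pot_r (x - z) \<le> pot_r x + pot_r (- z)"
proof -
  have "0 \<le> pot_r x * pot_r (- z)" using pot_r_nonneg by simp
  hence "0 \<le> green r 0 * (pot_r x + pot_r (- z) - pot_r (x - z))" using killed_green_nonneg[of z x] unfolding killed_green_eq by linarith
  hence "0 \<le> pot_r x + pot_r (- z) - pot_r (x - z)" using green_0_ge_1 by (simp add: zero_le_mult_iff)
  thus ?thesis by simp
qed

text \<open>Among the points \<open>0, z\<close>, a walk killed at rate \<open>1 - r\<close> that starts at \<open>x\<close> and visits \<open>z\<close>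
  before \<open>0\<close> may afterwards be killed before visiting \<open>0\<close>; \<open>pot_r\<close> measures the latter event.\<close>
lemma pot_r_three_points: "pot_r (- z) * (pot_r z - pot_r x) \<le> pot_r z * pot_r (x - z)"
proof -
  \<comment> \<open>The combination vanishes at both 0 and \<open>z\<close>. Elsewhere
    \<open>killed_green z\<close> is harmonic for the killed walk and \<open>pot_r\<close> is
    superharmonic.\<close>
  define h where "h x = pot_r x * killed_green z z - killed_green z x * pot_r z" for x
  obtain B where B: "\<And>x. \<bar>killed_green z x\<bar> \<le> B" using killed_green_bounded by blast
  have "h x \<ge> 0"
  proof (rule maximum_principle[where F="{0, z}"])
    fix x
    have "\<bar>pot_r x\<bar> \<le> 1 / (1 - r) + 1 / (1 - r)" unfolding pot_r_def using green_abs_le[of 0] green_abs_le[of "- x"] by linarith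
    hence "\<bar>pot_r x * killed_green z z\<bar> \<le> (1 / (1 - r) + 1 / (1 - r)) * \<bar>killed_green z z\<bar>" unfolding abs_mult by (rule mult_right_mono) simp
    moreover have "\<bar>killed_green z x * pot_r z\<bar> \<le> B * \<bar>pot_r z\<bar>" unfolding abs_mult by (rule mult_right_mono[OF B]) simp
    ultimately show "\<bar>h x\<bar> \<le> (1 / (1 - r) + 1 / (1 - r)) * \<bar>killed_green z z\<bar> + B * \<bar>pot_r z\<bar>" unfolding h_def by linarith
  next
    fix x assume "x \<in> {0, z}"
    thus "h x \<ge> 0" by (auto simp: h_def pot_r_def killed_green_def)
  next
    fix x assume x: "x \<notin> {0, z}"
    have i1: "integrable M (\<lambda>\<omega>. pot_r (x + Y \<omega>))" unfolding pot_r_def using int_gr[of 0 x] by simp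
    have i2: "integrable M (\<lambda>\<omega>. killed_green z (x + Y \<omega>))" 
      unfolding killed_green_alt by (intro Bochner_Integration.integrable_add integrable_mult_right int_gr integrable_const)
    have "expectation (\<lambda>\<omega>. h (x + Y \<omega>)) = expectation (\<lambda>\<omega>. pot_r (x + Y \<omega>)) * killed_green z z - expectation (\<lambda>\<omega>. killed_green z (x + Y \<omega>)) * pot_r z"
      unfolding h_def using i1 i2 by simp
    hence "r * expectation (\<lambda>\<omega>. h (x + Y \<omega>)) = (r * expectation (\<lambda>\<omega>. pot_r (x + Y \<omega>))) * killed_green z z - (r * expectation (\<lambda>\<omega>. killed_green z (x + Y \<omega>))) * pot_r z"
      by (simp only: right_diff_distrib mult.assoc)
    also have "r * expectation (\<lambda>\<omega>. killed_green z (x + Y \<omega>)) = killed_green z x" unfolding killed_green_expectation using x by simp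
    also have "(r * expectation (\<lambda>\<omega>. pot_r (x + Y \<omega>))) * killed_green z z \<le> pot_r x * killed_green z z"
    proof (rule mult_right_mono[OF _ killed_green_nonneg])
      have "pot_r y = green r 0 + (-1) * green r (0 - y) + 0 * green r (0 - y)" for y by (simp add: pot_r_def)
      hence "r * expectation (\<lambda>\<omega>. pot_r (x + Y \<omega>)) = r * green r 0 - green r (- x)"
        using expectation_affine[of "green r 0" "-1" 0 x 0 0] x by simp
      also have "\<dots> \<le> pot_r x" unfolding pot_r_def using r green_bounds(1)[of 0] by (simp add: mult_left_le_one_le)
      finally show "r * expectation (\<lambda>\<omega>. pot_r (x + Y \<omega>)) \<le> pot_r x" .
    qed
    finally show "r * expectation (\<lambda>\<omega>. h (x + Y \<omega>)) \<le> h x" by (simp add: h_def)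
  qed
  \<comment> \<open>The triple products without the factor \<open>green r 0\<close> cancel in
    \<open>h x\<close>, so this factor can be divided out.\<close>
  hence "0 \<le> green r 0 * (pot_r x * (pot_r z + pot_r (- z)) - (pot_r x + pot_r (- z) - pot_r (x - z)) * pot_r z)"
    unfolding h_def killed_green_eq by (simp add: algebra_simps pot_r_def)
  hence "0 \<le> pot_r x * (pot_r z + pot_r (- z)) - (pot_r x + pot_r (- z) - pot_r (x - z)) * pot_r z"
    using green_0_ge_1 by (simp add: zero_le_mult_iff)
  thus ?thesis by (simp add: algebra_simps)
qed

end

section \<open>Removing the discount: the limit as r tends to 1\<close>

lemma pot_r_tendsto: "((\<lambda>r. green r 0 - green r (- x)) \<longlongrightarrow> pot x) (at_left 1)"
proof (rule Lim_transform_eventually[OF Abel_limit[OF step_prob_sums]])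
  have "\<forall>\<^sub>F r in at_left (1::real). 0 < r \<and> r < 1"
    unfolding eventually_at_left_field by (intro exI[of _ 0]) auto
  thus "\<forall>\<^sub>F r in at_left 1. (\<Sum>n. r ^ n * (step_prob n 0 - step_prob n (- x))) = green r 0 - green r (- x)"
  proof eventually_elim
    case (elim r)
    thus ?case unfolding green_def by (subst suminf_diff[OF green_summable green_summable]) (auto simp: right_diff_distrib)
  qed
qed

lemma eventually_at_left_1: "\<forall>\<^sub>F r in at_left (1::real). 0 < r \<and> r < 1"
  unfolding eventually_at_left_field by (intro exI[of _ 0]) auto

lemma pot_nonneg: "pot x \<ge> 0"
proof (rule tendsto_lowerbound[OF pot_r_tendsto])
  show "\<forall>\<^sub>F r in at_left 1. 0 \<le> green r 0 - green r (- x)"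
    using eventually_at_left_1
  proof eventually_elim
    case (elim r)
    thus ?case using pot_r_nonneg[of r x] by (simp add: pot_r_def)
  qed
qed simp

lemma pot_0: "pot 0 = 0" by (simp add: pot_def)

lemma pot_subadditive: "pot (x + y) \<le> pot x + pot y"
proof (rule tendsto_le[OF _ tendsto_add[OF pot_r_tendsto[of x] pot_r_tendsto[of y]] pot_r_tendsto[of "x + y"]])
  show "\<forall>\<^sub>F r in at_left 1. green r 0 - green r (- (x + y)) \<le> green r 0 - green r (- x) + (green r 0 - green r (- y))"
    using eventually_at_left_1
  proof eventually_elim
    case (elim r)
    thus ?case using pot_r_subadditive[of r x "- y"] by (simp add: pot_r_def)
  qed
qed simp

lemma pot_three_points: "pot (- z) * (pot z - pot x) \<le> pot z * pot (x - z)"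
proof (rule tendsto_le[OF _ tendsto_mult[OF pot_r_tendsto[of z] pot_r_tendsto[of "x - z"]]
      tendsto_mult[OF pot_r_tendsto[of "- z"] tendsto_diff[OF pot_r_tendsto[of z] pot_r_tendsto[of x]]]])
  show "\<forall>\<^sub>F r in at_left 1. (green r 0 - green r (- (- z))) * (green r 0 - green r (- z) - (green r 0 - green r (- x))) \<le> (green r 0 - green r (- z)) * (green r 0 - green r (- (x - z)))"
    using eventually_at_left_1
  proof eventually_elim
    case (elim r)
    thus ?case using pot_r_three_points[of r z x] by (simp add: pot_r_def)
  qed
qed simp

end

section \<open>Fourier series of the right-continuous comparison walk\<close>

lemma Re_of_real_mult: "Re (of_real a * z) = a * Re z"
  by simp

context step
begin

definition Vsum :: "real \<Rightarrow> 'a \<Rightarrow> complex" where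
  "Vsum t \<omega> = (\<Sum>l<nat (- Y \<omega>). cis (- (real (Suc l) * t)))"

text \<open>Characteristic function of the law that gives \<open>-l\<close> the mass
  \<open>P(Y \<le> -l) / e\<close> for \<open>l \<ge> 1\<close>. The total mass is 1 because
  \<open>e\<close> is the mean of \<open>Ym\<close>. It is carried by the strictly negative
  integers.\<close>

definition V :: "real \<Rightarrow> complex" where "V t = (\<integral>\<omega>. Vsum t \<omega> \<partial>M) / of_real e"

lemma nat_Y: "real (nat (- Y \<omega>)) = Ym \<omega>" by (simp add: Ym_def)

lemma nat_Y_meas [measurable]: "(\<lambda>\<omega>. nat (- Y \<omega>)) \<in> measurable M (count_space UNIV)"
  by (rule measurable_compose[OF Y_meas]) simp

lemma measurable_sum_nat_Y:
  fixes f :: "nat \<Rightarrow> 'a \<times> real \<Rightarrow> 'b::{second_countable_topology, real_normed_vector}"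
  assumes [measurable]: "\<And>l. f l \<in> borel_measurable (M \<Otimes>\<^sub>M borel)"
  shows "(\<lambda>x. \<Sum>l<nat (- Y (fst x)). f l x) \<in> borel_measurable (M \<Otimes>\<^sub>M borel)"
  by (rule measurable_compose_countable'[where I=UNIV and f="\<lambda>n x. \<Sum>l<n. f l x"]) auto

lemma Vsum_meas2 [measurable]: "(\<lambda>x. Vsum (snd x) (fst x)) \<in> borel_measurable (M \<Otimes>\<^sub>M borel)"
  unfolding Vsum_def by (rule measurable_sum_nat_Y) measurable

lemma Vsum_meas [measurable]: "Vsum t \<in> borel_measurable M"
proof -
  have "(\<lambda>\<omega>. (\<lambda>x. Vsum (snd x) (fst x)) (\<omega>, t)) \<in> borel_measurable M"
    by (rule measurable_compose[OF _ Vsum_meas2]) measurable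
  thus ?thesis by simp
qed

lemma norm_Vsum: "norm (Vsum t \<omega>) \<le> Ym \<omega>"
proof -
  have "norm (Vsum t \<omega>) \<le> (\<Sum>l<nat (- Y \<omega>). norm (cis (- (real (Suc l) * t))))"
    unfolding Vsum_def by (rule norm_sum)
  thus ?thesis by (simp add: nat_Y)
qed

lemma Vsum_integrable: "integrable M (Vsum t)"
  by (rule Bochner_Integration.integrable_bound[OF Ym_int]) (use norm_Vsum Ym_nonneg in auto)

lemma V_meas [measurable]: "V \<in> borel_measurable borel"
proof -
  have "(\<lambda>t. \<integral>\<omega>. Vsum t \<omega> \<partial>M) \<in> borel_measurable borel"
  proof (rule borel_measurable_lebesgue_integral)
    have "(\<lambda>x. (\<lambda>y. Vsum (snd y) (fst y)) (snd x, fst x)) \<in> borel_measurable (borel \<Otimes>\<^sub>M M)"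
      by (rule measurable_compose[OF _ Vsum_meas2]) measurable
    thus "(\<lambda>(t, \<omega>). Vsum t \<omega>) \<in> borel_measurable (borel \<Otimes>\<^sub>M M)" by (simp add: case_prod_beta')
  qed
  thus ?thesis unfolding V_def[abs_def] by measurable
qed

lemma norm_V: "norm (V t) \<le> 1"
proof -
  have "norm (\<integral>\<omega>. Vsum t \<omega> \<partial>M) \<le> expectation (\<lambda>\<omega>. norm (Vsum t \<omega>))" by (rule integral_norm_bound)
  also have "\<dots> \<le> expectation Ym" using norm_Vsum Vsum_integrable Ym_int by (intro integral_mono integrable_norm) auto
  finally show ?thesis using e_pos by (simp add: V_def norm_divide e_eq[symmetric])
qed

lemma b_eq_expectation: "b t = (\<integral>\<omega>. 1 - cis (- (t * Ym \<omega>)) \<partial>M) + of_real e * (1 - cis t)" if t: "t > 0"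
proof -
  have ic: "integrable M (\<lambda>\<omega>. 1 - cis (- (t * Ym \<omega>)))"
    by (intro Bochner_Integration.integrable_diff integrable_cis) auto
  have "Re (\<integral>\<omega>. 1 - cis (- (t * Ym \<omega>)) \<partial>M) = Cm t"
    unfolding integral_Re[OF ic, symmetric] Cm_def by simp
  moreover have "Im (\<integral>\<omega>. 1 - cis (- (t * Ym \<omega>)) \<partial>M) = t * e - Sm t"
  proof -
    have "Im (\<integral>\<omega>. 1 - cis (- (t * Ym \<omega>)) \<partial>M) = expectation (\<lambda>\<omega>. t * Ym \<omega> - (t * Ym \<omega> - sin (t * Ym \<omega>)))"
      unfolding integral_Im[OF ic, symmetric] by simp
    also have "\<dots> = expectation (\<lambda>\<omega>. t * Ym \<omega>) - Sm t"
      unfolding Sm_def using Ym_int Ym_bounds(2)[OF t] by (intro Bochner_Integration.integral_diff) auto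
    finally show ?thesis by (simp add: e_eq)
  qed
  ultimately show ?thesis by (simp add: b_def complex_eq_iff algebra_simps)
qed

lemma Vsum_telescope: "(1 - cis t) * Vsum t \<omega> = - (1 - cis (- (t * Ym \<omega>)))"
proof -
  have "(1 - cis t) * (\<Sum>l<k. cis (- (real (Suc l) * t))) = - (1 - cis (- (t * real k)))" for k
  proof (induction k)
    case (Suc k)
    have *: "cis t * cis (- (real (Suc k) * t)) = cis (- (t * real k))" by (simp add: cis_mult algebra_simps)
    have "(1 - cis t) * (\<Sum>l<Suc k. cis (- (real (Suc l) * t)))
        = (1 - cis t) * (\<Sum>l<k. cis (- (real (Suc l) * t))) + (1 - cis t) * cis (- (real (Suc k) * t))"
      by (simp add: distrib_left)
    also have "\<dots> = - (1 - cis (- (t * real k))) + (cis (- (real (Suc k) * t)) - cis (- (t * real k)))"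
      unfolding Suc *[symmetric] by (simp add: algebra_simps)
    finally show ?case by (simp add: mult.commute)
  qed simp
  from this[of "nat (- Y \<omega>)"] show ?thesis by (simp only: Vsum_def nat_Y)
qed

text \<open>A Wiener-Hopf factorisation: \<open>1 - cis t\<close> belongs to the upward ladder
  height, which is constantly 1, and \<open>1 - V t\<close> to the downward one. Equal means on both
  sides remove any further term.\<close>

lemma b_eq_V: "b t = of_real e * (1 - cis t) * (1 - V t)" if t: "t > 0"
proof -
  have "of_real e * (1 - cis t) * V t = (1 - cis t) * (\<integral>\<omega>. Vsum t \<omega> \<partial>M)"
    using e_pos by (simp add: V_def)
  also have "\<dots> = (\<integral>\<omega>. (1 - cis t) * Vsum t \<omega> \<partial>M)" by (rule integral_mult_right_zero[symmetric])
  also have "\<dots> = - (\<integral>\<omega>. 1 - cis (- (t * Ym \<omega>)) \<partial>M)" unfolding Vsum_telescope by (rule Bochner_Integration.integral_minus)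
  finally show ?thesis unfolding b_eq_expectation[OF t] by (simp add: algebra_simps)
qed

text \<open>Each of the \<open>Ym\<close> summands \<open>1 - cos (l * t)\<close> has
  \<open>l \<le> Ym\<close>, and \<open>v / (1 + v)\<close> increases, so all are bounded by the
  expression at \<open>t * Ym\<close>. The number of summands raises the square to a cube.\<close>

lemma Re_V_upper: "1 - Re (V t) \<le> 8 / e * t\<^sup>2 * N3 t" "0 \<le> 1 - Re (V t)" if t: "t > 0"
proof -
  show "0 \<le> 1 - Re (V t)" using norm_V[of t] complex_Re_le_cmod[of "V t"] by linarith
  have pt: "Ym \<omega> - Re (Vsum t \<omega>) \<le> 8 * t\<^sup>2 * ((Ym \<omega>)^3 / (1 + t * Ym \<omega>)\<^sup>2)" for \<omega>
  proof -
    let ?u = "t * Ym \<omega>"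
    have u: "?u \<ge> 0" using t Ym_nonneg[of \<omega>] by simp
    have "Ym \<omega> - Re (Vsum t \<omega>) = (\<Sum>l<nat (- Y \<omega>). 1 - cos (real (Suc l) * t))"
      unfolding Vsum_def by (simp add: sum_subtractf nat_Y)
    also have "\<dots> \<le> (\<Sum>l<nat (- Y \<omega>). 8 * (?u\<^sup>2 / (1 + ?u)\<^sup>2))"
    proof (rule sum_mono)
      fix l assume l: "l \<in> {..<nat (- Y \<omega>)}"
      let ?v = "real (Suc l) * t"
      have v: "0 \<le> ?v" "?v \<le> ?u" using t l nat_Y[of \<omega>] by (auto simp: mult.commute intro!: mult_left_mono)
      have "?v / (1 + ?v) \<le> ?u / (1 + ?u)" using v u by (simp add: field_simps)
      hence "(?v / (1 + ?v))\<^sup>2 \<le> (?u / (1 + ?u))\<^sup>2" using v by (intro power_mono) auto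
      hence "?v\<^sup>2 / (1 + ?v)\<^sup>2 \<le> ?u\<^sup>2 / (1 + ?u)\<^sup>2" by (simp only: power_divide)
      thus "1 - cos ?v \<le> 8 * (?u\<^sup>2 / (1 + ?u)\<^sup>2)" using one_minus_cos_upper[OF v(1)] by linarith
    qed
    also have "\<dots> = Ym \<omega> * (8 * (?u\<^sup>2 / (1 + ?u)\<^sup>2))" by (simp add: nat_Y)
    also have "\<dots> = 8 * t\<^sup>2 * ((Ym \<omega>)^3 / (1 + ?u)\<^sup>2)" by (simp add: power_mult_distrib power2_eq_square power3_eq_cube)
    finally show ?thesis .
  qed
  have "e * (1 - Re (V t)) = expectation Ym - Re (\<integral>\<omega>. Vsum t \<omega> \<partial>M)"
    using e_pos e_eq by (simp add: V_def algebra_simps)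
  also have "\<dots> = expectation Ym - expectation (\<lambda>\<omega>. Re (Vsum t \<omega>))" by (simp add: integral_Re[OF Vsum_integrable])
  also have "\<dots> = expectation (\<lambda>\<omega>. Ym \<omega> - Re (Vsum t \<omega>))"
    by (rule Bochner_Integration.integral_diff[OF Ym_int integrable_Re[OF Vsum_integrable], symmetric])
  also have "\<dots> \<le> expectation (\<lambda>\<omega>. 8 * t\<^sup>2 * ((Ym \<omega>)^3 / (1 + t * Ym \<omega>)\<^sup>2))"
    using pt by (intro integral_mono integrable_mult_right integrable_reg3[OF Ym_int Ym_nonneg t]
      Bochner_Integration.integrable_diff Ym_int integrable_Re Vsum_integrable)
  also have "\<dots> = 8 * t\<^sup>2 * N3m t" unfolding reg3_def by (rule integral_mult_right_zero)
  also have "\<dots> \<le> 8 * t\<^sup>2 * N3 t" using N3_split[OF t] N3p_nonneg[of t] by (intro mult_left_mono) auto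
  finally show "1 - Re (V t) \<le> 8 / e * t\<^sup>2 * N3 t" using e_pos by (simp add: field_simps)
qed

lemma one_minus_V_lower: "\<exists>c>0. \<forall>t. 0 < t \<longrightarrow> t \<le> pi \<longrightarrow> c * (t * N t) \<le> norm (1 - V t)"
proof -
  obtain c where c: "c > 0" "\<And>t. 0 < t \<Longrightarrow> t \<le> pi \<Longrightarrow> c * (t\<^sup>2 * N t) \<le> norm (b t)" using b_lower by auto
  show ?thesis
  proof (intro exI[of _ "c / e"] conjI allI impI)
    fix t :: real assume t: "0 < t" "t \<le> pi"
    have "(norm (1 - cis t))\<^sup>2 = 2 * (1 - cos t)"
      using sin_cos_squared_add[of t] unfolding cmod_power2 by (simp add: power2_eq_square algebra_simps)
    also have "\<dots> \<le> t\<^sup>2" using one_minus_cos_le[of t] by simp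
    finally have n: "norm (1 - cis t) \<le> t" by (rule power2_le_imp_le) (use t in simp)
    have "c * (t\<^sup>2 * N t) \<le> e * norm (1 - cis t) * norm (1 - V t)"
      using c(2)[OF t] e_pos unfolding b_eq_V[OF t(1)] norm_mult by simp
    also have "\<dots> \<le> e * t * norm (1 - V t)" using n e_pos by (intro mult_right_mono mult_left_mono) auto
    finally show "c / e * (t * N t) \<le> norm (1 - V t)" using e_pos t by (simp add: field_simps power2_eq_square)
  qed (use c e_pos in auto)
qed

text \<open>\<open>V t ^ n\<close> has no positive frequencies, so after the shift by
  \<open>cis (- (real (Suc j) * t))\<close> all frequencies are strictly negative. This is the
  Fourier form of skip-freeness.\<close>

lemma V_power_integral_0: "(\<integral>t. Re (cis (- (real (Suc j) * t)) * V t ^ n) \<partial>LL) = 0"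
proof (induction n arbitrary: j)
  case 0
  show ?case using LL_integral_cos[of "int (Suc j)"] by simp
next
  case (Suc n)
  \<comment> \<open>One factor \<open>Vsum\<close> adds the frequency \<open>Suc l\<close> to
    \<open>Suc j\<close>; the sum is \<open>Suc (Suc j + l)\<close>, the induction hypothesis at
    \<open>Suc j + l\<close>.\<close>
  let ?g = "\<lambda>l t. Re (cis (- (real (Suc (Suc j + l)) * t)) * V t ^ n)"
  let ?f = "\<lambda>\<omega> t. (\<Sum>l<nat (- Y \<omega>). ?g l t)"
  have g1: "\<bar>?g l t\<bar> \<le> 1" for l t
  proof -
    have "norm (cis (- (real (Suc (Suc j + l)) * t)) * V t ^ n) \<le> 1" using norm_V[of t] by (simp add: norm_mult norm_power power_le_one)
    thus ?thesis using abs_Re_le_cmod[of "cis (- (real (Suc (Suc j + l)) * t)) * V t ^ n"] by linarith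
  qed
  have gi: "integrable LL (?g l)" for l
    by (rule integrable_LL_bounded[where B=1]) (use g1 in auto)
  have fb: "\<bar>?f \<omega> t\<bar> \<le> Ym \<omega>" for \<omega> t
  proof -
    have "\<bar>?f \<omega> t\<bar> \<le> (\<Sum>l<nat (- Y \<omega>). \<bar>?g l t\<bar>)" by (rule sum_abs)
    also have "\<dots> \<le> (\<Sum>l<nat (- Y \<omega>). 1)" by (intro sum_mono g1)
    finally show ?thesis by (simp add: nat_Y)
  qed
  have fm: "case_prod ?f \<in> borel_measurable (M \<Otimes>\<^sub>M LL)"
  proof (rule measurable_prod_LL)
    have "(\<lambda>x. \<Sum>l<nat (- Y (fst x)). ?g l (snd x)) \<in> borel_measurable (M \<Otimes>\<^sub>M borel)"
      by (rule measurable_sum_nat_Y) measurable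
    thus "case_prod ?f \<in> borel_measurable (M \<Otimes>\<^sub>M borel)" by (simp add: case_prod_beta')
  qed
  have fi: "integrable (M \<Otimes>\<^sub>M LL) (case_prod ?f)"
  proof (rule pair_LL.Fubini_integrable[OF fm])
    show "AE \<omega> in M. integrable LL (\<lambda>t. case_prod ?f (\<omega>, t))"
      unfolding prod.case by (intro AE_I2 Bochner_Integration.integrable_sum gi)
    show "integrable M (\<lambda>\<omega>. \<integral>t. norm (case_prod ?f (\<omega>, t)) \<partial>LL)"
    proof (rule Bochner_Integration.integrable_bound[where f="\<lambda>\<omega>. measure LL (space LL) * Ym \<omega>"])
      show "integrable M (\<lambda>\<omega>. measure LL (space LL) * Ym \<omega>)" using Ym_int by simp
      show "(\<lambda>\<omega>. \<integral>t. norm (case_prod ?f (\<omega>, t)) \<partial>LL) \<in> borel_measurable M"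
        using fm by (intro LL.borel_measurable_lebesgue_integral) (auto simp: case_prod_beta')
      show "AE \<omega> in M. norm (\<integral>t. norm (case_prod ?f (\<omega>, t)) \<partial>LL) \<le> norm (measure LL (space LL) * Ym \<omega>)"
      proof (rule AE_I2)
        fix \<omega>
        have "(\<integral>t. norm (?f \<omega> t) \<partial>LL) \<le> (\<integral>t. Ym \<omega> \<partial>LL)"
          using fb by (intro integral_mono integrable_norm Bochner_Integration.integrable_sum gi) auto
        moreover have "0 \<le> (\<integral>t. norm (?f \<omega> t) \<partial>LL)" by (rule integral_nonneg_AE) simp
        ultimately show "norm (\<integral>t. norm (case_prod ?f (\<omega>, t)) \<partial>LL) \<le> norm (measure LL (space LL) * Ym \<omega>)"
          using Ym_nonneg[of \<omega>] by (simp add: mult.commute)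
      qed
    qed
  qed
  have "(\<integral>t. Re (cis (- (real (Suc j) * t)) * V t ^ Suc n) \<partial>LL) = (\<integral>t. (1 / e) * (\<integral>\<omega>. ?f \<omega> t \<partial>M) \<partial>LL)"
  proof (rule Bochner_Integration.integral_cong[OF refl])
    fix t
    have "(\<integral>\<omega>. ?f \<omega> t \<partial>M) = (\<integral>\<omega>. Re ((cis (- (real (Suc j) * t)) * V t ^ n) * Vsum t \<omega>) \<partial>M)"
    proof (rule Bochner_Integration.integral_cong[OF refl])
      fix \<omega>
      have "cis (- (real (Suc (Suc j + l)) * t)) = cis (- (real (Suc j) * t)) * cis (- (real (Suc l) * t))" for l
        unfolding cis_mult by (rule arg_cong[where f=cis]) (simp add: algebra_simps)
      thus "?f \<omega> t = Re ((cis (- (real (Suc j) * t)) * V t ^ n) * Vsum t \<omega>)"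
        unfolding Vsum_def sum_distrib_left Re_sum by (intro sum.cong refl) (simp only: mult_ac)
    qed
    also have "\<dots> = Re (\<integral>\<omega>. (cis (- (real (Suc j) * t)) * V t ^ n) * Vsum t \<omega> \<partial>M)"
      by (intro integral_Re integrable_mult_right Vsum_integrable)
    also have "(\<integral>\<omega>. (cis (- (real (Suc j) * t)) * V t ^ n) * Vsum t \<omega> \<partial>M) = (cis (- (real (Suc j) * t)) * V t ^ n) * (of_real e * V t)"
      using e_pos by (subst integral_mult_right_zero) (simp add: V_def)
    also have "Re \<dots> = e * Re (cis (- (real (Suc j) * t)) * V t ^ Suc n)"
    proof -
      have "(cis (- (real (Suc j) * t)) * V t ^ n) * (of_real e * V t) = of_real e * (cis (- (real (Suc j) * t)) * V t ^ Suc n)"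
        by (simp only: power_Suc mult_ac)
      thus ?thesis by (simp only: Re_of_real_mult)
    qed
    finally show "Re (cis (- (real (Suc j) * t)) * V t ^ Suc n) = (1 / e) * (\<integral>\<omega>. ?f \<omega> t \<partial>M)" using e_pos by simp
  qed
  also have "\<dots> = (1 / e) * (\<integral>t. (\<integral>\<omega>. ?f \<omega> t \<partial>M) \<partial>LL)" by (rule integral_mult_right_zero)
  also have "(\<integral>t. (\<integral>\<omega>. ?f \<omega> t \<partial>M) \<partial>LL) = (\<integral>\<omega>. (\<integral>t. ?f \<omega> t \<partial>LL) \<partial>M)"
    by (rule pair_LL.Fubini_integral[OF fi])
  also have "\<dots> = (\<integral>\<omega>. (\<Sum>l<nat (- Y \<omega>). (\<integral>t. ?g l t \<partial>LL)) \<partial>M)"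
    by (intro Bochner_Integration.integral_cong refl Bochner_Integration.integral_sum gi)
  also have "\<dots> = 0" unfolding Suc by simp
  finally show ?case by simp
qed

text \<open>The damping makes the Neumann series in \<open>of_real r * V t\<close> converge
  uniformly; each term has zero integral, and the remainder is at most
  \<open>r ^ K / (1 - r)\<close>.\<close>

lemma damped_integral_0:
  assumes r: "0 < r" "r < 1"
  shows "(\<integral>t. Re (cis (- (real (Suc j) * t)) / (1 - of_real r * V t)) \<partial>LL) = 0"
proof -
  let ?c = "\<lambda>t. cis (- (real (Suc j) * t))"
  have nrV: "norm (of_real r * V t) \<le> r" for t using norm_V[of t] r by (simp add: norm_mult mult_left_le)
  have den: "1 - r \<le> norm (1 - of_real r * V t)" for t
    using norm_triangle_ineq2[of 1 "of_real r * V t"] nrV[of t] by simp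
  have ne: "1 - of_real r * V t \<noteq> 0" for t using den[of t] r by auto
  have i1: "integrable LL (\<lambda>t. Re (?c t * V t ^ n))" for n
  proof (rule integrable_LL_bounded[where B=1])
    fix t :: real
    have "norm (?c t * V t ^ n) \<le> 1" using norm_V[of t] by (simp add: norm_mult norm_power power_le_one)
    thus "norm (Re (?c t * V t ^ n)) \<le> 1" using abs_Re_le_cmod[of "?c t * V t ^ n"] by simp
  qed measurable
  let ?rem = "\<lambda>K t. Re (?c t * (of_real r * V t) ^ K / (1 - of_real r * V t))"
  have rem: "\<bar>?rem K t\<bar> \<le> r ^ K / (1 - r)" for K t
  proof -
    have "norm (?c t * (of_real r * V t) ^ K / (1 - of_real r * V t)) \<le> r ^ K / (1 - r)"
      unfolding norm_divide norm_mult[of "?c t"] norm_power norm_cis mult_1_left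
      using nrV[of t] den[of t] r by (intro frac_le power_mono) auto
    thus ?thesis using abs_Re_le_cmod[of "?c t * (of_real r * V t) ^ K / (1 - of_real r * V t)"] by linarith
  qed
  have irem: "integrable LL (?rem K)" for K
    by (rule integrable_LL_bounded[where B="r ^ K / (1 - r)"]) (use rem in auto)
  have "\<bar>\<integral>t. Re (?c t / (1 - of_real r * V t)) \<partial>LL\<bar> \<le> measure LL (space LL) * (r ^ K / (1 - r))" for K
  proof -
    have "(\<integral>t. Re (?c t / (1 - of_real r * V t)) \<partial>LL) = (\<integral>t. (\<Sum>n<K. r ^ n * Re (?c t * V t ^ n)) + ?rem K t \<partial>LL)"
    proof (rule Bochner_Integration.integral_cong[OF refl])
      fix t
      define q where "q = of_real r * V t"
      have q: "1 - q \<noteq> 0" using ne[of t] by (simp add: q_def)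
      hence "1 / (1 - q) = (\<Sum>n<K. q ^ n) + q ^ K / (1 - q)"
        using sum_gp_strict[of q K] by (simp add: add_divide_distrib[symmetric])
      hence "?c t / (1 - q) = ?c t * (\<Sum>n<K. q ^ n) + ?c t * q ^ K / (1 - q)"
        by (metis (no_types, opaque_lifting) distrib_left mult.right_neutral times_divide_eq_right)
      also have "?c t * (\<Sum>n<K. q ^ n) = (\<Sum>n<K. of_real (r ^ n) * (?c t * V t ^ n))"
        unfolding sum_distrib_left by (intro sum.cong refl) (simp add: q_def power_mult_distrib mult_ac)
      finally show "Re (?c t / (1 - of_real r * V t)) = (\<Sum>n<K. r ^ n * Re (?c t * V t ^ n)) + ?rem K t"
        unfolding q_def by (simp only: plus_complex.sel Re_sum Re_of_real_mult)
    qed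
    also have "\<dots> = (\<integral>t. (\<Sum>n<K. r ^ n * Re (?c t * V t ^ n)) \<partial>LL) + (\<integral>t. ?rem K t \<partial>LL)"
      by (intro Bochner_Integration.integral_add Bochner_Integration.integrable_sum integrable_mult_right i1 irem)
    also have "(\<integral>t. (\<Sum>n<K. r ^ n * Re (?c t * V t ^ n)) \<partial>LL) = (\<Sum>n<K. \<integral>t. r ^ n * Re (?c t * V t ^ n) \<partial>LL)"
      by (intro Bochner_Integration.integral_sum integrable_mult_right i1)
    also have "\<dots> = 0" unfolding integral_mult_right_zero V_power_integral_0 by simp
    finally have "\<bar>\<integral>t. Re (?c t / (1 - of_real r * V t)) \<partial>LL\<bar> = \<bar>\<integral>t. ?rem K t \<partial>LL\<bar>" by simp
    also have "\<dots> \<le> (\<integral>t. r ^ K / (1 - r) \<partial>LL)"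
      using Bochner_Integration.integral_norm_bound_integral[OF irem[of K], of "\<lambda>_. r ^ K / (1 - r)"] rem by simp
    finally show ?thesis by simp
  qed
  moreover have "(\<lambda>K. measure LL (space LL) * (r ^ K / (1 - r))) \<longlonglongrightarrow> measure LL (space LL) * (0 / (1 - r))"
    using r by (intro tendsto_intros LIMSEQ_realpow_zero) auto
  ultimately have "\<bar>\<integral>t. Re (?c t / (1 - of_real r * V t)) \<partial>LL\<bar> \<le> measure LL (space LL) * (0 / (1 - r))"
    by (intro LIMSEQ_le_const) auto
  thus ?thesis by simp
qed

text \<open>The part of \<open>1 / (1 - r V)\<close> that concentrates at \<open>t = 0\<close> as \<open>r\<close> tends to \<open>1\<close>; it has no mass in
  the limit because \<open>N\<close> is unbounded.\<close>
lemma concentrating_part_tendsto_0: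
  assumes r: "\<And>i. 1/2 \<le> r i" "\<And>i. r i < 1" "r \<longlonglongrightarrow> 1"
  shows "(\<lambda>i. \<integral>t. (1 - r i) * cos (x * t) / (norm (1 - of_real (r i) * V t))\<^sup>2 \<partial>LL) \<longlonglongrightarrow> 0"
proof (rule LIMSEQ_I)
  fix \<epsilon> :: real assume \<epsilon>: "\<epsilon> > 0"
  obtain c where c: "c > 0" "\<And>t. 0 < t \<Longrightarrow> t \<le> pi \<Longrightarrow> c * (t * N t) \<le> norm (1 - V t)" using one_minus_V_lower by auto
  \<comment> \<open>With \<open>N t \<ge> B\<close> near 0 the integrand lies below
    \<open>s / (s\<^sup>2 + (y * t)\<^sup>2)\<close>, where \<open>s = 1 - r i\<close>. Its integral
    is at most \<open>pi / (2 * y)\<close>, and \<open>B\<close> makes this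
    \<open>\<epsilon> / 2\<close>.\<close>
  define B where "B = 2 * pi / (c * \<epsilon>)"
  have B: "B > 0" using c \<epsilon> by (simp add: B_def)
  define y where "y = c * B / 2"
  have y: "y > 0" "pi / 2 / y \<le> \<epsilon> / 2" using B c \<epsilon> by (auto simp: y_def B_def field_simps)
  have "\<forall>\<^sub>F t in at_right 0. N t \<ge> B" using N_at_top by (simp add: filterlim_at_top)
  then obtain \<delta> where \<delta>: "\<delta> > 0" "\<And>t. 0 < t \<Longrightarrow> t < \<delta> \<Longrightarrow> N t \<ge> B"
    unfolding eventually_at_right_field by auto
  have Npi: "N pi > 0" using N_pos[of pi] by simp
  define K where "K = 1 / (c / 2 * (\<delta> * N pi))\<^sup>2"
  have K: "K > 0" using c \<delta> Npi by (simp add: K_def)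
  have den: "(1 - r i)\<^sup>2 + (c / 2 * (t * N t))\<^sup>2 \<le> (norm (1 - of_real (r i) * V t))\<^sup>2" if t: "0 < t" "t \<le> pi" for i t
  proof -
    define \<omega> where "\<omega> = 1 - V t"
    have R0: "0 \<le> Re \<omega>" using Re_V_upper(2)[OF t(1)] by (simp add: \<omega>_def)
    have ri: "0 \<le> r i" "0 \<le> 1 - r i" using r(1)[of i] r(2)[of i] by auto
    have eq: "1 - of_real (r i) * V t = of_real (1 - r i) + of_real (r i) * \<omega>" by (simp add: \<omega>_def algebra_simps)
    have "(norm (of_real (1 - r i) + of_real (r i) * \<omega>))\<^sup>2 = ((1 - r i) + r i * Re \<omega>)\<^sup>2 + (r i * Im \<omega>)\<^sup>2"
      unfolding cmod_power2 by simp
    also have "\<dots> = (1 - r i)\<^sup>2 + 2 * ((1 - r i) * (r i * Re \<omega>)) + ((r i * Re \<omega>)\<^sup>2 + (r i * Im \<omega>)\<^sup>2)"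
      by (simp add: power2_sum)
    also have "(r i * Re \<omega>)\<^sup>2 + (r i * Im \<omega>)\<^sup>2 = (r i * norm \<omega>)\<^sup>2" by (simp add: power_mult_distrib cmod_power2 distrib_left)
    finally have "(norm (1 - of_real (r i) * V t))\<^sup>2 \<ge> (1 - r i)\<^sup>2 + (r i * norm \<omega>)\<^sup>2"
      unfolding eq using mult_nonneg_nonneg[OF ri(2) mult_nonneg_nonneg[OF ri(1) R0]] by linarith
    moreover have "(c / 2 * (t * N t))\<^sup>2 \<le> (r i * norm \<omega>)\<^sup>2"
    proof (rule power_mono)
      have "1/2 * (c * (t * N t)) \<le> r i * norm \<omega>" using c(2)[OF t] r(1)[of i] c(1) N_nonneg[of t] t
        unfolding \<omega>_def by (intro mult_mono) auto
      thus "c / 2 * (t * N t) \<le> r i * norm \<omega>" by simp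
      show "0 \<le> c / 2 * (t * N t)" using c(1) N_nonneg[of t] t by simp
    qed
    ultimately show ?thesis by linarith
  qed
  have bound: "\<bar>\<integral>t. (1 - r i) * cos (x * t) / (norm (1 - of_real (r i) * V t))\<^sup>2 \<partial>LL\<bar> \<le> \<epsilon> / 2 + (1 - r i) * K * pi" for i
  proof -
    define s where "s = 1 - r i"
    have s: "s > 0" using r(2)[of i] by (simp add: s_def)
    let ?f = "\<lambda>t. s * cos (x * t) / (norm (1 - of_real (r i) * V t))\<^sup>2"
    let ?F = "\<lambda>t. arctan (y * t / s) / y + s * K * t"
    have D: "s\<^sup>2 \<le> (norm (1 - of_real (r i) * V t))\<^sup>2" if "0 < t" "t \<le> pi" for t
      using den[OF that, of i] zero_le_power2[of "c / 2 * (t * N t)"] unfolding s_def by linarith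
    have cosb: "\<bar>?f t\<bar> \<le> s / (norm (1 - of_real (r i) * V t))\<^sup>2" for t
    proof -
      have "\<bar>s * cos (x * t)\<bar> \<le> s" using s abs_cos_le_one[of "x * t"] by (simp add: abs_mult mult_left_le)
      thus ?thesis by (simp add: abs_divide divide_right_mono)
    qed
    have fi: "integrable LL ?f"
    proof (rule integrable_LL_bounded[where B="s / s\<^sup>2"])
      fix t :: real assume t: "0 < t" "t < pi"
      have "s / (norm (1 - of_real (r i) * V t))\<^sup>2 \<le> s / s\<^sup>2" using D[of t] s t by (intro frac_le) auto
      thus "norm (?f t) \<le> s / s\<^sup>2" using cosb[of t] by simp
    qed measurable
    have "\<bar>integral {0..pi} ?f\<bar> \<le> ?F pi - ?F 0"
    proof (rule FTC_bound[where F'="\<lambda>t. s / (s\<^sup>2 + (y * t)\<^sup>2) + s * K"])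
      show "?f integrable_on {0..pi}" by (rule LL_HK(1)[OF fi])
      show "continuous_on {0..pi} ?F" using s y by (intro continuous_intros) auto
      fix t :: real assume t: "0 < t" "t < pi"
      have "s\<^sup>2 + (y * t)\<^sup>2 > 0" using s by (simp add: add_pos_nonneg)
      thus "(?F has_real_derivative s / (s\<^sup>2 + (y * t)\<^sup>2) + s * K) (at t)"
        using s y by (auto intro!: derivative_eq_intros simp: divide_simps power2_eq_square)
          (simp add: algebra_simps)
      have "s / (norm (1 - of_real (r i) * V t))\<^sup>2 \<le> s / (s\<^sup>2 + (y * t)\<^sup>2) + s * K"
      proof (cases "t < \<delta>")
        case True
        have "y * t \<le> c / 2 * (t * N t)" using \<delta>(2)[OF t(1) True] c t by (simp add: y_def mult_left_mono)
        hence "(y * t)\<^sup>2 \<le> (c / 2 * (t * N t))\<^sup>2" using y t by (intro power_mono) auto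
        hence "s\<^sup>2 + (y * t)\<^sup>2 \<le> (norm (1 - of_real (r i) * V t))\<^sup>2" using den[of t i] t unfolding s_def by linarith
        hence "s / (norm (1 - of_real (r i) * V t))\<^sup>2 \<le> s / (s\<^sup>2 + (y * t)\<^sup>2)"
          using s by (intro frac_le add_pos_nonneg) auto
        thus ?thesis using s K mult_pos_pos[of s K] by linarith
      next
        case False
        have "\<delta> * N pi \<le> t * N t" using False \<delta> N_ge[of t] Npi t by (intro mult_mono) auto
        hence "(c / 2 * (\<delta> * N pi))\<^sup>2 \<le> (c / 2 * (t * N t))\<^sup>2" using c \<delta> Npi by (intro power_mono mult_left_mono) auto
        hence "(c / 2 * (\<delta> * N pi))\<^sup>2 \<le> (norm (1 - of_real (r i) * V t))\<^sup>2"
          using den[of t i] t zero_le_power2[of "1 - r i"] by linarith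
        hence "s / (norm (1 - of_real (r i) * V t))\<^sup>2 \<le> s / (c / 2 * (\<delta> * N pi))\<^sup>2"
          using s c \<delta> Npi by (intro frac_le) auto
        also have "\<dots> = s * K" by (simp add: K_def)
        finally have "s / (norm (1 - of_real (r i) * V t))\<^sup>2 \<le> s * K" .
        moreover have "0 \<le> s / (s\<^sup>2 + (y * t)\<^sup>2)" using s by simp
        ultimately show ?thesis by linarith
      qed
      thus "\<bar>?f t\<bar> \<le> s / (s\<^sup>2 + (y * t)\<^sup>2) + s * K" using cosb[of t] by linarith
    qed simp
    also have "?F pi - ?F 0 \<le> \<epsilon> / 2 + s * K * pi"
    proof -
      have "arctan (y * pi / s) / y \<le> (pi / 2) / y" using arctan_ubound[of "y * pi / s"] y(1) by (intro divide_right_mono) auto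
      from order_trans[OF this y(2)] show ?thesis by simp
    qed
    finally show ?thesis unfolding LL_HK(2)[OF fi, symmetric] by (simp add: s_def)
  qed
  have "(\<lambda>i. (1 - r i) * K * pi) \<longlonglongrightarrow> (1 - 1) * K * pi" by (intro tendsto_intros r)
  hence "(\<lambda>i. (1 - r i) * K * pi) \<longlonglongrightarrow> 0" by simp
  hence "\<forall>\<^sub>F i in sequentially. (1 - r i) * K * pi < \<epsilon> / 2" by (rule order_tendstoD) (use \<epsilon> in simp)
  then obtain i0 where i0: "\<And>i. i \<ge> i0 \<Longrightarrow> (1 - r i) * K * pi < \<epsilon> / 2" by (auto simp: eventually_sequentially)
  show "\<exists>i0. \<forall>i\<ge>i0. norm ((\<integral>t. (1 - r i) * cos (x * t) / (norm (1 - of_real (r i) * V t))\<^sup>2 \<partial>LL) - 0) < \<epsilon>"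
  proof (intro exI[of _ i0] allI impI)
    fix i assume "i0 \<le> i"
    thus "norm ((\<integral>t. (1 - r i) * cos (x * t) / (norm (1 - of_real (r i) * V t))\<^sup>2 \<partial>LL) - 0) < \<epsilon>"
      using i0[of i] bound[of i] by simp
  qed
qed

text \<open>Limit of the damped identity. The conjugate denominator splits as
  \<open>(1 - r) + r * cnj (1 - V t)\<close>: the first part gives \<open>T1\<close>, which has no
  mass in the limit, the second \<open>T2\<close>, dominated uniformly in \<open>r\<close> by a
  multiple of \<open>1 + N3 / N\<^sup>2\<close>.\<close>

lemma undamped_integral_0:
  shows "integrable LL (\<lambda>t. Re (cis (- (real (Suc j) * t)) / (1 - V t)))"
    and "(\<integral>t. Re (cis (- (real (Suc j) * t)) / (1 - V t)) \<partial>LL) = 0"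
proof -
  define x where "x = real (Suc j)"
  have x0: "x > 0" by (simp add: x_def)
  define r :: "nat \<Rightarrow> real" where "r i = 1 - 1 / real (i + 2)" for i
  have r: "1/2 \<le> r i" "r i < 1" "0 < r i" for i by (auto simp: r_def field_simps)
  have rlim: "r \<longlonglongrightarrow> 1"
  proof -
    have "(\<lambda>i. 1 / real (i + 2)) \<longlonglongrightarrow> 0" using LIMSEQ_ignore_initial_segment[OF lim_1_over_n, of 2] by simp
    hence "r \<longlonglongrightarrow> 1 - 0" unfolding r_def by (intro tendsto_intros)
    thus ?thesis by simp
  qed
  obtain c where c: "c > 0" "\<And>t. 0 < t \<Longrightarrow> t \<le> pi \<Longrightarrow> c * (t * N t) \<le> norm (1 - V t)" using one_minus_V_lower by auto
  define D where "D i t = (norm (1 - of_real (r i) * V t))\<^sup>2" for i t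
  define T1 where "T1 i t = (1 - r i) * cos (x * t) / D i t" for i t
  define T2 where "T2 i t = r i * (cos (x * t) * Re (1 - V t) - sin (x * t) * Im (1 - V t)) / D i t" for i t
  define T where "T t = (cos (x * t) * Re (1 - V t) - sin (x * t) * Im (1 - V t)) / (norm (1 - V t))\<^sup>2" for t
  have T_eq: "Re (cis (- (x * t)) / (1 - V t)) = T t" for t
    unfolding Re_divide_cnj T_def by simp
  have split: "Re (cis (- (x * t)) / (1 - of_real (r i) * V t)) = T1 i t + T2 i t" for i t
  proof -
    have "Re (cis (- (x * t)) * cnj (1 - of_real (r i) * V t)) = (1 - r i) * cos (x * t) + r i * (cos (x * t) * Re (1 - V t) - sin (x * t) * Im (1 - V t))"
      by (simp add: algebra_simps)
    thus ?thesis unfolding Re_divide_cnj T1_def T2_def D_def by (simp only: add_divide_distrib)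
  qed
  have den: "(r i * norm (1 - V t))\<^sup>2 \<le> D i t" if t: "0 < t" for i t
  proof -
    have R0: "0 \<le> Re (1 - V t)" using Re_V_upper(2)[OF t] by simp
    have "(r i * norm (1 - V t))\<^sup>2 = (r i * Re (1 - V t))\<^sup>2 + (r i * Im (1 - V t))\<^sup>2"
      by (simp only: power_mult_distrib cmod_power2 distrib_left)
    also have "(r i * Re (1 - V t))\<^sup>2 \<le> (Re (1 - of_real (r i) * V t))\<^sup>2"
      using R0 r[of i] by (intro power_mono) (auto simp: algebra_simps)
    also have "r i * Im (1 - V t) = Im (1 - of_real (r i) * V t)" by simp
    finally show ?thesis unfolding D_def cmod_power2[of "1 - of_real (r i) * V t"] by simp
  qed
  define K where "K = 2 * (8 / (e * c\<^sup>2) + x / (c * N pi))"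
  have Npi: "N pi > 0" using N_pos[of pi] by simp
  have bound: "\<bar>T2 i t\<bar> \<le> K * (1 + N3 t / (N t)\<^sup>2)" if t: "0 < t" "t < pi" for i t
  proof -
    define n where "n = norm (1 - V t)"
    have Nt: "N t > 0" "N pi \<le> N t" using N_pos[of t] N_ge[of t] t by auto
    have n: "c * (t * N t) \<le> n" "0 < n"
      using c(2)[of t] t Nt mult_pos_pos[OF c(1) mult_pos_pos[OF t(1) Nt(1)]] unfolding n_def by linarith+
    have R: "0 \<le> Re (1 - V t)" "Re (1 - V t) \<le> 8 / e * t\<^sup>2 * N3 t" using Re_V_upper[OF t(1)] by auto
    have "\<bar>cos (x * t) * Re (1 - V t)\<bar> \<le> Re (1 - V t)"
      unfolding abs_mult using R(1) by (simp add: mult_left_le_one_le)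
    moreover have "\<bar>sin (x * t) * Im (1 - V t)\<bar> \<le> (x * t) * n"
      unfolding abs_mult n_def using abs_sin_x_le_abs_x[of "x * t"] abs_Im_le_cmod[of "1 - V t"] x0 t by (intro mult_mono) auto
    ultimately have "\<bar>cos (x * t) * Re (1 - V t) - sin (x * t) * Im (1 - V t)\<bar> \<le> Re (1 - V t) + x * t * n" by linarith
    hence "\<bar>T2 i t\<bar> \<le> r i * (Re (1 - V t) + x * t * n) / (r i * n)\<^sup>2"
      unfolding T2_def abs_divide abs_mult[of "r i"]
      using den[OF t(1), of i] r[of i] n R(1) x0 t by (intro frac_le mult_mono) (auto simp: n_def)
    also have "\<dots> = (1 / r i) * ((Re (1 - V t) + x * t * n) / n\<^sup>2)"
      using r[of i] n by (simp add: power_mult_distrib power2_eq_square)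
    also have "\<dots> \<le> 2 * ((Re (1 - V t) + x * t * n) / n\<^sup>2)"
      using r[of i] R x0 t n by (intro mult_right_mono divide_nonneg_nonneg add_nonneg_nonneg mult_nonneg_nonneg) (auto simp: field_simps)
    also have "(Re (1 - V t) + x * t * n) / n\<^sup>2 = Re (1 - V t) / n\<^sup>2 + x * t / n"
      using n by (simp add: add_divide_distrib power2_eq_square)
    also have "Re (1 - V t) / n\<^sup>2 \<le> (8 / e * t\<^sup>2 * N3 t) / (c * (t * N t))\<^sup>2"
      using R n c Nt t N3_nonneg[of t] e_pos by (intro frac_le power_mono) auto
    also have "(8 / e * t\<^sup>2 * N3 t) / (c * (t * N t))\<^sup>2 = 8 / (e * c\<^sup>2) * (N3 t / (N t)\<^sup>2)"
      using t by (simp add: power_mult_distrib)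
    also have "x * t / n \<le> x * t / (c * (t * N t))" using n c Nt t x0 by (intro divide_left_mono) auto
    also have "\<dots> = x / (c * N t)" using t by simp
    also have "\<dots> \<le> x / (c * N pi)" using c Nt Npi x0 by (intro divide_left_mono mult_left_mono) auto
    finally have *: "\<bar>T2 i t\<bar> \<le> 2 * (8 / (e * c\<^sup>2) * (N3 t / (N t)\<^sup>2) + x / (c * N pi))" by simp
    have "p * d + q \<le> (p + q) * (1 + d)" if "0 \<le> p" "0 \<le> q" "0 \<le> d" for p q d :: real
      using mult_nonneg_nonneg[OF that(2,3)] that by (simp add: algebra_simps)
    note gen = this
    have "8 / (e * c\<^sup>2) * (N3 t / (N t)\<^sup>2) + x / (c * N pi) \<le> (8 / (e * c\<^sup>2) + x / (c * N pi)) * (1 + N3 t / (N t)\<^sup>2)"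
      by (rule gen) (use e_pos c x0 Npi N3_nonneg[of t] in auto)
    hence "2 * (8 / (e * c\<^sup>2) * (N3 t / (N t)\<^sup>2) + x / (c * N pi)) \<le> 2 * ((8 / (e * c\<^sup>2) + x / (c * N pi)) * (1 + N3 t / (N t)\<^sup>2))"
      by (rule mult_left_mono) simp
    from order_trans[OF * this] show ?thesis by (simp only: K_def mult.assoc)
  qed
  have m1: "T1 i \<in> borel_measurable borel" for i unfolding T1_def[abs_def] D_def by measurable
  have m2: "T2 i \<in> borel_measurable borel" for i unfolding T2_def[abs_def] D_def by measurable
  have m: "T \<in> borel_measurable borel" unfolding T_def[abs_def] by measurable
  have lim: "(\<lambda>i. T2 i t) \<longlonglongrightarrow> T t" if t: "0 < t" "t < pi" for t
  proof -
    have "norm (1 - V t) > 0"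
      using c(2)[of t] t mult_pos_pos[OF c(1) mult_pos_pos[OF t(1) N_pos[of t]]] by linarith
    hence "(\<lambda>i. T2 i t) \<longlonglongrightarrow> 1 * (cos (x * t) * Re (1 - V t) - sin (x * t) * Im (1 - V t)) / (norm (1 - of_real 1 * V t))\<^sup>2"
      unfolding T2_def D_def by (intro tendsto_intros rlim) auto
    thus ?thesis by (simp add: T_def)
  qed
  have args: "T \<in> borel_measurable LL" "\<And>i. T2 i \<in> borel_measurable LL" "integrable LL (\<lambda>t. K * (1 + N3 t / (N t)\<^sup>2))"
    "AE t in LL. (\<lambda>i. T2 i t) \<longlonglongrightarrow> T t" "\<And>i. AE t in LL. norm (T2 i t) \<le> K * (1 + N3 t / (N t)\<^sup>2)"
    subgoal by (rule LL_meas[OF m])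
    subgoal by (rule LL_meas[OF m2])
    subgoal by (rule dom_integrable')
    subgoal by (rule AE_I2) (use lim in \<open>simp add: space_LL\<close>)
    subgoal by (rule AE_I2) (use bound in \<open>simp add: space_LL\<close>)
    done
  have iT: "integrable LL T" by (rule integrable_dominated_convergence[OF args])
  have lT: "(\<lambda>i. \<integral>t. T2 i t \<partial>LL) \<longlonglongrightarrow> (\<integral>t. T t \<partial>LL)" by (rule integral_dominated_convergence[OF args])
  have iT2: "integrable LL (T2 i)" for i by (rule integrable_dominated_convergence2[OF args])
  have iT1: "integrable LL (T1 i)" for i
  proof (rule integrable_LL_bounded[OF m1, where B="1 / (1 - r i)\<^sup>2"])
    fix t :: real
    have "1 - r i \<le> norm (1 - of_real (r i) * V t)"
    proof -
      have "norm (of_real (r i) * V t) \<le> r i"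
        unfolding norm_mult using norm_V[of t] r[of i] by (simp add: mult_left_le)
      moreover have "1 - norm (of_real (r i) * V t) \<le> norm (1 - of_real (r i) * V t)"
        using norm_triangle_ineq2[of 1 "of_real (r i) * V t"] by simp
      ultimately show ?thesis by linarith
    qed
    hence "(1 - r i)\<^sup>2 \<le> D i t" unfolding D_def using r[of i] by (intro power_mono) auto
    moreover have "\<bar>(1 - r i) * cos (x * t)\<bar> \<le> 1"
      unfolding abs_mult using r[of i] by (intro mult_le_one) auto
    ultimately show "norm (T1 i t) \<le> 1 / (1 - r i)\<^sup>2"
      unfolding T1_def real_norm_def abs_divide using r[of i] by (intro frac_le) auto
  qed
  have "(\<integral>t. T1 i t \<partial>LL) + (\<integral>t. T2 i t \<partial>LL) = 0" for i
    using damped_integral_0[OF r(3) r(2), of j i] Bochner_Integration.integral_add[OF iT1 iT2, of i i] unfolding x_def[symmetric] split by simp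
  hence "(\<integral>t. T1 i t \<partial>LL) = - (\<integral>t. T2 i t \<partial>LL)" for i by (simp add: eq_neg_iff_add_eq_0)
  moreover have "(\<lambda>i. \<integral>t. T1 i t \<partial>LL) \<longlonglongrightarrow> 0"
    unfolding T1_def D_def by (rule concentrating_part_tendsto_0[OF r(1) r(2) rlim])
  ultimately have "(\<lambda>i. - (\<integral>t. T2 i t \<partial>LL)) \<longlonglongrightarrow> 0" by simp
  from tendsto_minus[OF this] have "(\<lambda>i. \<integral>t. T2 i t \<partial>LL) \<longlonglongrightarrow> 0" by simp
  hence "(\<integral>t. T t \<partial>LL) = 0" using lT LIMSEQ_unique by blast
  thus "(\<integral>t. Re (cis (- (real (Suc j) * t)) / (1 - V t)) \<partial>LL) = 0" "integrable LL (\<lambda>t. Re (cis (- (real (Suc j) * t)) / (1 - V t)))"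
    using iT unfolding x_def[symmetric] T_eq by auto
qed

text \<open>The potential function of the comparison walk vanishes on the negative side. Dividing by
  the ladder factor, \<open>(1 - cis (- (x * t))) / (1 - cis t)\<close> is minus a finite sum of
  negative frequencies, to each of which \<open>undamped_integral_0\<close> applies.\<close>

lemma b_kernel_integral_0:
  shows "integrable LL (\<lambda>t. Re ((1 - cis (- (real x * t))) / b t))"
    and "(\<integral>t. Re ((1 - cis (- (real x * t))) / b t) \<partial>LL) = 0"
proof -
  have eq: "Re ((1 - cis (- (real x * t))) / b t) = (\<Sum>j<x. (- 1 / e) * Re (cis (- (real (Suc j) * t)) / (1 - V t)))"
    if t: "t \<in> space LL" for t
  proof -
    have t: "0 < t" "t < pi" using that by (auto simp: space_LL)
    have geo: "(1 - cis t) * (\<Sum>j<x. cis (- (real (Suc j) * t))) = - (1 - cis (- (real x * t)))"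
    proof (induction x)
      case (Suc k)
      have *: "cis t * cis (- (real (Suc k) * t)) = cis (- (real k * t))" by (simp add: cis_mult algebra_simps)
      have "(1 - cis t) * (\<Sum>l<Suc k. cis (- (real (Suc l) * t)))
          = (1 - cis t) * (\<Sum>l<k. cis (- (real (Suc l) * t))) + (1 - cis t) * cis (- (real (Suc k) * t))"
        by (simp add: distrib_left)
      also have "\<dots> = - (1 - cis (- (real k * t))) + (cis (- (real (Suc k) * t)) - cis (- (real k * t)))"
        unfolding Suc *[symmetric] by (simp add: algebra_simps)
      finally show ?case by simp
    qed simp
    have ne: "1 - cis t \<noteq> 0"
    proof
      assume "1 - cis t = 0"
      hence "cos t = 1" by (metis cis.sel(1) eq_iff_diff_eq_0 one_complex.sel(1))
      thus False using cos_monotone_0_pi[of 0 t] t by simp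
    qed
    have "(1 - cis (- (real x * t))) / b t = - ((1 - cis t) * (\<Sum>j<x. cis (- (real (Suc j) * t)))) / (of_real e * (1 - cis t) * (1 - V t))"
      unfolding geo b_eq_V[OF t(1)] by simp
    also have "\<dots> = of_real (- 1 / e) * (\<Sum>j<x. cis (- (real (Suc j) * t)) / (1 - V t))"
      using ne e_pos by (simp add: sum_divide_distrib[symmetric])
    finally show ?thesis by (simp only: Re_of_real_mult Re_sum sum_distrib_left)
  qed
  have i: "integrable LL (\<lambda>t. (\<Sum>j<x. (- 1 / e) * Re (cis (- (real (Suc j) * t)) / (1 - V t))))"
    by (intro Bochner_Integration.integrable_sum integrable_mult_right undamped_integral_0)
  show "integrable LL (\<lambda>t. Re ((1 - cis (- (real x * t))) / b t))"
    using i by (subst Bochner_Integration.integrable_cong[OF refl eq])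
  have "(\<integral>t. Re ((1 - cis (- (real x * t))) / b t) \<partial>LL) = (\<integral>t. (\<Sum>j<x. (- 1 / e) * Re (cis (- (real (Suc j) * t)) / (1 - V t))) \<partial>LL)"
    by (rule Bochner_Integration.integral_cong[OF refl eq])
  also have "\<dots> = (\<Sum>j<x. (- 1 / e) * (\<integral>t. Re (cis (- (real (Suc j) * t)) / (1 - V t)) \<partial>LL))"
    by (subst Bochner_Integration.integral_sum) (auto intro!: integrable_mult_right undamped_integral_0 simp only: integral_mult_right_zero)
  also have "\<dots> = 0" unfolding undamped_integral_0(2) by simp
  finally show "(\<integral>t. Re ((1 - cis (- (real x * t))) / b t) \<partial>LL) = 0" .
qed

end

section \<open>Fejer weighted sums\<close>

text \<open>Plain sums of \<open>sin (x * t)\<close> change sign in \<open>t\<close>. With weights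
  \<open>n - x\<close> the closed form of the sine sum has numerator
  \<open>n * sin t - sin (n * t)\<close>, nonnegative on the half circle.\<close>

definition fejer_cos :: "nat \<Rightarrow> real \<Rightarrow> real" where "fejer_cos n t = (\<Sum>x<n. (real n - real x) * (1 - cos (real x * t)))"
definition fejer_sin :: "nat \<Rightarrow> real \<Rightarrow> real" where "fejer_sin n t = (\<Sum>x<n. (real n - real x) * sin (real x * t))"

lemma sum_sin: "2 * (1 - cos t) * (\<Sum>x<Suc n. sin (real x * t)) = sin t + sin (real n * t) - sin (real (Suc n) * t)"
proof (induction n)
  case (Suc n)
  have "sin (real (Suc (Suc n)) * t) + sin (real n * t) = 2 * cos t * sin (real (Suc n) * t)"
    using sin_add[of "real (Suc n) * t" t] sin_diff[of "real (Suc n) * t" t] by (simp add: algebra_simps)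
  hence "2 * (1 - cos t) * sin (real (Suc n) * t) = 2 * sin (real (Suc n) * t) - sin (real (Suc (Suc n)) * t) - sin (real n * t)"
    by (simp add: algebra_simps)
  thus ?case using Suc unfolding sum.lessThan_Suc[of _ "Suc n"] distrib_left by linarith
qed simp

lemma fejer_sin_closed_form: "2 * (1 - cos t) * fejer_sin n t = real n * sin t - sin (real n * t)"
proof (induction n)
  case (Suc n)
  have "fejer_sin (Suc n) t = fejer_sin n t + (\<Sum>x<Suc n. sin (real x * t))"
    unfolding fejer_sin_def by (simp add: sum.distrib[symmetric] algebra_simps)
  hence "2 * (1 - cos t) * fejer_sin (Suc n) t = 2 * (1 - cos t) * fejer_sin n t + 2 * (1 - cos t) * (\<Sum>x<Suc n. sin (real x * t))"
    by (simp only: distrib_left)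
  thus ?case unfolding Suc sum_sin by (simp add: algebra_simps)
qed (simp add: fejer_sin_def)

lemma abs_sin_mult_le: "\<bar>sin (real n * t)\<bar> \<le> real n * \<bar>sin t\<bar>"
proof (induction n)
  case (Suc n)
  have "\<bar>sin (real (Suc n) * t)\<bar> = \<bar>sin (real n * t) * cos t + cos (real n * t) * sin t\<bar>"
  proof -
    have "real (Suc n) * t = real n * t + t" by (simp add: algebra_simps)
    thus ?thesis by (simp only: sin_add)
  qed
  also have "\<dots> \<le> \<bar>sin (real n * t)\<bar> * \<bar>cos t\<bar> + \<bar>cos (real n * t)\<bar> * \<bar>sin t\<bar>"
    by (metis abs_mult abs_triangle_ineq)
  also have "\<dots> \<le> \<bar>sin (real n * t)\<bar> * 1 + 1 * \<bar>sin t\<bar>"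
    by (intro add_mono mult_mono abs_cos_le_one) auto
  finally show ?case using Suc by (simp add: algebra_simps)
qed simp

text \<open>Beyond 1 the left side is below \<open>1/3\<close> because
  \<open>pi\<^sup>2 < 10\<close>, and \<open>1 - cos 1\<close> is at least
  \<open>1/3\<close>.\<close>

lemma one_minus_cos_ge': "t\<^sup>2 / 30 \<le> 1 - cos t" if "0 < t" "t \<le> pi" for t :: real
proof (cases "t \<le> 1")
  case True
  thus ?thesis using one_minus_cos_ge[of t] that zero_le_power2[of t] by linarith
next
  case False
  have "t\<^sup>2 \<le> (3.15)\<^sup>2" using that pi_approx by (intro power_mono) auto
  hence "t\<^sup>2 / 30 \<le> 1/3" by (simp add: power2_eq_square)
  moreover have "cos t \<le> cos 1" using False that by (intro cos_monotone_0_pi_le) auto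
  moreover have "1/3 \<le> 1 - cos (1::real)" using one_minus_cos_ge[of 1] by simp
  ultimately show ?thesis by linarith
qed

lemma fejer_sin_nonneg: "0 \<le> fejer_sin n t" if "0 < t" "t \<le> pi"
proof -
  have "0 < 1 - cos t" using one_minus_cos_ge'[OF that] zero_less_power[OF that(1), of 2] by linarith
  moreover have "0 \<le> 2 * (1 - cos t) * fejer_sin n t"
    unfolding fejer_sin_closed_form using abs_sin_mult_le[of n t] sin_ge_zero[of t] that by (simp add: abs_le_iff)
  ultimately show ?thesis by (simp add: zero_le_mult_iff)
qed

lemma fejer_sin_upper1: "fejer_sin n t \<le> 30 * real n / t" if "0 < t" "t \<le> pi"
proof -
  have *: "t\<^sup>2 / 30 \<le> 1 - cos t" by (rule one_minus_cos_ge'[OF that])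
  have "2 * (t\<^sup>2 / 30) * fejer_sin n t \<le> 2 * (1 - cos t) * fejer_sin n t"
    using * fejer_sin_nonneg[OF that] by (intro mult_right_mono mult_left_mono) auto
  also have "\<dots> \<le> 2 * (real n * \<bar>sin t\<bar>)"
    unfolding fejer_sin_closed_form using abs_sin_mult_le[of n t] mult_left_mono[OF abs_ge_self[of "sin t"], of "real n"] by (simp add: abs_le_iff)
  also have "\<dots> \<le> 2 * (real n * t)" using abs_sin_x_le_abs_x[of t] that by (intro mult_left_mono) auto
  finally have "t * (t * fejer_sin n t) \<le> t * (30 * real n)" by (simp add: power2_eq_square algebra_simps)
  thus ?thesis using that by (simp add: field_simps)
qed

lemma fejer_sin_upper2: "fejer_sin n t \<le> real n ^ 3 * t" if "0 < t"
proof -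
  have "fejer_sin n t \<le> (\<Sum>x<n. real n * (real n * t))"
    unfolding fejer_sin_def
  proof (rule sum_mono)
    fix x assume x: "x \<in> {..<n}"
    have "sin (real x * t) \<le> real x * t" using that by (intro sin_x_le_x) auto
    also have "\<dots> \<le> real n * t" using x that by (intro mult_right_mono) auto
    finally have s: "sin (real x * t) \<le> real n * t" .
    have "(real n - real x) * sin (real x * t) \<le> (real n - real x) * (real n * t)" using s x by (intro mult_left_mono) auto
    also have "\<dots> \<le> real n * (real n * t)" using x that by (intro mult_right_mono) auto
    finally show "(real n - real x) * sin (real x * t) \<le> real n * (real n * t)" .
  qed
  thus ?thesis by (simp add: power3_eq_cube mult_ac)
qed

lemma fejer_cos_nonneg: "0 \<le> fejer_cos n t"
  unfolding fejer_cos_def by (intro sum_nonneg mult_nonneg_nonneg) auto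

lemma fejer_cos_upper1: "fejer_cos n t \<le> 2 * (real n)\<^sup>2"
proof -
  have "fejer_cos n t \<le> (\<Sum>x<n. real n * 2)"
    unfolding fejer_cos_def
  proof (intro sum_mono mult_mono)
    fix x show "1 - cos (real x * t) \<le> 2" using cos_ge_minus_one[of "real x * t"] by linarith
  qed auto
  thus ?thesis by (simp add: power2_eq_square)
qed

lemma fejer_cos_upper2: "fejer_cos n t \<le> real n ^ 4 * t\<^sup>2"
proof -
  have "fejer_cos n t \<le> (\<Sum>x<n. real n * (real n * t)\<^sup>2)"
    unfolding fejer_cos_def
  proof (intro sum_mono mult_mono)
    fix x assume x: "x \<in> {..<n}"
    have "1 - cos (real x * t) \<le> (real x * t)\<^sup>2" using one_minus_cos_le[of "real x * t"] zero_le_power2[of "real x * t"] by linarith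
    also have "\<dots> \<le> (real n * t)\<^sup>2" unfolding power_mult_distrib using x by (intro mult_right_mono power_mono) auto
    finally show "1 - cos (real x * t) \<le> (real n * t)\<^sup>2" .
  qed auto
  thus ?thesis by (simp add: power_mult_distrib power2_eq_square power4_eq_xxxx mult_ac)
qed

lemma sum_weights:
  "(\<Sum>x<n. (real n - real x) * real x) = (real n ^ 3 - real n) / 6"
  "(\<Sum>x<n. (real n - real x) * (real x)\<^sup>2) = (real n ^ 4 - (real n)\<^sup>2) / 12"
proof -
  have s1: "(\<Sum>x<n. real x) = real n * (real n - 1) / 2" by (induction n) (auto simp: field_simps)
  have s2: "(\<Sum>x<n. (real x)\<^sup>2) = (real n - 1) * real n * (2 * real n - 1) / 6"
    by (induction n) (auto simp: field_simps power2_eq_square)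
  have s3: "(\<Sum>x<n. (real x)^3) = (real n * (real n - 1))\<^sup>2 / 4"
    by (induction n) (auto simp: field_simps power2_eq_square power3_eq_cube)
  have "(\<Sum>x<n. (real n - real x) * real x) = real n * (\<Sum>x<n. real x) - (\<Sum>x<n. (real x)\<^sup>2)"
    by (simp add: sum_distrib_left sum_subtractf[symmetric] algebra_simps power2_eq_square)
  thus "(\<Sum>x<n. (real n - real x) * real x) = (real n ^ 3 - real n) / 6"
    unfolding s1 s2 by (simp add: field_simps power3_eq_cube)
  have "(\<Sum>x<n. (real n - real x) * (real x)\<^sup>2) = real n * (\<Sum>x<n. (real x)\<^sup>2) - (\<Sum>x<n. (real x)^3)"
    by (simp add: sum_distrib_left sum_subtractf[symmetric] algebra_simps power2_eq_square power3_eq_cube)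
  thus "(\<Sum>x<n. (real n - real x) * (real x)\<^sup>2) = (real n ^ 4 - (real n)\<^sup>2) / 12"
    unfolding s2 s3 by (simp add: field_simps power2_eq_square power4_eq_xxxx)
qed

text \<open>For these \<open>t\<close> all angles \<open>x * t\<close> are at most 1, so nothing
  oscillates and quadratic and linear lower bounds can be summed. The exact constants
  \<open>1/192\<close> and \<open>5/96\<close> are rounded to \<open>1/200\<close>.\<close>

lemma fejer_cos_kI_lower:
  assumes n: "n \<ge> 2" and t: "1 / (2 * real n) \<le> t" "t \<le> 1 / real n"
  shows "(real n)\<^sup>2 / 200 \<le> fejer_cos n t" "(real n)\<^sup>2 / 200 \<le> fejer_sin n t"
proof -
  have n': "real n \<ge> 2" using n by simp
  have t0: "t > 0" using t n' by (intro less_le_trans[OF _ t(1)]) auto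
  have xt: "0 \<le> real x * t" "real x * t \<le> 1" if "x < n" for x
  proof -
    have "real x * t \<le> real n * (1 / real n)" using that t t0 by (intro mult_mono) auto
    thus "real x * t \<le> 1" using n' by simp
  qed (use t0 in auto)
  have "(real n)\<^sup>2 / 200 \<le> (1 / (2 * real n))\<^sup>2 / 3 * ((real n ^ 4 - (real n)\<^sup>2) / 12)"
  proof -
    have "(real n)\<^sup>2 * 4 \<le> (real n)\<^sup>2 * (real n)\<^sup>2" using power_mono[OF n', of 2] by (intro mult_left_mono) auto
    hence "real n ^ 4 - (real n)\<^sup>2 \<ge> 3/4 * real n ^ 4" by (simp add: power4_eq_xxxx power2_eq_square)
    hence "(1 / (2 * real n))\<^sup>2 / 3 * ((3/4 * real n ^ 4) / 12) \<le> (1 / (2 * real n))\<^sup>2 / 3 * ((real n ^ 4 - (real n)\<^sup>2) / 12)"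
      by (intro mult_left_mono divide_right_mono) auto
    moreover have "(1 / (2 * real n))\<^sup>2 / 3 * ((3/4 * real n ^ 4) / 12) = (real n)\<^sup>2 / 192"
      using n' by (simp add: power2_eq_square power4_eq_xxxx)
    ultimately show ?thesis using zero_le_power2[of "real n"] by linarith
  qed
  also have "\<dots> \<le> t\<^sup>2 / 3 * ((real n ^ 4 - (real n)\<^sup>2) / 12)"
  proof (intro mult_right_mono divide_right_mono power_mono t)
    have "(real n)\<^sup>2 \<le> real n ^ 4" using n' by (intro power_increasing) auto
    thus "0 \<le> (real n ^ 4 - (real n)\<^sup>2) / 12" by simp
  qed (use n' in auto)
  also have "\<dots> = (\<Sum>x<n. (real n - real x) * ((real x * t)\<^sup>2 / 3))"
    unfolding sum_weights(2)[symmetric] sum_distrib_left by (intro sum.cong refl) (simp add: power_mult_distrib)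
  also have "\<dots> \<le> fejer_cos n t" unfolding fejer_cos_def
  proof (intro sum_mono mult_left_mono)
    fix x assume "x \<in> {..<n}"
    thus "(real x * t)\<^sup>2 / 3 \<le> 1 - cos (real x * t)" using xt[of x] by (intro one_minus_cos_ge) simp
  qed auto
  finally show "(real n)\<^sup>2 / 200 \<le> fejer_cos n t" .
  have "(real n)\<^sup>2 / 200 \<le> (1 / (2 * real n)) * (5/6) * ((real n ^ 3 - real n) / 6)"
  proof -
    have "real n * 4 \<le> real n * (real n)\<^sup>2" using power_mono[OF n', of 2] by (intro mult_left_mono) auto
    hence "real n ^ 3 - real n \<ge> 3/4 * real n ^ 3" by (simp add: power3_eq_cube power2_eq_square)
    hence "(1 / (2 * real n)) * (5/6) * ((3/4 * real n ^ 3) / 6) \<le> (1 / (2 * real n)) * (5/6) * ((real n ^ 3 - real n) / 6)"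
      by (intro mult_left_mono divide_right_mono) auto
    moreover have "(1 / (2 * real n)) * (5/6) * ((3/4 * real n ^ 3) / 6) = 5/96 * (real n)\<^sup>2"
      using n' by (simp add: power2_eq_square power3_eq_cube)
    ultimately show ?thesis using zero_le_power2[of "real n"] by linarith
  qed
  also have "\<dots> \<le> t * (5/6) * ((real n ^ 3 - real n) / 6)"
  proof (intro mult_right_mono t)
    have "real n ^ 1 \<le> real n ^ 3" using n' by (intro power_increasing) auto
    thus "0 \<le> (real n ^ 3 - real n) / 6" by simp
  qed auto
  also have "\<dots> = (\<Sum>x<n. (real n - real x) * (5/6 * (real x * t)))"
    unfolding sum_weights(1)[symmetric] sum_distrib_left by (intro sum.cong refl) simp
  also have "\<dots> \<le> fejer_sin n t" unfolding fejer_sin_def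
  proof (intro sum_mono mult_left_mono)
    fix x assume "x \<in> {..<n}"
    hence x: "0 \<le> real x * t" "real x * t \<le> 1" using xt by auto
    have "(real x * t)^3 \<le> (real x * t)^1" using x by (intro power_decreasing) auto
    thus "5/6 * (real x * t) \<le> sin (real x * t)" using minus_sin_cubic[OF x(1)] by simp
  qed auto
  finally show "(real n)\<^sup>2 / 200 \<le> fejer_sin n t" .
qed

section \<open>Difference of the reciprocals for the walk and its comparison walk\<close>

context step
begin

text \<open>The difference is \<open>\<Delta> / W\<close> with \<open>W = w t * b t\<close>. The
  imaginary part of \<open>W\<close> pairs a real with an imaginary part, so the cross terms keep
  the factor \<open>N2\<close> or \<open>N3\<close>, and what accompanies it is at most
  \<open>Np / N\<close>. Thus each term is small by way of the positive jumps.\<close>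

lemma inverse_difference_bounds:
  "\<exists>C>0. \<forall>t. 0 < t \<longrightarrow> t < pi \<longrightarrow>
    \<bar>Re (1 / w t - 1 / b t)\<bar> \<le> C * ((Np t - t * N3p t) + Np t / N t * (N t - t * N3 t)) / (t\<^sup>2 * (N t)\<^sup>2) \<and>
    \<bar>Im (1 / w t - 1 / b t)\<bar> \<le> C * (N3p t + Np t / N t * N3 t) / (t * (N t)\<^sup>2)"
proof -
  obtain cw where cw: "cw > 0" "\<And>t. 0 < t \<Longrightarrow> t \<le> pi \<Longrightarrow> cw * (t\<^sup>2 * N t) \<le> norm (w t)" using w_lower by auto
  obtain cb where cb: "cb > 0" "\<And>t. 0 < t \<Longrightarrow> t \<le> pi \<Longrightarrow> cb * (t\<^sup>2 * N t) \<le> norm (b t)" using b_lower by auto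
  define c where "c = cw * cb"
  have c: "c > 0" using cw cb by (simp add: c_def)
  obtain C1 where C1: "C1 \<ge> 1" "\<And>t. 0 < t \<Longrightarrow> t \<le> pi \<Longrightarrow>
      \<bar>Re (b t - w t)\<bar> \<le> C1 * (t\<^sup>2 * (Np t - t * N3p t)) \<and> \<bar>Im (b t - w t)\<bar> \<le> C1 * (t^3 * N3p t)"
    using b_minus_w by blast
  \<comment> \<open>Twice \<open>8 * (8 + C1)\<close>: \<open>Im W\<close> is a sum of two products
    of a bound for \<open>w\<close> with one for \<open>b\<close>.\<close>
  define C2 where "C2 = 16 * (8 + C1)"
  define C where "C = C1 / c + C1 * C2 / c\<^sup>2"
  have C2: "C2 > 0" using C1 by (simp add: C2_def)
  have C: "C > 0" "C1 / c \<le> C" "C1 * C2 / c\<^sup>2 \<le> C" using C1(1) C2 c by (auto simp: C_def intro!: add_pos_pos divide_pos_pos mult_pos_pos)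
  show ?thesis
  proof (intro exI[of _ C] conjI allI impI C(1))
    fix t :: real assume t: "0 < t" "t < pi"
    define n2 n3 p2 p3 where "n2 = N t - t * N3 t" and "n3 = N3 t" and "p2 = Np t - t * N3p t" and "p3 = N3p t"
    have Nt: "N t > 0" using N_pos[of t] t by simp
    have Npn: "0 \<le> Np t" using Np_nonneg[of t] t by simp
    have pos: "0 \<le> n2" "0 \<le> n3" "0 \<le> p2" "0 \<le> p3" "p2 \<le> n2" "p3 \<le> n3" "p2 \<le> Np t" "n2 \<le> N t" "t * n3 \<le> N t" "t * p3 \<le> Np t"
      using N3_le[OF t(1)] N3p_le[OF t(1)] N3_nonneg[of t] N3p_nonneg[of t] N2p_le_N2[OF t(1)] N3p_le_N3[OF t(1)] t
      by (auto simp: n2_def n3_def p2_def p3_def)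
    define \<Delta> where "\<Delta> = b t - w t"
    define W where "W = w t * b t"
    have d: "\<bar>Re \<Delta>\<bar> \<le> C1 * (t\<^sup>2 * p2)" "\<bar>Im \<Delta>\<bar> \<le> C1 * (t^3 * p3)"
      using C1(2)[of t] t by (simp_all add: \<Delta>_def p2_def p3_def)
    have wb: "\<bar>Re (w t)\<bar> \<le> 8 * (t\<^sup>2 * n2)" "\<bar>Im (w t)\<bar> \<le> 8 * (t^3 * n3)"
      using w_upper(1,2,3)[OF t(1)] unfolding n2_def n3_def by linarith+
    have bb: "\<bar>Re (b t)\<bar> \<le> (8 + C1) * (t\<^sup>2 * n2)" "\<bar>Im (b t)\<bar> \<le> (8 + C1) * (t^3 * n3)"
    proof -
      have "C1 * (t\<^sup>2 * p2) \<le> C1 * (t\<^sup>2 * n2)" using pos C1(1) by (intro mult_left_mono) auto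
      moreover have "Re (b t) = Re (w t) + Re \<Delta>" by (simp add: \<Delta>_def)
      ultimately show "\<bar>Re (b t)\<bar> \<le> (8 + C1) * (t\<^sup>2 * n2)" using wb d unfolding distrib_right by linarith
      have "C1 * (t^3 * p3) \<le> C1 * (t^3 * n3)" using pos C1(1) t by (intro mult_left_mono) auto
      moreover have "Im (b t) = Im (w t) + Im \<Delta>" by (simp add: \<Delta>_def)
      ultimately show "\<bar>Im (b t)\<bar> \<le> (8 + C1) * (t^3 * n3)" using wb d unfolding distrib_right by linarith
    qed
    define q where "q = c * (t^4 * (N t)\<^sup>2)"
    have q: "q > 0" using c t Nt by (simp add: q_def)
    have Wq: "q \<le> norm W"
    proof -
      have "(cw * (t\<^sup>2 * N t)) * (cb * (t\<^sup>2 * N t)) \<le> norm (w t) * norm (b t)"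
        using cw(1) cw(2)[of t] cb(1) cb(2)[of t] t Nt by (intro mult_mono) auto
      thus ?thesis by (simp add: q_def c_def W_def norm_mult power2_eq_square power4_eq_xxxx mult_ac)
    qed
    hence nW: "norm W > 0" using q by linarith
    have D: "1 / w t - 1 / b t = \<Delta> / W"
    proof -
      have "w t \<noteq> 0" "b t \<noteq> 0" using nW by (auto simp: W_def)
      thus ?thesis by (simp add: \<Delta>_def W_def divide_simps)
    qed
    have ImW: "\<bar>Im W\<bar> \<le> C2 * (t^5 * (n2 * n3))"
    proof -
      have "\<bar>Im W\<bar> = \<bar>Re (w t) * Im (b t) + Im (w t) * Re (b t)\<bar>" by (simp only: W_def times_complex.sel)
      also have "\<dots> \<le> \<bar>Re (w t)\<bar> * \<bar>Im (b t)\<bar> + \<bar>Im (w t)\<bar> * \<bar>Re (b t)\<bar>" by (metis abs_mult abs_triangle_ineq)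
      also have "\<dots> \<le> (8 * (t\<^sup>2 * n2)) * ((8 + C1) * (t^3 * n3)) + (8 * (t^3 * n3)) * ((8 + C1) * (t\<^sup>2 * n2))"
        using wb bb pos t by (intro add_mono mult_mono) auto
      also have "\<dots> = C2 * (t^5 * (n2 * n3))"
        by (simp add: C2_def power_numeral_reduce algebra_simps)
      finally show ?thesis .
    qed
    \<comment> \<open>Both parts of \<open>\<Delta> * cnj W\<close> are a main product with
      \<open>Re W\<close>, for which the norm of \<open>W\<close> suffices, and a cross product with
      \<open>Im W\<close>, which needs its finer bound.\<close>
    have gen: "\<bar>(A * X + B * Z) / (norm W)\<^sup>2\<bar> \<le> \<bar>A\<bar> / q + \<bar>B\<bar> * \<bar>Z\<bar> / q\<^sup>2" if "\<bar>X\<bar> \<le> norm W" for A B X Z :: real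
    proof -
      have "\<bar>(A * X + B * Z) / (norm W)\<^sup>2\<bar> \<le> (\<bar>A\<bar> * norm W + \<bar>B\<bar> * \<bar>Z\<bar>) / (norm W)\<^sup>2"
      proof -
        have "\<bar>A * X + B * Z\<bar> \<le> \<bar>A\<bar> * \<bar>X\<bar> + \<bar>B\<bar> * \<bar>Z\<bar>" by (metis abs_mult abs_triangle_ineq)
        also have "\<dots> \<le> \<bar>A\<bar> * norm W + \<bar>B\<bar> * \<bar>Z\<bar>" using that by (intro add_mono mult_left_mono) auto
        finally show ?thesis by (simp add: abs_divide divide_right_mono)
      qed
      also have "\<dots> = \<bar>A\<bar> / norm W + \<bar>B\<bar> * \<bar>Z\<bar> / (norm W)\<^sup>2" using nW by (simp add: add_divide_distrib power2_eq_square)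
      also have "\<dots> \<le> \<bar>A\<bar> / q + \<bar>B\<bar> * \<bar>Z\<bar> / q\<^sup>2"
        using Wq q by (intro add_mono divide_left_mono power_mono mult_pos_pos) auto
      finally show ?thesis .
    qed
    have "\<bar>Re (1 / w t - 1 / b t)\<bar> \<le> \<bar>Re \<Delta>\<bar> / q + \<bar>Im \<Delta>\<bar> * \<bar>Im W\<bar> / q\<^sup>2"
      unfolding D Re_divide_cnj using gen[of "Re W" "Re \<Delta>" "Im \<Delta>" "Im W"] abs_Re_le_cmod[of W] by simp
    also have "\<dots> \<le> C1 * (t\<^sup>2 * p2) / q + (C1 * (t^3 * p3)) * (C2 * (t^5 * (n2 * n3))) / q\<^sup>2"
      using d ImW q pos t C1(1) by (intro add_mono divide_right_mono mult_mono) auto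
    also have "C1 * (t\<^sup>2 * p2) / q = C1 / c * (p2 / (t\<^sup>2 * (N t)\<^sup>2))"
      using t Nt c by (simp add: q_def power_numeral_reduce)
    also have "(C1 * (t^3 * p3)) * (C2 * (t^5 * (n2 * n3))) / q\<^sup>2 = C1 * C2 / c\<^sup>2 * (((t * p3) * (t * n3) / (N t)\<^sup>2 * n2) / (t\<^sup>2 * (N t)\<^sup>2))"
      using t Nt c by (simp add: q_def power_numeral_reduce power_mult_distrib mult_ac)
    also have "C1 / c * (p2 / (t\<^sup>2 * (N t)\<^sup>2)) + C1 * C2 / c\<^sup>2 * (((t * p3) * (t * n3) / (N t)\<^sup>2 * n2) / (t\<^sup>2 * (N t)\<^sup>2))
        \<le> C * (p2 / (t\<^sup>2 * (N t)\<^sup>2)) + C * ((Np t * N t / (N t)\<^sup>2 * n2) / (t\<^sup>2 * (N t)\<^sup>2))"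
      using C C1(1) C2 c pos t Nt Npn by (intro add_mono mult_mono divide_right_mono mult_right_mono) auto
    also have "\<dots> = C * (p2 + Np t / N t * n2) / (t\<^sup>2 * (N t)\<^sup>2)"
      using Nt by (simp add: power2_eq_square add_divide_distrib distrib_left)
    finally show "\<bar>Re (1 / w t - 1 / b t)\<bar> \<le> C * ((Np t - t * N3p t) + Np t / N t * (N t - t * N3 t)) / (t\<^sup>2 * (N t)\<^sup>2)"
      by (simp only: p2_def n2_def)
    have "\<bar>Im (1 / w t - 1 / b t)\<bar> \<le> \<bar>Im \<Delta>\<bar> / q + \<bar>Re \<Delta>\<bar> * \<bar>Im W\<bar> / q\<^sup>2"
      unfolding D Im_divide_cnj using gen[of "Re W" "Im \<Delta>" "- Re \<Delta>" "Im W"] abs_Re_le_cmod[of W] by simp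
    also have "\<dots> \<le> C1 * (t^3 * p3) / q + (C1 * (t\<^sup>2 * p2)) * (C2 * (t^5 * (n2 * n3))) / q\<^sup>2"
      using d ImW q pos t C1(1) by (intro add_mono divide_right_mono mult_mono) auto
    also have "C1 * (t^3 * p3) / q = C1 / c * (p3 / (t * (N t)\<^sup>2))"
      using t Nt c by (simp add: q_def power_numeral_reduce)
    also have "(C1 * (t\<^sup>2 * p2)) * (C2 * (t^5 * (n2 * n3))) / q\<^sup>2 = C1 * C2 / c\<^sup>2 * ((p2 * n2 / (N t)\<^sup>2 * n3) / (t * (N t)\<^sup>2))"
      using t Nt c by (simp add: q_def power_numeral_reduce power_mult_distrib mult_ac)
    also have "C1 / c * (p3 / (t * (N t)\<^sup>2)) + C1 * C2 / c\<^sup>2 * ((p2 * n2 / (N t)\<^sup>2 * n3) / (t * (N t)\<^sup>2))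
        \<le> C * (p3 / (t * (N t)\<^sup>2)) + C * ((Np t * N t / (N t)\<^sup>2 * n3) / (t * (N t)\<^sup>2))"
      using C C1(1) C2 c pos t Nt Npn by (intro add_mono mult_mono divide_right_mono mult_right_mono) auto
    also have "\<dots> = C * (p3 + Np t / N t * n3) / (t * (N t)\<^sup>2)"
      using Nt by (simp add: power2_eq_square add_divide_distrib distrib_left)
    finally show "\<bar>Im (1 / w t - 1 / b t)\<bar> \<le> C * (N3p t + Np t / N t * N3 t) / (t * (N t)\<^sup>2)"
      by (simp only: p3_def n3_def)
  qed
qed

end

section \<open>Primitives for the error terms and the resulting integral estimate\<close>

lemma absorb_fraction: "a \<le> 2 * k * z / q \<Longrightarrow> y + k * z / q \<le> y - a + 3 * k * z / q" for a k z q y :: real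
proof -
  assume a: "a \<le> 2 * k * z / q"
  have "2 * k * z / q = 2 * (k * z / q)" "3 * k * z / q = 3 * (k * z / q)" by simp_all
  thus ?thesis using a by linarith
qed

text \<open>Used with \<open>p = N\<close>, \<open>a = Np\<close> near 0, and with
  \<open>p = t N\<close>, \<open>a = t Np\<close> away from 0. The term \<open>a / p\<^sup>2\<close>
  is of size \<open>\<eta> / p\<close> where \<open>a \<le> \<eta> * p\<close>, and its derivative
  contains that of the positive jumps alone; \<open>k / p\<close> pays for the mixed term.\<close>

lemma quotient_derivative:
  fixes a p :: "real \<Rightarrow> real"
  assumes a: "(a has_real_derivative a') (at t)" and p: "(p has_real_derivative p') (at t)" "p t \<noteq> 0"
  shows "((\<lambda>t. k / p t - a t / (p t)\<^sup>2) has_real_derivative (2 * a t * p' / (p t)^3 - a' / (p t)\<^sup>2 - k * p' / (p t)\<^sup>2)) (at t)"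
proof -
  have "((\<lambda>t. k / p t - a t / (p t)\<^sup>2) has_real_derivative
      ((0 * p t - k * p') / (p t * p t) - (a' * (p t)\<^sup>2 - a t * (2 * p t * p')) / ((p t)\<^sup>2 * (p t)\<^sup>2))) (at t)"
    using assms by (auto intro!: derivative_eq_intros)
  moreover have "(0 * p t - k * p') / (p t * p t) - (a' * (p t)\<^sup>2 - a t * (2 * p t * p')) / ((p t)\<^sup>2 * (p t)\<^sup>2)
      = 2 * a t * p' / (p t)^3 - a' / (p t)\<^sup>2 - k * p' / (p t)\<^sup>2"
    using p(2) by (simp add: diff_divide_distrib power2_eq_square power3_eq_cube mult_ac)
  ultimately show ?thesis by simp
qed

context step
begin

text \<open>The order of the weighted sums: about \<open>n\<^sup>2\<close> in total weight, times
  potential values of order \<open>n / N (1/n)\<close>.\<close>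

definition growth :: "nat \<Rightarrow> real" where "growth n = real n ^ 3 / N (1 / real n)"

definition tail_ratio :: "real \<Rightarrow> real" where "tail_ratio t = Np t / N t"

abbreviation "N2 t \<equiv> N t - t * N3 t"
abbreviation "N2p t \<equiv> Np t - t * N3p t"

lemma Np_derivative: "(Np has_real_derivative - N3p t) (at t)" if "t > 0"
  by (rule reg2_has_derivative[OF Yp_int Yp_nonneg that])

lemma N_derivative: "(N has_real_derivative - N3 t) (at t)" if "t > 0"
  by (rule reg2_has_derivative[OF Ya_int Ya_nonneg that])

lemma small_numbers:
  assumes t: "0 < t" "t \<le> pi" and small: "Np t \<le> \<eta> * N t"
  shows "0 \<le> tail_ratio t" "tail_ratio t \<le> \<eta>" "0 \<le> N2 t" "N2 t \<le> N t" "0 \<le> N2p t" "N2p t \<le> \<eta> * N t" "t * N3p t \<le> \<eta> * N t" "t * N3 t \<le> N t" "0 \<le> N3 t" "0 \<le> N3p t"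
proof -
  have n: "N t > 0" using N_pos t by simp
  show "0 \<le> tail_ratio t" using Np_nonneg[of t] n t by (simp add: tail_ratio_def)
  show "tail_ratio t \<le> \<eta>" using small n by (simp add: tail_ratio_def pos_divide_le_eq)
  have "0 \<le> t * N3 t" "0 \<le> t * N3p t" using N3_nonneg[of t] N3p_nonneg[of t] t by auto
  thus "0 \<le> N2 t" "N2 t \<le> N t" "0 \<le> N2p t" "N2p t \<le> \<eta> * N t" "t * N3p t \<le> \<eta> * N t" "t * N3 t \<le> N t" "0 \<le> N3 t" "0 \<le> N3p t"
    using N3_le[OF t(1)] N3p_le[OF t(1)] small N3_nonneg[of t] N3p_nonneg[of t] by linarith+
qed

text \<open>Using \<open>N3p \<le> N3\<close> would give \<open>B / N \<tau>\<close> without the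
  factor \<open>\<eta>\<close>. The primitive \<open>3 * \<eta> / N - Np / N\<^sup>2\<close> keeps
  it: of the \<open>3 * \<eta>\<close>, two cover the mixed term of its derivative and one covers
  \<open>tail_ratio * N3\<close>. The cosine part is bounded by the constant
  \<open>k\<close>.\<close>

lemma segment_near_0:
  assumes \<tau>: "0 < \<tau>" "\<tau> \<le> pi" and small: "\<And>t. 0 < t \<Longrightarrow> t \<le> \<tau> \<Longrightarrow> Np t \<le> \<eta> * N t" and \<eta>: "\<eta> > 0"
    and f: "f integrable_on {0..\<tau>}" and A: "A \<ge> 0" "B \<ge> 0"
    and bd: "\<And>t. 0 < t \<Longrightarrow> t < \<tau> \<Longrightarrow> \<bar>f t\<bar> \<le> A * t\<^sup>2 * ((N2p t + tail_ratio t * N2 t) / (t\<^sup>2 * (N t)\<^sup>2)) + B * t * ((N3p t + tail_ratio t * N3 t) / (t * (N t)\<^sup>2))"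
  shows "\<bar>integral {0..\<tau>} f\<bar> \<le> 2 * \<eta> * A * \<tau> / N \<tau> + 3 * \<eta> * B / N \<tau>"
proof -
  define g where "g t = 3 * \<eta> / N t - Np t / (N t)\<^sup>2" for t
  define G where "G t = (if t \<le> 0 then 0 else g t)" for t
  have pos: "N t > 0" if "0 < t" "t \<le> \<tau>" for t using N_pos[of t] that \<tau> by simp
  have dg: "(g has_real_derivative (N3p t / (N t)\<^sup>2 - 2 * Np t * N3 t / (N t)^3 + 3 * \<eta> * N3 t / (N t)\<^sup>2)) (at t)"
    if "0 < t" "t \<le> \<tau>" for t
    unfolding g_def[abs_def]
    by (rule DERIV_cong[OF quotient_derivative[OF Np_derivative[OF that(1)] N_derivative[OF that(1)]]])
       (use pos[OF that] in auto)
  have dG: "(G has_real_derivative (N3p t / (N t)\<^sup>2 - 2 * Np t * N3 t / (N t)^3 + 3 * \<eta> * N3 t / (N t)\<^sup>2)) (at t)"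
    if "0 < t" "t \<le> \<tau>" for t
  proof (rule has_field_derivative_transform_within_open[OF dg[OF that] open_greaterThan])
    show "t \<in> {0<..}" using that by simp
  qed (auto simp: G_def)
  have glim: "(g \<longlongrightarrow> 0) (at_right 0)"
  proof -
    have 1: "((\<lambda>t. 3 * \<eta> * (1 / N t)) \<longlongrightarrow> 3 * \<eta> * 0) (at_right 0)" by (intro tendsto_intros inverse_N_tendsto)
    have 2: "((\<lambda>t. (Np t / N t) * (1 / N t)) \<longlongrightarrow> 0 * 0) (at_right 0)" by (intro tendsto_mult ratio' inverse_N_tendsto)
    have "((\<lambda>t. 3 * \<eta> * (1 / N t) - (Np t / N t) * (1 / N t)) \<longlongrightarrow> 3 * \<eta> * 0 - 0 * 0) (at_right 0)"
      by (rule tendsto_diff[OF 1 2])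
    thus ?thesis by (simp add: g_def[abs_def] power2_eq_square)
  qed
  have contG: "continuous_on {0..\<tau>} G"
    by (rule continuous_at_0_if[OF \<tau>(1) glim]) (auto intro!: DERIV_isCont[OF dG] simp: G_def)
  define k where "k = 2 * \<eta> * A / N \<tau>"
  let ?F = "\<lambda>t. k * t + B * G t"
  have "\<bar>integral {0..\<tau>} f\<bar> \<le> ?F \<tau> - ?F 0"
  proof (rule FTC_bound[OF _ f])
    show "continuous_on {0..\<tau>} ?F" by (intro continuous_intros contG)
    fix t assume t: "0 < t" "t < \<tau>"
    have t': "t \<le> pi" "t \<le> \<tau>" using t \<tau> by auto
    show "(?F has_real_derivative k + B * (N3p t / (N t)\<^sup>2 - 2 * Np t * N3 t / (N t)^3 + 3 * \<eta> * N3 t / (N t)\<^sup>2)) (at t)"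
      using t by (auto intro!: derivative_eq_intros dG)
    note sm = small_numbers[OF t(1) t'(1) small[OF t(1) t'(2)]]
    note Nt = pos[OF t(1) t'(2)]
    have "tail_ratio t * N2 t \<le> \<eta> * N t" using sm by (intro mult_mono) auto
    hence "(N2p t + tail_ratio t * N2 t) / (t\<^sup>2 * (N t)\<^sup>2) \<le> (2 * \<eta> * N t) / (t\<^sup>2 * (N t)\<^sup>2)"
      using sm by (intro divide_right_mono) auto
    also have "\<dots> = 2 * \<eta> / (t\<^sup>2 * N t)" using Nt by (simp add: power2_eq_square)
    finally have "A * t\<^sup>2 * ((N2p t + tail_ratio t * N2 t) / (t\<^sup>2 * (N t)\<^sup>2)) \<le> A * t\<^sup>2 * (2 * \<eta> / (t\<^sup>2 * N t))"
      using A by (intro mult_left_mono) auto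
    also have "\<dots> = 2 * \<eta> * A / N t" using t by simp
    also have "\<dots> \<le> 2 * \<eta> * A / N \<tau>"
      using reg2_antimono[OF Ya_int Ya_nonneg t(1) t'(2)] A \<eta> pos[of \<tau>] \<tau> by (intro divide_left_mono) (auto intro!: mult_pos_pos Nt)
    finally have 1: "A * t\<^sup>2 * ((N2p t + tail_ratio t * N2 t) / (t\<^sup>2 * (N t)\<^sup>2)) \<le> k" unfolding k_def .
    have "2 * Np t * N3 t / (N t)^3 = 2 * tail_ratio t * N3 t / (N t)\<^sup>2"
      by (simp add: tail_ratio_def power2_eq_square power3_eq_cube)
    also have "\<dots> \<le> 2 * \<eta> * N3 t / (N t)\<^sup>2" using sm by (intro divide_right_mono mult_right_mono) auto
    finally have "N3p t / (N t)\<^sup>2 + \<eta> * N3 t / (N t)\<^sup>2 \<le> N3p t / (N t)\<^sup>2 - 2 * Np t * N3 t / (N t)^3 + 3 * \<eta> * N3 t / (N t)\<^sup>2"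
      by simp
    moreover have "tail_ratio t * N3 t / (N t)\<^sup>2 \<le> \<eta> * N3 t / (N t)\<^sup>2" using sm by (intro divide_right_mono mult_right_mono) auto
    moreover have "B * t * ((N3p t + tail_ratio t * N3 t) / (t * (N t)\<^sup>2)) = B * (N3p t / (N t)\<^sup>2 + tail_ratio t * N3 t / (N t)\<^sup>2)"
      using t by (simp add: add_divide_distrib[symmetric])
    ultimately have "B * t * ((N3p t + tail_ratio t * N3 t) / (t * (N t)\<^sup>2)) \<le> B * (N3p t / (N t)\<^sup>2 - 2 * Np t * N3 t / (N t)^3 + 3 * \<eta> * N3 t / (N t)\<^sup>2)"
      using A(2) by (simp only:) (intro mult_left_mono, linarith+)
    thus "\<bar>f t\<bar> \<le> k + B * (N3p t / (N t)\<^sup>2 - 2 * Np t * N3 t / (N t)^3 + 3 * \<eta> * N3 t / (N t)\<^sup>2)"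
      using bd[OF t] 1 by linarith
  qed (use \<tau> in auto)
  also have "?F \<tau> - ?F 0 \<le> 2 * \<eta> * A * \<tau> / N \<tau> + 3 * \<eta> * B / N \<tau>"
  proof -
    have "G \<tau> \<le> 3 * \<eta> / N \<tau>" using \<tau> Np_nonneg[of \<tau>] by (simp add: G_def g_def)
    hence "B * G \<tau> \<le> B * (3 * \<eta> / N \<tau>)" using A by (intro mult_left_mono)
    thus ?thesis by (simp add: G_def k_def mult_ac)
  qed
  finally show ?thesis .
qed

text \<open>Counterpart of \<open>segment_near_0\<close> with the roles exchanged: the cosine part
  needs the exact primitive, built from \<open>t * N t\<close> and \<open>t * Np t\<close>, while
  the sine part can be bounded crudely by a multiple of \<open>1 / t\<^sup>2\<close>.\<close>

lemma segment_middle: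
  assumes \<tau>: "0 < \<tau>" "\<tau> \<le> \<delta>" "\<delta> \<le> pi" and small: "\<And>t. 0 < t \<Longrightarrow> t \<le> \<delta> \<Longrightarrow> Np t \<le> \<eta> * N t" and \<eta>: "\<eta> > 0"
    and f: "f integrable_on {\<tau>..\<delta>}" and A: "A \<ge> 0" "B \<ge> 0"
    and bd: "\<And>t. \<tau> < t \<Longrightarrow> t < \<delta> \<Longrightarrow> \<bar>f t\<bar> \<le> A * ((N2p t + tail_ratio t * N2 t) / (t\<^sup>2 * (N t)\<^sup>2)) + B / t * ((N3p t + tail_ratio t * N3 t) / (t * (N t)\<^sup>2))"
  shows "\<bar>integral {\<tau>..\<delta>} f\<bar> \<le> 3 * \<eta> * A / (\<tau> * N \<tau>) + 2 * \<eta> * B / (\<tau>\<^sup>2 * N \<tau>)"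
proof -
  have pos: "N t > 0" if "\<tau> \<le> t" "t \<le> \<delta>" for t using N_pos[of t] that \<tau> by simp
  define P where "P t = t * N t" for t
  define Q where "Q t = t * Np t" for t
  have Ppos: "P t > 0" if "\<tau> \<le> t" "t \<le> \<delta>" for t using pos[OF that] that \<tau> by (simp add: P_def)
  have dP: "(P has_real_derivative N2 t) (at t)" if "t > 0" for t
    unfolding P_def[abs_def] by (auto intro!: derivative_eq_intros N_derivative that)
  have dQ: "(Q has_real_derivative N2p t) (at t)" if "t > 0" for t
    unfolding Q_def[abs_def] by (auto intro!: derivative_eq_intros Np_derivative that)
  have dH: "((\<lambda>t. Q t / (P t)\<^sup>2 - 3 * \<eta> / P t) has_real_derivative (N2p t / (P t)\<^sup>2 - 2 * Q t * N2 t / (P t)^3 + 3 * \<eta> * N2 t / (P t)\<^sup>2)) (at t)"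
    if "\<tau> \<le> t" "t \<le> \<delta>" for t
  proof -
    have t: "t > 0" "P t \<noteq> 0" using Ppos[OF that] that \<tau> by auto
    from DERIV_minus[OF quotient_derivative[OF dQ[OF t(1)] dP[OF t(1)] t(2), of "3 * \<eta>"]]
    have "((\<lambda>t. - (3 * \<eta> / P t - Q t / (P t)\<^sup>2)) has_real_derivative - (2 * Q t * N2 t / (P t)^3 - N2p t / (P t)\<^sup>2 - 3 * \<eta> * N2 t / (P t)\<^sup>2)) (at t)" .
    moreover have "(\<lambda>t. - (3 * \<eta> / P t - Q t / (P t)\<^sup>2)) = (\<lambda>t. Q t / (P t)\<^sup>2 - 3 * \<eta> / P t)" by auto
    moreover have "- (2 * Q t * N2 t / (P t)^3 - N2p t / (P t)\<^sup>2 - 3 * \<eta> * N2 t / (P t)\<^sup>2) = N2p t / (P t)\<^sup>2 - 2 * Q t * N2 t / (P t)^3 + 3 * \<eta> * N2 t / (P t)\<^sup>2"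
      by linarith
    ultimately show ?thesis by (simp only:)
  qed
  define k where "k = 2 * \<eta> * B / (\<tau> * N \<tau>)"
  let ?F = "\<lambda>t. A * (Q t / (P t)\<^sup>2 - 3 * \<eta> / P t) - k * (1 / t)"
  let ?F' = "\<lambda>t. A * (N2p t / (P t)\<^sup>2 - 2 * Q t * N2 t / (P t)^3 + 3 * \<eta> * N2 t / (P t)\<^sup>2) + k * (1 / t\<^sup>2)"
  have dF: "(?F has_real_derivative ?F' t) (at t)" if "\<tau> \<le> t" "t \<le> \<delta>" for t
  proof -
    have "((\<lambda>t. k * (1 / t)) has_real_derivative - (k * (1 / t\<^sup>2))) (at t)"
      using that \<tau> by (auto intro!: derivative_eq_intros simp: power2_eq_square)
    from DERIV_diff[OF DERIV_cmult[OF dH[OF that], of A] this] show ?thesis by simp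
  qed
  have "\<bar>integral {\<tau>..\<delta>} f\<bar> \<le> ?F \<delta> - ?F \<tau>"
  proof (rule FTC_bound[OF \<tau>(2) f])
    show "continuous_on {\<tau>..\<delta>} ?F"
      by (intro continuous_at_imp_continuous_on ballI) (rule DERIV_isCont[OF dF], auto)
    fix t assume t: "\<tau> < t" "t < \<delta>"
    have t': "0 < t" "t \<le> pi" "t \<le> \<delta>" "\<tau> \<le> t" using t \<tau> by auto
    show "(?F has_real_derivative ?F' t) (at t)" by (rule dF) (use t in auto)
    note sm = small_numbers[OF t'(1,2) small[OF t'(1,3)]]
    note Nt = pos[OF t'(4,3)]
    note Pt = Ppos[OF t'(4,3)]
    have "2 * Q t * N2 t / (P t)^3 = 2 * tail_ratio t * N2 t / (P t)\<^sup>2"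
      using t' by (simp add: tail_ratio_def Q_def P_def power2_eq_square power3_eq_cube)
    also have "\<dots> \<le> 2 * \<eta> * N2 t / (P t)\<^sup>2" using sm by (intro divide_right_mono mult_right_mono) auto
    finally have "2 * Q t * N2 t / (P t)^3 \<le> 2 * \<eta> * N2 t / (P t)\<^sup>2" .
    hence "N2p t / (P t)\<^sup>2 + \<eta> * N2 t / (P t)\<^sup>2 \<le> N2p t / (P t)\<^sup>2 - 2 * Q t * N2 t / (P t)^3 + 3 * \<eta> * N2 t / (P t)\<^sup>2"
      by (rule absorb_fraction)

    moreover have "tail_ratio t * N2 t / (P t)\<^sup>2 \<le> \<eta> * N2 t / (P t)\<^sup>2" using sm by (intro divide_right_mono mult_right_mono) auto
    moreover have "(N2p t + tail_ratio t * N2 t) / (t\<^sup>2 * (N t)\<^sup>2) = N2p t / (P t)\<^sup>2 + tail_ratio t * N2 t / (P t)\<^sup>2"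
      by (simp add: P_def power_mult_distrib add_divide_distrib)
    ultimately have 1: "A * ((N2p t + tail_ratio t * N2 t) / (t\<^sup>2 * (N t)\<^sup>2)) \<le> A * (N2p t / (P t)\<^sup>2 - 2 * Q t * N2 t / (P t)^3 + 3 * \<eta> * N2 t / (P t)\<^sup>2)"
      using A(1) by (simp only:) (intro mult_left_mono, linarith+)
    have "t * (tail_ratio t * N3 t) = tail_ratio t * (t * N3 t)" by simp
    also have "\<dots> \<le> \<eta> * N t" using sm t' by (intro mult_mono mult_nonneg_nonneg) auto
    finally have "t * (N3p t + tail_ratio t * N3 t) \<le> 2 * \<eta> * N t" using sm unfolding distrib_left by linarith
    hence "N3p t + tail_ratio t * N3 t \<le> 2 * \<eta> * N t / t" using t' by (simp add: pos_le_divide_eq mult.commute)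
    hence "B / t * ((N3p t + tail_ratio t * N3 t) / (t * (N t)\<^sup>2)) \<le> B / t * ((2 * \<eta> * N t / t) / (t * (N t)\<^sup>2))"
      using A t' by (intro mult_left_mono divide_right_mono) auto
    also have "\<dots> = 2 * \<eta> * B / (t * N t) * (1 / t\<^sup>2)" using t' Nt by (simp add: power2_eq_square mult_ac)
    also have "\<dots> \<le> 2 * \<eta> * B / (\<tau> * N \<tau>) * (1 / t\<^sup>2)"
      using reg2_mult_mono[OF Ya_int Ya_nonneg \<tau>(1) t'(4)] A \<eta> pos[of \<tau>] Nt \<tau> t'
      by (intro mult_right_mono divide_left_mono mult_pos_pos) auto
    finally have "B / t * ((N3p t + tail_ratio t * N3 t) / (t * (N t)\<^sup>2)) \<le> k * (1 / t\<^sup>2)" unfolding k_def .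
    thus "\<bar>f t\<bar> \<le> ?F' t" using bd[OF t] 1 by linarith
  qed
  also have "?F \<delta> - ?F \<tau> \<le> 3 * \<eta> * A / (\<tau> * N \<tau>) + 2 * \<eta> * B / (\<tau>\<^sup>2 * N \<tau>)"
  proof -
    have P\<delta>: "P \<delta> > 0" and P\<tau>: "P \<tau> > 0" using Ppos[of \<delta>] Ppos[of \<tau>] \<tau> by auto
    \<comment> \<open>Smallness at the right end makes the boundary term there nonpositive; only the
      one at \<open>\<tau>\<close> remains.\<close>
    have "Q \<delta> \<le> \<eta> * P \<delta>" using small[of \<delta>] \<tau> unfolding Q_def P_def
      by (metis less_le_trans mult.left_commute mult_left_mono order_less_imp_le order_refl)
    hence "Q \<delta> / (P \<delta>)\<^sup>2 \<le> \<eta> * P \<delta> / (P \<delta>)\<^sup>2" by (intro divide_right_mono) auto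
    also have "\<dots> = \<eta> / P \<delta>" using P\<delta> by (simp add: power2_eq_square)
    also have "\<dots> \<le> 3 * \<eta> / P \<delta>" using P\<delta> \<eta> by (intro divide_right_mono) auto
    finally have "A * (Q \<delta> / (P \<delta>)\<^sup>2 - 3 * \<eta> / P \<delta>) \<le> 0" using A by (simp add: mult_nonneg_nonpos)
    moreover have "0 \<le> Q \<tau>" using Np_nonneg[of \<tau>] \<tau> by (simp add: Q_def)
    hence "A * (3 * \<eta> / P \<tau> - Q \<tau> / (P \<tau>)\<^sup>2) \<le> A * (3 * \<eta> / P \<tau>)" using A by (intro mult_left_mono) auto
    moreover have "0 \<le> k * (1 / \<delta>)" using A \<eta> \<tau> pos[of \<tau>] by (simp add: k_def)
    moreover have "k * (1 / \<tau>) = 2 * \<eta> * B / (\<tau>\<^sup>2 * N \<tau>)" by (simp add: k_def power2_eq_square mult_ac)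
    moreover have "A * (3 * \<eta> / P \<tau>) = 3 * \<eta> * A / (\<tau> * N \<tau>)" by (simp add: P_def)
    moreover have "?F \<delta> - ?F \<tau> = A * (Q \<delta> / (P \<delta>)\<^sup>2 - 3 * \<eta> / P \<delta>) + A * (3 * \<eta> / P \<tau> - Q \<tau> / (P \<tau>)\<^sup>2) - k * (1 / \<delta>) + k * (1 / \<tau>)"
      by (simp only: right_diff_distrib)
    ultimately show ?thesis by linarith
  qed
  finally show ?thesis .
qed

text \<open>Contributions from \<open>t\<close> away from 0 are of order \<open>n\<^sup>2\<close>;
  they are negligible because \<open>t * N t\<close> tends to 0 at \<open>t = 1/n\<close>.\<close>

lemma growth_growth: "\<forall>\<^sub>F n in sequentially. K * (real n)\<^sup>2 \<le> \<epsilon> * growth n" if "\<epsilon> > 0"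
proof -
  define K' where "K' = \<bar>K\<bar> + 1"
  have "\<forall>\<^sub>F t in at_right 0. t * N t < \<epsilon> / K'"
    by (rule order_tendstoD[OF reg2_mult_tendsto_0[OF Ya_int Ya_nonneg]]) (use that in \<open>simp add: K'_def\<close>)
  then obtain d where d: "d > 0" "\<And>t. 0 < t \<Longrightarrow> t < d \<Longrightarrow> t * N t < \<epsilon> / K'"
    unfolding eventually_at_right_field by auto
  have "\<forall>\<^sub>F n in sequentially. 1 / real n < d" by (rule order_tendstoD[OF lim_1_over_n]) (use d in simp)
  thus ?thesis using eventually_gt_at_top[of 0]
  proof eventually_elim
    case (elim n)
    define \<tau> where "\<tau> = 1 / real n"
    have "\<tau> \<le> 1" using elim by (simp add: \<tau>_def)
    hence "\<tau> \<le> pi" using pi_gt3 by linarith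
    hence \<tau>: "0 < \<tau>" "\<tau> < d" "\<tau> \<le> pi" using elim by (auto simp: \<tau>_def)
    have N\<tau>: "N \<tau> > 0" using N_pos[of \<tau>] \<tau> by simp
    have "\<tau> * N \<tau> < \<epsilon> / K'" by (rule d(2)[OF \<tau>(1,2)])
    hence "K' * (\<tau> * N \<tau>) \<le> \<epsilon>" by (simp add: K'_def field_simps)
    hence "K' * N \<tau> \<le> \<epsilon> * real n" using elim by (simp add: \<tau>_def field_simps)
    hence "(K' * N \<tau>) * (real n)\<^sup>2 \<le> (\<epsilon> * real n) * (real n)\<^sup>2" by (rule mult_right_mono) simp
    hence "K' * (real n)\<^sup>2 * N \<tau> \<le> \<epsilon> * real n ^ 3" by (simp add: power2_eq_square power3_eq_cube mult_ac)
    hence "K' * (real n)\<^sup>2 \<le> \<epsilon> * growth n" using N\<tau> by (simp add: growth_def \<tau>_def[symmetric] pos_le_divide_eq)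
    moreover have "K * (real n)\<^sup>2 \<le> K' * (real n)\<^sup>2" unfolding K'_def by (intro mult_right_mono) auto
    ultimately show ?case by linarith
  qed
qed

text \<open>The kernels of the weighted sums are of size \<open>n\<^sup>4 t\<^sup>2\<close> and \<open>n\<^sup>3 t\<close> for \<open>t < 1/n\<close>, and of size
  \<open>n\<^sup>2\<close> and \<open>n / t\<close> for larger \<open>t\<close>; integrating by parts, every factor \<open>Np / N\<close> becomes small.\<close>
lemma kernel_estimate:
  assumes C: "C > 0" and \<epsilon>: "\<epsilon> > 0"
  shows "\<forall>\<^sub>F n in sequentially. \<forall>f. integrable LL f \<longrightarrow>
    (\<forall>t. 0 < t \<longrightarrow> t < pi \<longrightarrow> \<bar>f t\<bar> \<le> fejer_cos n t * (C * (N2p t + tail_ratio t * N2 t) / (t\<^sup>2 * (N t)\<^sup>2)) + fejer_sin n t * (C * (N3p t + tail_ratio t * N3 t) / (t * (N t)\<^sup>2)))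
    \<longrightarrow> \<bar>\<integral>t. f t \<partial>LL\<bar> \<le> \<epsilon> * growth n"
proof -
  \<comment> \<open>The segments up to \<open>\<tau>\<close> and from \<open>\<tau>\<close> to
    \<open>\<delta>\<close> cost \<open>5 * \<eta> * C\<close> and \<open>66 * \<eta> * C\<close>
    times \<open>growth n\<close>; 142 is twice their sum, leaving half of \<open>\<epsilon>\<close>
    for \<open>t \<ge> \<delta>\<close>.\<close>
  define \<eta> where "\<eta> = \<epsilon> / (142 * C)"
  have \<eta>: "\<eta> > 0" "71 * \<eta> * C = \<epsilon> / 2" using C \<epsilon> by (auto simp: \<eta>_def)
  obtain \<delta> where \<delta>: "\<delta> > 0" "\<delta> \<le> pi" "\<And>t. 0 < t \<Longrightarrow> t \<le> \<delta> \<Longrightarrow> Np t \<le> \<eta> * N t" using Np_small[OF \<eta>(1)] by auto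
  define K where "K = (C * 4 / (\<delta>\<^sup>2 * N pi) + C * 60 / (\<delta>^3 * N pi)) * pi"
  have Npi: "N pi > 0" using N_pos[of pi] by simp
  have "\<forall>\<^sub>F n in sequentially. 1 / real n < \<delta>" by (rule order_tendstoD[OF lim_1_over_n]) (use \<delta> in simp)
  moreover have "\<forall>\<^sub>F n in sequentially. K * (real n)\<^sup>2 \<le> \<epsilon> / 2 * growth n" by (rule growth_growth) (use \<epsilon> in simp)
  ultimately show ?thesis using eventually_gt_at_top[of 0]
  proof eventually_elim
    case (elim n)
    define \<tau> where "\<tau> = 1 / real n"
    have n: "real n \<ge> 1" using elim by simp
    have \<tau>: "0 < \<tau>" "\<tau> < \<delta>" "\<tau> \<le> pi" using elim \<delta> by (auto simp: \<tau>_def)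
    have N\<tau>: "N \<tau> > 0" using N_pos[of \<tau>] \<tau> by simp
    show ?case
    proof (intro allI impI)
      fix f assume f: "integrable LL f" and bd: "\<forall>t. 0 < t \<longrightarrow> t < pi \<longrightarrow> \<bar>f t\<bar> \<le>
        fejer_cos n t * (C * (N2p t + tail_ratio t * N2 t) / (t\<^sup>2 * (N t)\<^sup>2)) + fejer_sin n t * (C * (N3p t + tail_ratio t * N3 t) / (t * (N t)\<^sup>2))"
      define X where "X t = (N2p t + tail_ratio t * N2 t) / (t\<^sup>2 * (N t)\<^sup>2)" for t
      define Z where "Z t = (N3p t + tail_ratio t * N3 t) / (t * (N t)\<^sup>2)" for t
      have XZ: "0 \<le> X t" "0 \<le> Z t" if "0 < t" "t \<le> pi" for t
      proof -
        have "Np t \<le> 1 * N t" using Np_le_N[OF that(1)] by simp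
        note sm = small_numbers[OF that this]
        show "0 \<le> X t" "0 \<le> Z t" using sm that by (auto simp: X_def Z_def)
      qed
      have fi: "f integrable_on {0..pi}" by (rule LL_HK(1)[OF f])
      have fb: "\<bar>f t\<bar> \<le> a * X t + c * Z t" if "0 < t" "t < pi" "fejer_cos n t * C \<le> a" "fejer_sin n t * C \<le> c" for t a c
      proof -
        have "\<bar>f t\<bar> \<le> fejer_cos n t * C * X t + fejer_sin n t * C * Z t" using bd that by (simp add: X_def Z_def mult.assoc)
        also have "\<dots> \<le> a * X t + c * Z t" using that XZ[of t] by (intro add_mono mult_right_mono) auto
        finally show ?thesis .
      qed
      have s1: "\<bar>integral {0..\<tau>} f\<bar> \<le> 2 * \<eta> * (C * real n ^ 4) * \<tau> / N \<tau> + 3 * \<eta> * (C * real n ^ 3) / N \<tau>"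
      proof (rule segment_near_0[OF \<tau>(1,3)])
        show "Np t \<le> \<eta> * N t" if "0 < t" "t \<le> \<tau>" for t using \<delta>(3)[of t] that \<tau> by simp
        show "f integrable_on {0..\<tau>}" by (rule integrable_on_subinterval[OF fi]) (use \<tau> in auto)
        fix t assume t: "0 < t" "t < \<tau>"
        have "fejer_cos n t * C \<le> C * real n ^ 4 * t\<^sup>2" using mult_right_mono[OF fejer_cos_upper2[of n t], of C] C by (simp add: mult_ac)
        moreover have "fejer_sin n t * C \<le> C * real n ^ 3 * t" using mult_right_mono[OF fejer_sin_upper2[OF t(1), of n], of C] C by (simp add: mult_ac)
        ultimately show "\<bar>f t\<bar> \<le> C * real n ^ 4 * t\<^sup>2 * ((N2p t + tail_ratio t * N2 t) / (t\<^sup>2 * (N t)\<^sup>2)) + C * real n ^ 3 * t * ((N3p t + tail_ratio t * N3 t) / (t * (N t)\<^sup>2))"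
          using fb[of t "C * real n ^ 4 * t\<^sup>2" "C * real n ^ 3 * t"] t \<tau> by (simp add: X_def Z_def)
      qed (use C \<eta> in auto)
      have s2: "\<bar>integral {\<tau>..\<delta>} f\<bar> \<le> 3 * \<eta> * (2 * C * (real n)\<^sup>2) / (\<tau> * N \<tau>) + 2 * \<eta> * (30 * C * real n) / (\<tau>\<^sup>2 * N \<tau>)"
      proof (rule segment_middle[OF \<tau>(1) _ \<delta>(2,3)])
        show "f integrable_on {\<tau>..\<delta>}" by (rule integrable_on_subinterval[OF fi]) (use \<tau> \<delta> in auto)
        fix t assume t: "\<tau> < t" "t < \<delta>"
        have t': "0 < t" "t < pi" using t \<tau> \<delta> by auto
        have "fejer_cos n t * C \<le> 2 * C * (real n)\<^sup>2" using mult_right_mono[OF fejer_cos_upper1[of n t], of C] C by (simp add: mult_ac)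
        moreover have "fejer_sin n t * C \<le> 30 * C * real n / t" using mult_right_mono[OF fejer_sin_upper1[of t n], of C] C t' by (simp add: mult_ac)
        ultimately show "\<bar>f t\<bar> \<le> 2 * C * (real n)\<^sup>2 * ((N2p t + tail_ratio t * N2 t) / (t\<^sup>2 * (N t)\<^sup>2)) + 30 * C * real n / t * ((N3p t + tail_ratio t * N3 t) / (t * (N t)\<^sup>2))"
          using fb[of t "2 * C * (real n)\<^sup>2" "30 * C * real n / t"] t' by (simp only: X_def Z_def) 
      qed (use C \<eta> \<tau> in auto)
      \<comment> \<open>Here \<open>tail_ratio\<close> is not small, but constant bounds for all
        factors give order \<open>n\<^sup>2\<close>, which suffices.\<close>
      have s3: "\<bar>integral {\<delta>..pi} f\<bar> \<le> K * (real n)\<^sup>2"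
      proof -
        define k where "k = (C * 4 / (\<delta>\<^sup>2 * N pi) + C * 60 / (\<delta>^3 * N pi)) * (real n)\<^sup>2"
        have k0: "k \<ge> 0" unfolding k_def using C \<delta> Npi by (intro mult_nonneg_nonneg add_nonneg_nonneg) auto
        have "\<bar>integral {\<delta>..pi} f\<bar> \<le> k * pi - k * \<delta>"
        proof (rule FTC_bound[OF \<delta>(2), where F="\<lambda>t. k * t" and F'="\<lambda>_. k"])
          show "f integrable_on {\<delta>..pi}" by (rule integrable_on_subinterval[OF fi]) (use \<delta> in auto)
          show "continuous_on {\<delta>..pi} (\<lambda>t. k * t)" by (intro continuous_intros)
          fix t assume t: "\<delta> < t" "t < pi"
          have t': "0 < t" "t \<le> pi" using t \<delta> by auto
          show "((\<lambda>t. k * t) has_real_derivative k) (at t)" by (auto intro!: derivative_eq_intros)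
          have "Np t \<le> 1 * N t" using Np_le_N[OF t'(1)] by simp
          note sm = small_numbers[OF t' this]
          have Nt: "N t > 0" "N pi \<le> N t" using N_pos[OF t'] N_ge[OF t'] by auto
          have "tail_ratio t * N2 t \<le> 1 * N t" using sm by (intro mult_mono) auto
          hence "X t \<le> (2 * N t) / (t\<^sup>2 * (N t)\<^sup>2)" unfolding X_def using sm by (intro divide_right_mono) auto
          also have "\<dots> = 2 / (t\<^sup>2 * N t)" using Nt by (simp add: power2_eq_square)
          also have "\<dots> \<le> 2 / (\<delta>\<^sup>2 * N pi)"
            using Nt Npi \<delta> t by (intro divide_left_mono mult_mono power_mono mult_pos_pos) auto
          finally have X: "X t \<le> 2 / (\<delta>\<^sup>2 * N pi)" .
          have "t * (tail_ratio t * N3 t) = tail_ratio t * (t * N3 t)" by simp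
          also have "\<dots> \<le> 1 * N t" using sm t' by (intro mult_mono mult_nonneg_nonneg) auto
          finally have "t * (N3p t + tail_ratio t * N3 t) \<le> 2 * N t" using sm unfolding distrib_left by linarith
          hence "N3p t + tail_ratio t * N3 t \<le> 2 * N t / t" using t' by (simp add: pos_le_divide_eq mult.commute)
          hence "Z t \<le> (2 * N t / t) / (t * (N t)\<^sup>2)" unfolding Z_def using t' by (intro divide_right_mono) auto
          also have "\<dots> = 2 / (t\<^sup>2 * N t)" using Nt t' by (simp add: power2_eq_square)
          also have "\<dots> \<le> 2 / (\<delta>\<^sup>2 * N pi)"
            using Nt Npi \<delta> t by (intro divide_left_mono mult_mono power_mono mult_pos_pos) auto
          finally have Z: "Z t \<le> 2 / (\<delta>\<^sup>2 * N pi)" .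
          have "fejer_cos n t * C \<le> 2 * C * (real n)\<^sup>2" using mult_right_mono[OF fejer_cos_upper1[of n t], of C] C by (simp add: mult_ac)
          moreover have "fejer_sin n t * C \<le> 30 * C * (real n)\<^sup>2 / \<delta>"
          proof -
            have "fejer_sin n t \<le> 30 * real n / t" by (rule fejer_sin_upper1[OF t'])
            also have "\<dots> \<le> 30 * (real n)\<^sup>2 / \<delta>"
              using n t \<delta> power_increasing[of 1 2 "real n"] by (intro frac_le) auto
            finally show ?thesis using mult_right_mono[of "fejer_sin n t" "30 * (real n)\<^sup>2 / \<delta>" C] C by (simp add: mult_ac)
          qed
          ultimately have "\<bar>f t\<bar> \<le> 2 * C * (real n)\<^sup>2 * X t + 30 * C * (real n)\<^sup>2 / \<delta> * Z t"
            using fb[of t "2 * C * (real n)\<^sup>2" "30 * C * (real n)\<^sup>2 / \<delta>"] t t' by simp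
          also have "\<dots> \<le> 2 * C * (real n)\<^sup>2 * (2 / (\<delta>\<^sup>2 * N pi)) + 30 * C * (real n)\<^sup>2 / \<delta> * (2 / (\<delta>\<^sup>2 * N pi))"
            using X Z C \<delta> by (intro add_mono mult_left_mono) auto
          also have "\<dots> = k" by (simp add: k_def power2_eq_square power3_eq_cube algebra_simps)
          finally show "\<bar>f t\<bar> \<le> k" .
        qed
        also have "\<dots> \<le> k * pi" using k0 \<delta> by simp
        finally show ?thesis by (simp add: k_def K_def mult_ac)
      qed
      have "(\<integral>t. f t \<partial>LL) = integral {0..\<tau>} f + integral {\<tau>..\<delta>} f + integral {\<delta>..pi} f"
      proof -
        have "integral {0..pi} f = integral {0..\<delta>} f + integral {\<delta>..pi} f"
          using fi \<delta> by (intro Henstock_Kurzweil_Integration.integral_combine[symmetric]) auto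
        moreover have "integral {0..\<delta>} f = integral {0..\<tau>} f + integral {\<tau>..\<delta>} f"
          using \<tau> \<delta> by (intro Henstock_Kurzweil_Integration.integral_combine[symmetric] integrable_on_subinterval[OF fi]) auto
        ultimately show ?thesis using LL_HK(2)[OF f] by simp
      qed
      moreover have "2 * \<eta> * (C * real n ^ 4) * \<tau> / N \<tau> + 3 * \<eta> * (C * real n ^ 3) / N \<tau> = 5 * \<eta> * C * growth n"
        using elim by (simp add: growth_def \<tau>_def power_numeral_reduce field_simps)
      moreover have "3 * \<eta> * (2 * C * (real n)\<^sup>2) / (\<tau> * N \<tau>) + 2 * \<eta> * (30 * C * real n) / (\<tau>\<^sup>2 * N \<tau>) = 66 * \<eta> * C * growth n"
        using elim by (simp add: growth_def \<tau>_def power_numeral_reduce field_simps)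
      moreover have "5 * \<eta> * C * growth n + 66 * \<eta> * C * growth n = \<epsilon> / 2 * growth n" unfolding \<eta>(2)[symmetric] by (simp add: algebra_simps)
      ultimately have "\<bar>\<integral>t. f t \<partial>LL\<bar> \<le> \<epsilon> / 2 * growth n + \<epsilon> / 2 * growth n" using s1 s2 s3 elim(2) by linarith
      thus "\<bar>\<integral>t. f t \<partial>LL\<bar> \<le> \<epsilon> * growth n" by simp
    qed
  qed
qed

section \<open>Weighted sums of the potential function on the two half-lines\<close>

definition left_sum :: "nat \<Rightarrow> real" where "left_sum n = (\<Sum>x<n. (real n - real x) * pot (- int x))"
definition right_sum :: "nat \<Rightarrow> real" where "right_sum n = (\<Sum>x<n. (real n - real x) * pot (int x))"

text \<open>Subtracting the vanishing integrals of the comparison walk puts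
  \<open>1 / w - 1 / b\<close> in place of \<open>1 / w\<close>, so no main term is left to
  cancel.\<close>

lemma left_sum_integral:
  shows "integrable LL (\<lambda>t. fejer_cos n t * Re (1 / w t - 1 / b t) - fejer_sin n t * Im (1 / w t - 1 / b t))"
    and "left_sum n = (1 / pi) * (\<integral>t. fejer_cos n t * Re (1 / w t - 1 / b t) - fejer_sin n t * Im (1 / w t - 1 / b t) \<partial>LL)"
proof -
  let ?D = "\<lambda>t. 1 / w t - 1 / b t"
  let ?u = "\<lambda>x t. Re ((1 - cis (- (real x * t))) / w t) - Re ((1 - cis (- (real x * t))) / b t)"
  have i1: "integrable LL (\<lambda>t. Re ((1 - cis (- (real x * t))) / w t))" for x
    using pot_kernel_limit(1)[of "- int x"] by simp
  have iu: "integrable LL (?u x)" for x by (intro Bochner_Integration.integrable_diff i1 b_kernel_integral_0)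
  have pot: "pot (- int x) = (1 / pi) * (\<integral>t. ?u x t \<partial>LL)" for x
    using b_kernel_integral_0(2)[of x] Bochner_Integration.integral_diff[OF i1[of x] b_kernel_integral_0(1)[of x]]
    by (simp add: pot_def)
  have u: "(\<Sum>x<n. (real n - real x) * ?u x t) = fejer_cos n t * Re (?D t) - fejer_sin n t * Im (?D t)" for t
  proof -
    have ux: "?u x t = (1 - cos (real x * t)) * Re (?D t) - sin (real x * t) * Im (?D t)" for x
    proof -
      have "?u x t = Re ((1 - cis (- (real x * t))) * ?D t)" by (simp add: right_diff_distrib)
      thus ?thesis unfolding Re_one_minus_cis_mult by simp
    qed
    show ?thesis unfolding fejer_cos_def fejer_sin_def sum_distrib_right sum_subtractf[symmetric] ux
      by (intro sum.cong refl, subst right_diff_distrib) (simp only: mult.assoc)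
  qed
  show "integrable LL (\<lambda>t. fejer_cos n t * Re (?D t) - fejer_sin n t * Im (?D t))"
    unfolding u[symmetric] by (intro Bochner_Integration.integrable_sum integrable_mult_right iu)
  have "(\<integral>t. fejer_cos n t * Re (?D t) - fejer_sin n t * Im (?D t) \<partial>LL) = (\<Sum>x<n. \<integral>t. (real n - real x) * ?u x t \<partial>LL)"
    unfolding u[symmetric] by (intro Bochner_Integration.integral_sum integrable_mult_right iu)
  also have "\<dots> = (\<Sum>x<n. (real n - real x) * (\<integral>t. ?u x t \<partial>LL))" by (simp only: integral_mult_right_zero)
  finally show "left_sum n = (1 / pi) * (\<integral>t. fejer_cos n t * Re (?D t) - fejer_sin n t * Im (?D t) \<partial>LL)"
    unfolding left_sum_def pot by (simp only: sum_distrib_left mult.left_commute)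
qed

lemma left_sum_small:
  assumes \<epsilon>: "\<epsilon> > 0"
  shows "\<forall>\<^sub>F n in sequentially. left_sum n \<le> \<epsilon> * growth n"
proof -
  obtain C where C: "C > 0" "\<And>t. 0 < t \<Longrightarrow> t < pi \<Longrightarrow>
    \<bar>Re (1 / w t - 1 / b t)\<bar> \<le> C * (N2p t + Np t / N t * N2 t) / (t\<^sup>2 * (N t)\<^sup>2) \<and>
    \<bar>Im (1 / w t - 1 / b t)\<bar> \<le> C * (N3p t + Np t / N t * N3 t) / (t * (N t)\<^sup>2)"
    using inverse_difference_bounds by auto
  show ?thesis using kernel_estimate[OF C(1) \<epsilon>]
  proof eventually_elim
    case (elim n)
    let ?f = "\<lambda>t. fejer_cos n t * Re (1 / w t - 1 / b t) - fejer_sin n t * Im (1 / w t - 1 / b t)"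
    have "\<bar>?f t\<bar> \<le> fejer_cos n t * (C * (N2p t + tail_ratio t * N2 t) / (t\<^sup>2 * (N t)\<^sup>2)) + fejer_sin n t * (C * (N3p t + tail_ratio t * N3 t) / (t * (N t)\<^sup>2))"
      if t: "0 < t" "t < pi" for t
    proof -
      have "\<bar>?f t\<bar> \<le> \<bar>fejer_cos n t * Re (1 / w t - 1 / b t)\<bar> + \<bar>fejer_sin n t * Im (1 / w t - 1 / b t)\<bar>" by (rule abs_triangle_ineq4)
      also have "\<dots> = fejer_cos n t * \<bar>Re (1 / w t - 1 / b t)\<bar> + fejer_sin n t * \<bar>Im (1 / w t - 1 / b t)\<bar>"
        using fejer_cos_nonneg[of n t] fejer_sin_nonneg[of t n] t by (simp add: abs_mult)
      also have "\<dots> \<le> fejer_cos n t * (C * (N2p t + tail_ratio t * N2 t) / (t\<^sup>2 * (N t)\<^sup>2)) + fejer_sin n t * (C * (N3p t + tail_ratio t * N3 t) / (t * (N t)\<^sup>2))"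
        using C(2)[OF t] fejer_cos_nonneg[of n t] fejer_sin_nonneg[of t n] t unfolding tail_ratio_def by (intro add_mono mult_left_mono) auto
      finally show ?thesis .
    qed
    hence I: "\<bar>\<integral>t. ?f t \<partial>LL\<bar> \<le> \<epsilon> * growth n" using elim left_sum_integral(1)[of n] by blast
    have "left_sum n = (1 / pi) * (\<integral>t. ?f t \<partial>LL)" by (rule left_sum_integral(2))
    also have "\<dots> \<le> (1 / pi) * (\<epsilon> * growth n)" using I by (intro mult_left_mono) auto
    also have "\<dots> \<le> 1 * (\<epsilon> * growth n)" using I pi_gt3 by (intro mult_right_mono) (auto simp: field_simps intro: order_trans[OF abs_ge_zero])
    finally show ?case by simp
  qed
qed

lemma Sp_meas [measurable]: "Sp \<in> borel_measurable borel" and Sm_meas [measurable]: "Sm \<in> borel_measurable borel"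
  unfolding Sp_def[abs_def] Sm_def[abs_def] by measurable

lemma fejer_cos_meas [measurable]: "fejer_cos n \<in> borel_measurable borel" and fejer_sin_meas [measurable]: "fejer_sin n \<in> borel_measurable borel"
  unfolding fejer_cos_def[abs_def] fejer_sin_def[abs_def] by measurable

lemma right_sum_integral:
  shows "integrable LL (\<lambda>t. fejer_cos n t * Re (1 / w t) + fejer_sin n t * Im (1 / w t))"
    and "right_sum n = (1 / pi) * (\<integral>t. fejer_cos n t * Re (1 / w t) + fejer_sin n t * Im (1 / w t) \<partial>LL)"
proof -
  let ?u = "\<lambda>x t. Re ((1 - cis (real x * t)) / w t)"
  have iu: "integrable LL (?u x)" for x
    using pot_kernel_limit(1)[of "int x"] by simp
  have pot: "pot (int x) = (1 / pi) * (\<integral>t. ?u x t \<partial>LL)" for x by (simp add: pot_def)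
  have u: "(\<Sum>x<n. (real n - real x) * ?u x t) = fejer_cos n t * Re (1 / w t) + fejer_sin n t * Im (1 / w t)" for t
  proof -
    have "?u x t = (1 - cos (real x * t)) * Re (1 / w t) + sin (real x * t) * Im (1 / w t)" for x
    proof -
      have "?u x t = Re ((1 - cis (real x * t)) * (1 / w t))" by simp
      thus ?thesis unfolding Re_one_minus_cis_mult .
    qed
    thus ?thesis unfolding fejer_cos_def fejer_sin_def sum_distrib_right sum.distrib[symmetric]
      by (intro sum.cong refl) (simp only: distrib_left mult.assoc)
  qed
  show "integrable LL (\<lambda>t. fejer_cos n t * Re (1 / w t) + fejer_sin n t * Im (1 / w t))"
    unfolding u[symmetric] by (intro Bochner_Integration.integrable_sum integrable_mult_right iu)
  have "(\<integral>t. fejer_cos n t * Re (1 / w t) + fejer_sin n t * Im (1 / w t) \<partial>LL) = (\<Sum>x<n. \<integral>t. (real n - real x) * ?u x t \<partial>LL)"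
    unfolding u[symmetric] by (intro Bochner_Integration.integral_sum integrable_mult_right iu)
  also have "\<dots> = (\<Sum>x<n. (real n - real x) * (\<integral>t. ?u x t \<partial>LL))" by (simp only: integral_mult_right_zero)
  finally show "right_sum n = (1 / pi) * (\<integral>t. fejer_cos n t * Re (1 / w t) + fejer_sin n t * Im (1 / w t) \<partial>LL)"
    unfolding right_sum_def pot by (simp only: sum_distrib_left mult.left_commute)
qed

lemma LL_indicator: "(\<integral>t. c * indicator {a..d} t \<partial>LL) = c * (d - a)" "integrable LL (\<lambda>t. c * indicator {a..d} t)"
  if "0 < a" "a \<le> d" "d < pi" for a c d :: real
proof -
  have s: "{a..d} \<in> sets LL" using that unfolding LL_def by (subst sets_restrict_space_iff) auto
  have "{a..d} \<inter> space LL = {a..d}" using that by (auto simp: space_LL)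
  moreover have "measure LL {a..d} = d - a" using that unfolding LL_def by (subst measure_restrict_space) auto
  ultimately show "(\<integral>t. c * indicator {a..d} t \<partial>LL) = c * (d - a)" by simp
  show "integrable LL (\<lambda>t. c * indicator {a..d} t)"
    using s by (intro integrable_mult_right integrable_real_indicator) (auto simp: LL.emeasure_finite less_top[symmetric])
qed

text \<open>The imaginary part of \<open>1 / w\<close> is split into its \<open>Sm\<close> and
  \<open>Sp\<close> contributions. The \<open>Sp\<close> part \<open>h\<close> comes from positive
  jumps and is negligible by \<open>kernel_estimate\<close>; the rest \<open>g\<close> is
  nonnegative because the sine kernel is, so its integral may be bounded below on
  \<open>{\<tau>/2..\<tau>}\<close> alone.\<close>

lemma right_sum_large: "\<exists>c>0. \<forall>\<^sub>F n in sequentially. c * growth n \<le> right_sum n"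
proof -
  obtain c where c: "c > 0" "\<And>t. 0 < t \<Longrightarrow> t \<le> pi \<Longrightarrow> c * (t\<^sup>2 * N t) \<le> norm (w t)" using w_lower by auto
  obtain \<delta> where \<delta>: "\<delta> > 0" "\<delta> \<le> pi" "\<And>t. 0 < t \<Longrightarrow> t \<le> \<delta> \<Longrightarrow> Np t \<le> 1/2 * N t" using Np_small[of "1/2"] by auto
  define C where "C = 8 / c\<^sup>2"
  have C: "C > 0" using c by (simp add: C_def)
  \<comment> \<open>The factors are 200 from the kernels, 8 from the lower bound for
    \<open>Re (w t) + Sm t\<close>, \<open>64 = 8\<^sup>2\<close> from the upper bound for
    \<open>norm (w t)\<close>; the last 2 makes the interval of length \<open>\<tau> / 2\<close>
    contribute exactly \<open>c0 * growth n\<close>.\<close>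
  define c0 :: real where "c0 = 1 / (200 * 8 * 64 * 2)"
  have c0: "c0 > 0" by (simp add: c0_def)
  have "\<forall>\<^sub>F n in sequentially. 1 / real n < min \<delta> 1" by (rule order_tendstoD[OF lim_1_over_n]) (use \<delta> in simp)
  moreover have "c0 / 2 > 0" using c0 by simp
  note kernel_estimate[OF C this]
  ultimately have "\<forall>\<^sub>F n in sequentially. c0 / 2 / pi * growth n \<le> right_sum n" using eventually_ge_at_top[of 2]
  proof eventually_elim
    case (elim n)
    define \<tau> where "\<tau> = 1 / real n"
    have \<tau>: "0 < \<tau>" "\<tau> < \<delta>" "\<tau> < pi" using elim \<delta> by (auto simp: \<tau>_def)
    have N\<tau>: "N \<tau> > 0" using N_pos[of \<tau>] \<tau> by simp
    define g where "g t = (fejer_cos n t * Re (w t) + fejer_sin n t * Sm t) / (norm (w t))\<^sup>2" for t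
    define h where "h t = fejer_sin n t * Sp t / (norm (w t))\<^sup>2" for t
    have gh: "fejer_cos n t * Re (1 / w t) + fejer_sin n t * Im (1 / w t) = g t - h t" if "0 < t" for t
    proof -
      have "Re (1 / w t) = Re (w t) / (norm (w t))\<^sup>2" unfolding Re_divide_cnj by simp
      moreover have "Im (1 / w t) = (Sm t - Sp t) / (norm (w t))\<^sup>2" unfolding Im_divide_cnj using Im_w[OF that] by simp
      ultimately show ?thesis unfolding g_def h_def by (simp add: add_divide_distrib diff_divide_distrib right_diff_distrib)
    qed
    have hb: "\<bar>h t\<bar> \<le> fejer_sin n t * (C * N3p t / (t * (N t)\<^sup>2))" and h0: "0 \<le> h t" if t: "0 < t" "t < pi" for t
    proof -
      have pos: "0 < c * (t\<^sup>2 * N t)" using c N_pos[of t] t by simp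
      have cw: "c * (t\<^sup>2 * N t) \<le> norm (w t)" using c(2)[of t] t by simp
      have k0: "0 \<le> fejer_sin n t" using fejer_sin_nonneg[of t n] t by simp
      show "0 \<le> h t" unfolding h_def using CS_nonneg(3)[OF t(1)] k0 by simp
      have "Sp t / (norm (w t))\<^sup>2 \<le> (8 * t^3 * N3p t) / (c * (t\<^sup>2 * N t))\<^sup>2"
        using CS_upper(3)[OF t(1)] CS_nonneg(3)[OF t(1)] cw pos N3p_nonneg[of t] t by (intro frac_le power_mono) auto
      also have "\<dots> = C * N3p t / (t * (N t)\<^sup>2)" using t by (simp add: C_def power_mult_distrib power_numeral_reduce)
      finally have "fejer_sin n t * (Sp t / (norm (w t))\<^sup>2) \<le> fejer_sin n t * (C * N3p t / (t * (N t)\<^sup>2))" by (rule mult_left_mono[OF _ k0])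
      thus "\<bar>h t\<bar> \<le> fejer_sin n t * (C * N3p t / (t * (N t)\<^sup>2))" using \<open>0 \<le> h t\<close> by (simp add: h_def)
    qed
    have hi: "integrable LL h"
    proof (rule Bochner_Integration.integrable_bound)
      show "integrable LL (\<lambda>t. real n ^ 3 * C * (N3 t / (N t)\<^sup>2))" by (intro integrable_mult_right dom_integrable)
      show "h \<in> borel_measurable LL" unfolding h_def[abs_def] by (rule LL_meas) measurable
      show "AE t in LL. norm (h t) \<le> norm (real n ^ 3 * C * (N3 t / (N t)\<^sup>2))"
      proof (rule AE_I2)
        fix t assume "t \<in> space LL"
        hence t: "0 < t" "t < pi" by (auto simp: space_LL)
        have "\<bar>h t\<bar> \<le> fejer_sin n t * (C * N3p t / (t * (N t)\<^sup>2))" by (rule hb[OF t])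
        also have "\<dots> \<le> (real n ^ 3 * t) * (C * N3 t / (t * (N t)\<^sup>2))"
          using fejer_sin_upper2[OF t(1), of n] fejer_sin_nonneg[of t n] N3p_le_N3[OF t(1)] N3p_nonneg[of t] C t
          by (intro mult_mono divide_right_mono mult_left_mono) auto
        also have "\<dots> = real n ^ 3 * C * (N3 t / (N t)\<^sup>2)" using t by simp
        finally have "\<bar>h t\<bar> \<le> real n ^ 3 * C * (N3 t / (N t)\<^sup>2)" .
        also have "\<dots> \<le> \<bar>real n ^ 3 * C * (N3 t / (N t)\<^sup>2)\<bar>" by (rule abs_ge_self)
        finally show "norm (h t) \<le> norm (real n ^ 3 * C * (N3 t / (N t)\<^sup>2))" unfolding real_norm_def .
      qed
    qed
    have "\<forall>t. 0 < t \<longrightarrow> t < pi \<longrightarrow> \<bar>h t\<bar> \<le> fejer_cos n t * (C * (N2p t + tail_ratio t * N2 t) / (t\<^sup>2 * (N t)\<^sup>2)) + fejer_sin n t * (C * (N3p t + tail_ratio t * N3 t) / (t * (N t)\<^sup>2))"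
    proof (intro allI impI)
      fix t assume t: "0 < t" "t < pi"
      have "Np t \<le> 1 * N t" using Np_le_N[OF t(1)] by simp
      note sm = small_numbers[OF t(1) less_imp_le[OF t(2)] this]
      have "fejer_sin n t * (C * N3p t / (t * (N t)\<^sup>2)) \<le> fejer_sin n t * (C * (N3p t + tail_ratio t * N3 t) / (t * (N t)\<^sup>2))"
        using sm C t fejer_sin_nonneg[of t n] by (intro mult_left_mono divide_right_mono) auto
      moreover have "0 \<le> fejer_cos n t * (C * (N2p t + tail_ratio t * N2 t) / (t\<^sup>2 * (N t)\<^sup>2))"
        using sm C fejer_cos_nonneg[of n t] by (intro mult_nonneg_nonneg divide_nonneg_nonneg add_nonneg_nonneg) auto
      ultimately show "\<bar>h t\<bar> \<le> fejer_cos n t * (C * (N2p t + tail_ratio t * N2 t) / (t\<^sup>2 * (N t)\<^sup>2)) + fejer_sin n t * (C * (N3p t + tail_ratio t * N3 t) / (t * (N t)\<^sup>2))"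
        using hb[OF t] by linarith
    qed
    hence hI: "\<bar>\<integral>t. h t \<partial>LL\<bar> \<le> c0 / 2 * growth n" using elim(2) hi by blast
    have totali: "integrable LL (\<lambda>t. fejer_cos n t * Re (1 / w t) + fejer_sin n t * Im (1 / w t))" by (rule right_sum_integral(1))
    have gi: "integrable LL g"
    proof -
      have "integrable LL (\<lambda>t. (fejer_cos n t * Re (1 / w t) + fejer_sin n t * Im (1 / w t)) + h t)"
        by (rule Bochner_Integration.integrable_add[OF totali hi])
      thus ?thesis by (rule Bochner_Integration.integrable_cong[OF refl, THEN iffD1, rotated]) (use gh in \<open>auto simp: space_LL\<close>)
    qed
    have g0: "0 \<le> g t" if t: "0 < t" "t < pi" for t
      unfolding g_def using fejer_cos_nonneg[of n t] fejer_sin_nonneg[of t n] CS_nonneg(4)[OF t(1)] w_upper(1)[OF t(1)] t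
      by (intro divide_nonneg_nonneg add_nonneg_nonneg mult_nonneg_nonneg) (auto simp del: minus_complex.sel)
    define g1 where "g1 = 2 * c0 * (real n ^ 4 / N \<tau>)"
    have g1: "g1 \<le> g t" if t: "\<tau> / 2 \<le> t" "t \<le> \<tau>" for t
    proof -
      have t': "0 < t" "t \<le> pi" "t \<le> \<delta>" using t \<tau> by auto
      have Nt: "N t > 0" by (rule N_pos[OF t'(1,2)])
      have n2: "1 / (2 * real n) \<le> t" "t \<le> 1 / real n" using t by (auto simp: \<tau>_def)
      note k = fejer_cos_kI_lower[OF elim(3) n2]
      have "Np t \<le> 1/2 * N t" by (rule \<delta>(3)[OF t'(1,3)])
      hence "Nm t \<ge> N t / 2" using N_split[OF t'(1)] by simp
      hence "t\<^sup>2 * (N t / 2) \<le> t\<^sup>2 * Nm t" by (intro mult_left_mono) auto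
      hence "t\<^sup>2 * N t / 8 \<le> Cm t + Sm t" using CS_lower[OF t'(1)] by linarith
      hence s: "t\<^sup>2 * N t / 8 \<le> Re (w t) + Sm t" unfolding Re_w[OF t'(1)] using CS_nonneg(1)[OF t'(1)] by linarith
      have "(real n)\<^sup>2 / 200 * (t\<^sup>2 * N t / 8) \<le> (real n)\<^sup>2 / 200 * (Re (w t) + Sm t)"
        using s by (intro mult_left_mono) auto
      also have "\<dots> = (real n)\<^sup>2 / 200 * Re (w t) + (real n)\<^sup>2 / 200 * Sm t" by (rule distrib_left)
      also have "\<dots> \<le> fejer_cos n t * Re (w t) + fejer_sin n t * Sm t"
        using k CS_nonneg(4)[OF t'(1)] w_upper(1)[OF t'(1)] by (intro add_mono mult_right_mono)
      finally have num: "(real n)\<^sup>2 / 200 * (t\<^sup>2 * N t / 8) \<le> fejer_cos n t * Re (w t) + fejer_sin n t * Sm t" .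
      have nw: "0 < norm (w t)" using w_nonzero[OF t'(1,2)] by simp
      have "(real n)\<^sup>2 / 200 * (t\<^sup>2 * N t / 8) / (8 * t\<^sup>2 * N t)\<^sup>2 \<le> g t"
        unfolding g_def using num nw w_upper(4)[OF t'(1)] t' Nt by (intro frac_le power_mono order_trans[OF _ num]) auto
      moreover have "(real n)\<^sup>2 / 200 * (t\<^sup>2 * N t / 8) / (8 * t\<^sup>2 * N t)\<^sup>2 = 2 * c0 * ((real n)\<^sup>2 / (t * (t * N t)))"
        using t' Nt by (simp add: c0_def power2_eq_square)
      moreover have "t * (t * N t) \<le> \<tau> * (\<tau> * N \<tau>)"
        by (rule mult_mono[OF t(2) reg2_mult_mono[OF Ya_int Ya_nonneg t'(1) t(2)]]) (use t' \<tau> Nt in auto)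
      hence "(real n)\<^sup>2 / (\<tau> * (\<tau> * N \<tau>)) \<le> (real n)\<^sup>2 / (t * (t * N t))"
        using t' Nt N\<tau> \<tau> by (intro divide_left_mono mult_pos_pos) auto
      hence "2 * c0 * ((real n)\<^sup>2 / (\<tau> * (\<tau> * N \<tau>))) \<le> 2 * c0 * ((real n)\<^sup>2 / (t * (t * N t)))"
        using c0 by (intro mult_left_mono) auto
      moreover have "(real n)\<^sup>2 / (\<tau> * (\<tau> * N \<tau>)) = real n ^ 4 / N \<tau>" by (simp add: \<tau>_def power_numeral_reduce)
      ultimately show ?thesis by (simp add: g1_def)
    qed
    have "g1 * (\<tau> - \<tau> / 2) = (\<integral>t. g1 * indicator {\<tau>/2..\<tau>} t \<partial>LL)"
      using \<tau> by (intro LL_indicator(1)[symmetric]) auto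
    also have "\<dots> \<le> (\<integral>t. g t \<partial>LL)"
      using g0 g1 \<tau> by (intro integral_mono gi LL_indicator(2)) (auto simp: indicator_def space_LL)
    finally have "g1 * (\<tau> / 2) \<le> (\<integral>t. g t \<partial>LL)" by simp
    moreover have "g1 * (\<tau> / 2) = c0 * growth n" using elim by (simp add: g1_def growth_def \<tau>_def power_numeral_reduce)
    moreover have "(\<integral>t. fejer_cos n t * Re (1 / w t) + fejer_sin n t * Im (1 / w t) \<partial>LL) = (\<integral>t. g t \<partial>LL) - (\<integral>t. h t \<partial>LL)"
    proof -
      have "(\<integral>t. fejer_cos n t * Re (1 / w t) + fejer_sin n t * Im (1 / w t) \<partial>LL) = (\<integral>t. g t - h t \<partial>LL)"
        by (rule Bochner_Integration.integral_cong[OF refl]) (use gh in \<open>auto simp: space_LL\<close>)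
      thus ?thesis using Bochner_Integration.integral_diff[OF gi hi] by simp
    qed
    ultimately have "c0 / 2 * growth n \<le> (\<integral>t. fejer_cos n t * Re (1 / w t) + fejer_sin n t * Im (1 / w t) \<partial>LL)" using hI by linarith
    hence "(1 / pi) * (c0 / 2 * growth n) \<le> right_sum n" unfolding right_sum_integral(2) by (intro mult_left_mono) auto
    thus ?case by simp
  qed
  moreover have "c0 / 2 / pi > 0" using c0 by simp
  ultimately show ?thesis by blast
qed

end

section \<open>Asymptotic monotonicity\<close>

text \<open>Where \<open>f\<close> vanishes so does \<open>g\<close>, and there asymptotic
  equivalence reads the quotient as 1.\<close>

lemma asymp_equiv_squeeze:
  fixes f g :: "'a \<Rightarrow> real"
  assumes "\<And>\<epsilon>. 0 < \<epsilon> \<Longrightarrow> \<epsilon> < 1 \<Longrightarrow> \<forall>\<^sub>F x in F. (1 - \<epsilon>) * f x \<le> g x"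
    and "\<And>x. g x \<le> f x" "\<And>x. 0 \<le> g x"
  shows "g \<sim>[F] f"
  unfolding asymp_equiv_def
proof (rule tendstoI)
  fix \<epsilon> :: real assume \<epsilon>: "\<epsilon> > 0"
  define \<eta> where "\<eta> = min (\<epsilon> / 2) (1/2)"
  have \<eta>: "0 < \<eta>" "\<eta> < 1" "\<eta> < \<epsilon>" using \<epsilon> by (auto simp: \<eta>_def)
  show "\<forall>\<^sub>F x in F. dist (if g x = 0 \<and> f x = 0 then 1 else g x / f x) 1 < \<epsilon>"
    using assms(1)[OF \<eta>(1,2)]
  proof eventually_elim
    case (elim x)
    show ?case
    proof (cases "f x = 0")
      case True
      thus ?thesis using assms(2,3)[of x] \<epsilon> by simp
    next
      case False
      hence f: "f x > 0" using assms(2,3)[of x] by linarith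
      have "1 - \<eta> \<le> g x / f x" "g x / f x \<le> 1" using elim assms(2)[of x] f by (auto simp: field_simps)
      thus ?thesis using \<eta> False by (simp add: dist_real_def)
    qed
  qed
qed

text \<open>The bound \<open>max x 0\<close> keeps the interval nonempty, so that the function is
  monotone on all integers.\<close>

definition running_max :: "(int \<Rightarrow> real) \<Rightarrow> int \<Rightarrow> real" where
  "running_max g x = Max (g ` {0..max x 0})"

lemma running_max_mono: "mono (running_max g)"
  unfolding mono_def running_max_def by (auto intro!: Max_mono image_mono)

lemma running_max_ge: "0 \<le> z \<Longrightarrow> z \<le> x \<Longrightarrow> g z \<le> running_max g x"
  unfolding running_max_def by (intro Max_ge) auto

lemma running_max_attained: "0 \<le> x \<Longrightarrow> \<exists>z. 0 \<le> z \<and> z \<le> x \<and> running_max g x = g z"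
proof -
  assume x: "0 \<le> x"
  have "running_max g x \<in> g ` {0..max x 0}" unfolding running_max_def by (rule Max_in) auto
  thus ?thesis using x by auto
qed

lemma running_max_nonneg: "0 \<le> running_max g x" if "\<And>x. 0 \<le> g x"
proof -
  have "g 0 \<le> running_max g x" unfolding running_max_def by (rule Max_ge[OF _ imageI]) auto
  thus ?thesis using that[of 0] by linarith
qed

lemma asymp_increasing_runmaxI:
  fixes g :: "int \<Rightarrow> real"
  assumes nn: "\<And>x. 0 \<le> g x"
    and ev: "\<And>\<epsilon>. 0 < \<epsilon> \<Longrightarrow> \<epsilon> < 1 \<Longrightarrow> \<forall>\<^sub>F x in at_top. (1 - \<epsilon>) * running_max g x \<le> g x"
  shows "asymp_increasing g"
proof -
  \<comment> \<open>The squeeze asks for domination at every integer; changing \<open>g\<close> on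
    the negative ones does not affect the asymptotics.\<close>
  define h where "h x = (if x < 0 then 0 else g x)" for x
  have eq: "\<forall>\<^sub>F x in at_top. g x = h x"
    using eventually_ge_at_top[of 0] by eventually_elim (simp add: h_def)
  have "h \<sim>[at_top] running_max g"
  proof (rule asymp_equiv_squeeze)
    fix \<epsilon> :: real assume "0 < \<epsilon>" "\<epsilon> < 1"
    from ev[OF this] eq show "\<forall>\<^sub>F x in at_top. (1 - \<epsilon>) * running_max g x \<le> h x" by eventually_elim simp
  next
    fix x
    have "0 \<le> running_max g x" by (rule running_max_nonneg[OF nn])
    thus "h x \<le> running_max g x" using running_max_ge[of x x g] by (auto simp: h_def)
    show "0 \<le> h x" using nn by (simp add: h_def)
  qed
  hence "g \<sim>[at_top] running_max g" by (rule asymp_equiv_trans[OF asymp_equiv_refl_ev[OF eq]])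
  thus ?thesis unfolding asymp_increasing_def using running_max_mono by blast
qed

text \<open>The asymptotic monotonicity is deduced from these properties alone, without further
  reference to the walk.\<close>

locale potential_like =
  fixes a :: "int \<Rightarrow> real"
  assumes a_nonneg: "0 \<le> a x"
    and a_sub: "a (x + y) \<le> a x + a y"
    and a_three: "a (- z) * (a z - a x) \<le> a z * a (x - z)"
    and a_ratio: "0 < \<epsilon> \<Longrightarrow> \<exists>z0. \<forall>z\<ge>z0. a (- z) \<le> \<epsilon> * a z"
    and a_top: "filterlim a at_top at_top"
begin

lemma increasing_right: "asymp_increasing a"
proof (rule asymp_increasing_runmaxI[OF a_nonneg])
  fix \<epsilon> :: real assume \<epsilon>: "0 < \<epsilon>" "\<epsilon> < 1"
  obtain z0 where z0: "\<And>z. z \<ge> z0 \<Longrightarrow> a (- z) \<le> \<epsilon> / 2 * a z" using a_ratio[of "\<epsilon> / 2"] \<epsilon> by auto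
  \<comment> \<open>Below \<open>z0\<close> the ratio bound may fail. The finitely many values there
    are absorbed in an additive constant, harmless because \<open>a\<close> tends to
    infinity.\<close>
  define C where "C = running_max (\<lambda>z. a (- z)) z0"
  have C: "a (- z) \<le> \<epsilon> / 2 * a z + C" if "z \<ge> 0" for z
  proof (cases "z \<ge> z0")
    case True
    have "0 \<le> C" unfolding C_def by (rule running_max_nonneg) (rule a_nonneg)
    thus ?thesis using z0[OF True] by linarith
  next
    case False
    hence "a (- z) \<le> C" unfolding C_def using that by (intro running_max_ge[of z z0 "\<lambda>z. a (- z)"]) auto
    moreover have "0 \<le> \<epsilon> / 2 * a z" using \<epsilon> a_nonneg[of z] by simp
    ultimately show ?thesis by linarith
  qed
  have "\<forall>\<^sub>F x in at_top. a x \<ge> 2 * C / \<epsilon>" using a_top by (simp add: filterlim_at_top)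
  thus "\<forall>\<^sub>F x in at_top. (1 - \<epsilon>) * running_max a x \<le> a x"
    using eventually_ge_at_top[of 0]
  proof eventually_elim
    case (elim x)
    obtain z where z: "0 \<le> z" "z \<le> x" "running_max a x = a z" using running_max_attained[OF elim(2)] by blast
    have "a z \<le> a x + a (- (x - z))" using a_sub[of x "z - x"] by simp
    also have "a (- (x - z)) \<le> \<epsilon> / 2 * a (x - z) + C" using z by (intro C) auto
    also have "a (x - z) \<le> running_max a x" using z by (intro running_max_ge) auto
    finally have 1: "running_max a x \<le> a x + (\<epsilon> / 2 * running_max a x + C)" using z(3) \<epsilon> by simp
    have "2 * C / \<epsilon> \<le> running_max a x" using elim running_max_ge[of x x a] by simp
    hence "C \<le> \<epsilon> / 2 * running_max a x" using \<epsilon> by (simp add: field_simps)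
    thus ?case using 1 by (simp add: algebra_simps)
  qed
qed

text \<open>The three point inequality with \<open>x = - t\<close>: passing from \<open>- z\<close> to \<open>- (z + t)\<close> costs at most the
  factor \<open>1 - a (- t) / a z\<close>.\<close>
lemma left_step:
  assumes "a (- t) \<le> \<epsilon> * a z" "0 < a z"
  shows "(1 - \<epsilon>) * a (- z) \<le> a (- (z + t))"
proof -
  have "a (- z) * (\<epsilon> * a z) \<ge> a (- z) * a (- t)" using assms a_nonneg by (intro mult_left_mono)
  moreover have "a (- z) * (a z - a (- t)) \<le> a z * a (- (z + t))" using a_three[of z "- t"] by (simp add: add.commute)
  ultimately have "a z * ((1 - \<epsilon>) * a (- z)) \<le> a z * a (- (z + t))" by (simp add: algebra_simps)
  thus ?thesis using assms(2) by simp
qed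

text \<open>\<open>left_step\<close> needs \<open>a (- t)\<close> small compared with
  \<open>a z\<close>. If the left values are bounded, this holds for all \<open>t\<close> once
  \<open>z\<close> is large, but the maximiser of a running maximum could stay among small
  \<open>z\<close>; hence a tail infimum in that case. If they are unbounded, the maximiser is
  eventually large.\<close>

lemma increasing_left: "asymp_increasing (\<lambda>x. a (- x))"
proof (cases "\<exists>B. \<forall>x\<ge>0. a (- x) \<le> B")
  case True
  then obtain B where B: "\<And>x. x \<ge> 0 \<Longrightarrow> a (- x) \<le> B" by blast
  define f where "f x = (INF y\<in>{max x 0..}. a (- y))" for x
  have bb: "bdd_below ((\<lambda>y. a (- y)) ` A)" for A using a_nonneg by (intro bdd_belowI2[of _ 0]) auto
  have "mono f"
  proof (rule monoI)
    fix x y :: int assume "x \<le> y"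
    thus "f x \<le> f y" unfolding f_def by (intro cINF_superset_mono bb) auto
  qed
  define h where "h x = (if x < 0 then f x else a (- x))" for x
  have "f \<sim>[at_top] h"
  proof (rule asymp_equiv_squeeze)
    fix \<epsilon> :: real assume \<epsilon>: "0 < \<epsilon>" "\<epsilon> < 1"
    have "\<forall>\<^sub>F x in at_top. a x \<ge> \<bar>B\<bar> / \<epsilon> + 1" using a_top by (simp add: filterlim_at_top)
    thus "\<forall>\<^sub>F x in at_top. (1 - \<epsilon>) * h x \<le> f x"
      using eventually_ge_at_top[of 0]
    proof eventually_elim
      case (elim x)
      have ax: "0 < a x" using elim(1) \<epsilon> by (intro less_le_trans[OF _ elim(1)]) (simp add: add_nonneg_pos)
      have "\<bar>B\<bar> / \<epsilon> \<le> a x" using elim(1) by simp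
      hence bx: "B \<le> \<epsilon> * a x" using \<epsilon> by (simp add: field_simps abs_le_iff)
      have "(1 - \<epsilon>) * a (- x) \<le> f x"
        unfolding f_def
      proof (rule cINF_greatest)
        fix y assume "y \<in> {max x 0..}"
        hence y: "x \<le> y" by simp
        have "a (- (y - x)) \<le> \<epsilon> * a x" using B[of "y - x"] y bx by simp
        from left_step[OF this ax] show "(1 - \<epsilon>) * a (- x) \<le> a (- y)" by simp
      qed auto
      thus ?case using elim by (simp add: h_def)
    qed
  next
    fix x
    show "f x \<le> h x" unfolding h_def f_def by (auto intro!: cINF_lower[OF bb])
    show "0 \<le> f x" unfolding f_def using a_nonneg by (intro cINF_greatest) auto
  qed
  hence hf: "h \<sim>[at_top] f" by (rule asymp_equiv_symI)
  have eq: "\<forall>\<^sub>F x in at_top. a (- x) = h x" using eventually_ge_at_top[of 0] by eventually_elim (simp add: h_def)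
  have "(\<lambda>x. a (- x)) \<sim>[at_top] f" by (rule asymp_equiv_trans[OF asymp_equiv_refl_ev[OF eq] hf])
  thus ?thesis unfolding asymp_increasing_def using \<open>mono f\<close> by blast
next
  case False
  hence unb: "\<exists>x\<ge>0. B < a (- x)" for B by (meson not_le)
  show ?thesis
  proof (rule asymp_increasing_runmaxI[OF a_nonneg])
    fix \<epsilon> :: real assume \<epsilon>: "0 < \<epsilon>" "\<epsilon> < 1"
    let ?m = "running_max (\<lambda>x. a (- x))"
    obtain z0 where z0: "\<And>z. z \<ge> z0 \<Longrightarrow> a (- z) \<le> \<epsilon> * a z" using a_ratio[of \<epsilon>] \<epsilon> by auto
    \<comment> \<open>Once the running maximum exceeds \<open>C\<close>, its maximiser lies beyond
      \<open>z0\<close>. There \<open>a (- (x - z)) \<le> a (- z) \<le> \<epsilon> * a z\<close>,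
      the first by maximality, which is the premise of \<open>left_step\<close>.\<close>
    define C where "C = ?m z0"
    have C0: "0 \<le> C" unfolding C_def by (rule running_max_nonneg) (rule a_nonneg)
    obtain y0 where y0: "y0 \<ge> 0" "C < a (- y0)" using unb by blast
    show "\<forall>\<^sub>F x in at_top. (1 - \<epsilon>) * ?m x \<le> a (- x)"
      using eventually_ge_at_top[of y0]
    proof eventually_elim
      case (elim x)
      have x: "x \<ge> 0" using elim y0 by simp
      obtain z where z: "0 \<le> z" "z \<le> x" "?m x = a (- z)" using running_max_attained[OF x] by blast
      have "a (- y0) \<le> ?m x" using running_max_ge[of y0 x "\<lambda>x. a (- x)"] y0 elim by simp
      hence big: "C < a (- z)" using y0 z by simp
      have "z0 \<le> z"
      proof (rule ccontr)
        assume "\<not> z0 \<le> z"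
        hence "a (- z) \<le> C" unfolding C_def using z by (intro running_max_ge[of z z0 "\<lambda>x. a (- x)"]) auto
        thus False using big by simp
      qed
      hence az: "a (- z) \<le> \<epsilon> * a z" by (rule z0)
      hence "0 < \<epsilon> * a z" using big C0 by linarith
      hence "0 < a z" using \<epsilon> by (simp add: zero_less_mult_iff)
      moreover have "a (- (x - z)) \<le> a (- z)" using running_max_ge[of "x - z" x "\<lambda>x. a (- x)"] z by simp
      hence "a (- (x - z)) \<le> \<epsilon> * a z" using az by simp
      ultimately have "(1 - \<epsilon>) * a (- z) \<le> a (- (z + (x - z)))" by (intro left_step)
      thus ?case using z by simp
    qed
  qed
qed

end

section \<open>From weighted sums to single values of the potential function\<close>

context step
begin

lemma growth_double: "growth (2 * n) \<le> 8 * growth n" if "n \<ge> 1"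
proof -
  have n: "real n \<ge> 1" using that by simp
  have 1: "0 < 1 / (2 * real n)" "1 / (2 * real n) \<le> 1 / real n" using n by (auto simp: field_simps)
  have "1 / real n \<le> 1" using n by simp
  hence "1 / real n \<le> pi" using pi_gt3 by linarith
  hence "N (1 / real n) > 0" using n by (intro N_pos) auto
  moreover have "N (1 / real n) \<le> N (1 / (2 * real n))" by (rule reg2_antimono[OF Ya_int Ya_nonneg 1])
  ultimately have "(2 * real n)^3 / N (1 / (2 * real n)) \<le> (2 * real n)^3 / N (1 / real n)"
    using n by (intro divide_left_mono mult_pos_pos) auto
  thus ?thesis by (simp add: growth_def power_mult_distrib)
qed

text \<open>Doubling the length makes every weight on the first half at least \<open>z\<close>, so
  the weighted sum controls the plain one.\<close>

lemma left_sum_le: "real z * (\<Sum>y<z. pot (- int y)) \<le> left_sum (2 * z)"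
proof -
  have "real z * (\<Sum>y<z. pot (- int y)) = (\<Sum>y<z. real z * pot (- int y))" by (rule sum_distrib_left)
  also have "\<dots> \<le> (\<Sum>y<z. (real (2 * z) - real y) * pot (- int y))"
    using pot_nonneg by (intro sum_mono mult_right_mono) auto
  also have "\<dots> \<le> left_sum (2 * z)" unfolding left_sum_def using pot_nonneg by (intro sum_mono2) auto
  finally show ?thesis .
qed

lemma sum_reflect: "(\<Sum>y<z. g (z - y)) = (\<Sum>y<z. g (Suc y))" for g :: "nat \<Rightarrow> real"
  by (rule sum.reindex_bij_witness[of _ "\<lambda>y. z - Suc y" "\<lambda>y. z - Suc y"]) (auto simp: Suc_diff_Suc)

lemma left_reflected_sum: "(\<Sum>y<z. pot (- int (z - y))) = (\<Sum>y<z. pot (- int y)) + pot (- int z)"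
proof -
  have "(\<Sum>y<z. pot (- int (z - y))) = (\<Sum>y<z. pot (- int (Suc y)))" by (rule sum_reflect)
  also have "\<dots> = (\<Sum>y<Suc z. pot (- int y)) - pot (- int 0)" by (subst sum.lessThan_Suc_shift) simp
  finally show ?thesis by (simp add: pot_0)
qed

text \<open>Average \<open>pot (- z) \<le> pot (- y) + pot (- (z - y))\<close> over
  \<open>y < z\<close>; both terms on the right run through essentially the same values.\<close>

lemma left_pointwise: "(real z - 1) * pot (- int z) \<le> 2 * (\<Sum>y<z. pot (- int y))"
proof -
  have "real z * pot (- int z) = (\<Sum>y<z. pot (- int z))" by simp
  also have "\<dots> \<le> (\<Sum>y<z. pot (- int y) + pot (- int (z - y)))"
  proof (rule sum_mono)
    fix y assume "y \<in> {..<z}"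
    thus "pot (- int z) \<le> pot (- int y) + pot (- int (z - y))" using pot_subadditive[of "- int y" "- int (z - y)"] by simp
  qed
  also have "\<dots> = 2 * (\<Sum>y<z. pot (- int y)) + pot (- int z)" unfolding sum.distrib left_reflected_sum by simp
  finally show ?thesis by (simp add: algebra_simps)
qed

text \<open>Average \<open>pot y \<le> pot z + pot (- (z - y))\<close>, with weights at most
  \<open>z\<close>: a large weighted sum on the right and a small sum on the left force
  \<open>pot z\<close> to be large.\<close>

lemma right_pointwise: "right_sum z \<le> (real z)\<^sup>2 * pot (int z) + real z * ((\<Sum>y<z. pot (- int y)) + pot (- int z))"
proof -
  have "right_sum z \<le> (\<Sum>y<z. real z * (pot (int z) + pot (- int (z - y))))"
    unfolding right_sum_def
  proof (intro sum_mono mult_mono)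
    fix y assume y: "y \<in> {..<z}"
    thus "pot (int y) \<le> pot (int z) + pot (- int (z - y))" using pot_subadditive[of "int z" "- int (z - y)"] by simp
  qed (use pot_nonneg in auto)
  also have "\<dots> = real z * (real z * pot (int z) + (\<Sum>y<z. pot (- int (z - y))))"
    by (simp add: sum_distrib_left[symmetric] sum.distrib)
  finally show ?thesis unfolding left_reflected_sum by (simp add: power2_eq_square algebra_simps)
qed

lemma pot_estimates:
  obtains c where "c > 0" "\<forall>\<^sub>F z in sequentially. c * growth z \<le> (real z)\<^sup>2 * pot (int z)"
    "\<And>\<epsilon>. \<epsilon> > 0 \<Longrightarrow> \<forall>\<^sub>F z in sequentially. pot (- int z) \<le> \<epsilon> * pot (int z)"
proof -
  obtain c where c: "c > 0" "\<forall>\<^sub>F z in sequentially. c * growth z \<le> right_sum z" using right_sum_large by auto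
  \<comment> \<open>The 32 is \<open>8\<close> from doubling \<open>growth\<close>, times 4 from
    \<open>left_pointwise\<close> with \<open>z - 1 \<ge> z / 2\<close>. Then
    \<open>40 = 8 + 32\<close>, and \<open>c / 80\<close> keeps \<open>40 * \<epsilon>\<close> below
    \<open>c / 2\<close>.\<close>
  have main: "\<forall>\<^sub>F z in sequentially. (real z)\<^sup>2 * pot (- int z) \<le> 32 * \<epsilon> * growth z \<and> c / 2 * growth z \<le> (real z)\<^sup>2 * pot (int z)"
    if \<epsilon>: "0 < \<epsilon>" "\<epsilon> \<le> c / 80" for \<epsilon>
  proof -
    have "\<forall>\<^sub>F z in sequentially. left_sum (2 * z) \<le> \<epsilon> * growth (2 * z)"
      using eventually_compose_filterlim[OF left_sum_small[OF \<epsilon>(1)], of "\<lambda>z. 2 * z" sequentially]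
      by (simp add: filterlim_subseq strict_mono_def)
    thus ?thesis using c(2) eventually_ge_at_top[of 2]
    proof eventually_elim
      case (elim z)
      define S where "S = (\<Sum>y<z. pot (- int y))"
      have z: "real z \<ge> 2" using elim by simp
      have "growth (2 * z) \<le> 8 * growth z" by (rule growth_double) (use elim in simp)
      hence "\<epsilon> * growth (2 * z) \<le> \<epsilon> * (8 * growth z)" using \<epsilon> by (intro mult_left_mono) auto
      hence zS: "real z * S \<le> 8 * \<epsilon> * growth z" using left_sum_le[of z] elim by (simp add: S_def)
      have "real z * (real z / 2) * pot (- int z) \<le> real z * (real z - 1) * pot (- int z)"
        using z pot_nonneg by (intro mult_right_mono mult_left_mono) auto
      also have "\<dots> \<le> real z * (2 * S)"
        using left_pointwise[of z] z unfolding mult.assoc S_def by (intro mult_left_mono) auto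
      finally have 1: "(real z)\<^sup>2 * pot (- int z) \<le> 32 * \<epsilon> * growth z" using zS by (simp add: power2_eq_square algebra_simps)
      have "real z * pot (- int z) \<le> (real z)\<^sup>2 * pot (- int z)"
        using z pot_nonneg power_increasing[of 1 2 "real z"] by (intro mult_right_mono) auto
      hence "c * growth z \<le> (real z)\<^sup>2 * pot (int z) + 40 * \<epsilon> * growth z"
        using right_pointwise[of z] elim zS 1 by (simp add: S_def[symmetric] distrib_left)
      moreover have "growth z \<ge> 0" unfolding growth_def using N_nonneg[of "1 / real z"] by simp
      hence "40 * \<epsilon> * growth z \<le> c / 2 * growth z" using \<epsilon> by (intro mult_right_mono) auto
      ultimately show ?case using 1 by (simp add: field_simps)
    qed
  qed
  show ?thesis
  proof (rule that[of "c / 2"])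
    show "c / 2 > 0" using c by simp
    show "\<forall>\<^sub>F z in sequentially. c / 2 * growth z \<le> (real z)\<^sup>2 * pot (int z)"
      using main[of "c / 80"] c(1) by (auto elim: eventually_mono)
    fix \<epsilon> :: real assume \<epsilon>: "\<epsilon> > 0"
    define \<eta> where "\<eta> = min (c / 80) (c * \<epsilon> / 64)"
    have \<eta>: "0 < \<eta>" "\<eta> \<le> c / 80" "64 * \<eta> \<le> c * \<epsilon>" using c \<epsilon> by (auto simp: \<eta>_def)
    show "\<forall>\<^sub>F z in sequentially. pot (- int z) \<le> \<epsilon> * pot (int z)"
      using main[OF \<eta>(1,2)] eventually_ge_at_top[of 1]
    proof eventually_elim
      case (elim z)
      have "growth z \<ge> 0" unfolding growth_def using N_nonneg[of "1 / real z"] by simp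
      hence "64 * \<eta> * growth z \<le> c * \<epsilon> * growth z" using \<eta> by (intro mult_right_mono)
      moreover have "\<epsilon> * (c / 2 * growth z) \<le> \<epsilon> * ((real z)\<^sup>2 * pot (int z))" using elim \<epsilon> by (intro mult_left_mono) auto
      ultimately have "(real z)\<^sup>2 * pot (- int z) \<le> (real z)\<^sup>2 * (\<epsilon> * pot (int z))"
      proof -
        have "\<epsilon> * (c / 2 * growth z) = c * \<epsilon> * growth z / 2" by simp
        moreover have "\<epsilon> * ((real z)\<^sup>2 * pot (int z)) = (real z)\<^sup>2 * (\<epsilon> * pot (int z))" by (rule mult.left_commute)
        ultimately show ?thesis using conjunct1[OF elim(1)]
          \<open>64 * \<eta> * growth z \<le> c * \<epsilon> * growth z\<close> \<open>\<epsilon> * (c / 2 * growth z) \<le> \<epsilon> * ((real z)\<^sup>2 * pot (int z))\<close> by linarith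
      qed
      moreover have "0 < (real z)\<^sup>2" using elim by simp
      ultimately show ?case by (simp only: mult_le_cancel_left_pos)
    qed
  qed
qed

lemma eventually_int_of_nat: "(\<forall>\<^sub>F z in sequentially. P (int z)) \<Longrightarrow> \<forall>\<^sub>F z in at_top. P z"
proof -
  assume "\<forall>\<^sub>F z in sequentially. P (int z)"
  then obtain n0 where n0: "\<And>n. n \<ge> n0 \<Longrightarrow> P (int n)" by (auto simp: eventually_sequentially)
  have "P z" if "z \<ge> int n0" for z using n0[of "nat z"] that by (simp add: le_nat_iff)
  thus ?thesis unfolding eventually_at_top_linorder by blast
qed

lemma potential_like_pot: "potential_like pot"
proof
  obtain c where c: "c > 0" "\<forall>\<^sub>F z in sequentially. c * growth z \<le> (real z)\<^sup>2 * pot (int z)"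
    "\<And>\<epsilon>. \<epsilon> > 0 \<Longrightarrow> \<forall>\<^sub>F z in sequentially. pot (- int z) \<le> \<epsilon> * pot (int z)" using pot_estimates by blast
  show "\<exists>z0. \<forall>z\<ge>z0. pot (- z) \<le> \<epsilon> * pot z" if "0 < \<epsilon>" for \<epsilon>
    using eventually_int_of_nat[of "\<lambda>z. pot (- z) \<le> \<epsilon> * pot z"] c(3)[OF that] by (simp add: eventually_at_top_linorder)
  show "filterlim pot at_top at_top"
    unfolding filterlim_at_top
  proof
    fix B
    have "\<forall>\<^sub>F z in sequentially. B \<le> pot (int z)"
      using c(2) growth_growth[OF c(1), of B] eventually_ge_at_top[of 1]
    proof eventually_elim
      case (elim z)
      moreover have "(real z)\<^sup>2 * B = B * (real z)\<^sup>2" by (rule mult.commute)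
      ultimately have "(real z)\<^sup>2 * B \<le> (real z)\<^sup>2 * pot (int z)" by linarith
      moreover have "0 < (real z)\<^sup>2" using elim by simp
      ultimately show ?case by (simp only: mult_le_cancel_left_pos)
    qed
    thus "\<forall>\<^sub>F z in at_top. B \<le> pot z" by (rule eventually_int_of_nat)
  qed
qed (rule pot_nonneg pot_subadditive pot_three_points)+

end

section \<open>The truncated second moments as integrated tails\<close>

text \<open>The integral of \<open>max 0 (y - s)\<close> over \<open>s\<close> in
  \<open>{0..x}\<close> for \<open>x, y \<ge> 0\<close>; the Huber function with threshold
  \<open>x\<close>. Its mean at the positive part of the step is \<open>m_plus\<close>.\<close>

definition huber :: "real \<Rightarrow> real \<Rightarrow> real" where
  "huber x y = y * min y x - (min y x)\<^sup>2 / 2"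

lemma huber_nonneg: "0 \<le> huber x y" if "0 \<le> x" "0 \<le> y"
proof -
  have m: "0 \<le> min y x" "min y x \<le> y" using that by auto
  have "min y x * min y x \<le> y * min y x" using m by (intro mult_right_mono)
  moreover have "0 \<le> min y x * min y x" using m by simp
  ultimately show ?thesis unfolding huber_def power2_eq_square by linarith
qed

text \<open>Both functions are comparable to \<open>y * min x y\<close>, quadratic below
  \<open>x\<close> and linear above.\<close>

lemma huber_bounds:
  assumes "0 < x" "0 \<le> y"
  shows "y\<^sup>2 / (1 + inverse x * y) \<le> 2 * huber x y" "huber x y \<le> 2 * (y\<^sup>2 / (1 + inverse x * y))"
proof -
  define q where "q = y\<^sup>2 / (1 + inverse x * y)"
  have den: "1 + inverse x * y > 0" using assms by (simp add: add_pos_nonneg)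
  have qx: "q = x * y\<^sup>2 / (x + y)" using assms den unfolding q_def by (simp add: field_simps)
  have xy: "x + y > 0" using assms by simp
  have y2: "0 \<le> y\<^sup>2" by simp
  have "q \<le> 2 * huber x y \<and> huber x y \<le> 2 * q"
  proof (cases "y \<le> x")
    case True
    hence h: "huber x y = y\<^sup>2 / 2" by (simp add: huber_def power2_eq_square)
    have "x * y\<^sup>2 \<le> y\<^sup>2 * (x + y)" using assms by (simp add: algebra_simps)
    hence 1: "q \<le> y\<^sup>2" unfolding qx using xy by (simp add: pos_divide_le_eq)
    have "y\<^sup>2 * (x + y) \<le> y\<^sup>2 * (2 * x)" using True y2 by (intro mult_left_mono) auto
    hence "y\<^sup>2 / 2 \<le> q" unfolding qx using xy by (simp add: pos_le_divide_eq algebra_simps)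
    thus ?thesis using 1 h y2 by simp
  next
    case False
    hence h: "huber x y = x * y - x\<^sup>2 / 2" by (simp add: huber_def)
    have "x * x \<le> x * y" using False assms by (intro mult_left_mono) auto
    hence h2: "x * y / 2 \<le> huber x y" "huber x y \<le> x * y" unfolding h power2_eq_square using assms by auto
    have "x * y\<^sup>2 \<le> x * y * (x + y)" using assms by (simp add: algebra_simps power2_eq_square)
    hence 1: "q \<le> x * y" unfolding qx using xy by (simp add: pos_divide_le_eq)
    have "x * y * (x + y) \<le> x * y * (2 * y)" using False assms by (intro mult_left_mono) auto
    hence "x * y / 2 \<le> q" unfolding qx using xy by (simp add: pos_le_divide_eq power2_eq_square algebra_simps)
    thus ?thesis using 1 h2 by linarith
  qed
  thus "y\<^sup>2 / (1 + inverse x * y) \<le> 2 * huber x y" "huber x y \<le> 2 * (y\<^sup>2 / (1 + inverse x * y))"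
    by (auto simp: q_def)
qed

lemma m_minus_eq_m_plus: "m_minus M Y = m_plus M (\<lambda>\<omega>. - Y \<omega>)"
proof -
  have "mu_minus M Y = mu_plus M (\<lambda>\<omega>. - Y \<omega>)"
    unfolding mu_minus_def mu_plus_def by (intro ext arg_cong[where f="measure M"]) auto
  hence "eta_minus M Y = eta_plus M (\<lambda>\<omega>. - Y \<omega>)" unfolding eta_minus_def eta_plus_def by (intro ext) simp
  thus ?thesis unfolding m_minus_def m_plus_def by (intro ext) simp
qed

context prob_space
begin

lemma lborel_pair: "pair_sigma_finite M (lborel :: real measure)"
  by (intro pair_sigma_finite.intro sigma_finite_measure_axioms lborel.sigma_finite_measure_axioms)

context
  fixes Y :: "'a \<Rightarrow> int"
  assumes Y_meas [measurable]: "Y \<in> measurable M (count_space UNIV)"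
    and Y_int: "integrable M (\<lambda>\<omega>. real_of_int (Y \<omega>))"
begin

lemma Y_real_meas [measurable]: "(\<lambda>\<omega>. real_of_int (Y \<omega>)) \<in> borel_measurable M" using Y_int by auto

text \<open>Tonelli, carried out for nonnegative extended integrals and transferred to real ones at
  the end; \<open>mu_plus\<close> is measurable because it is monotone.\<close>

lemma eta_plus_eq: "eta_plus M Y x = expectation (\<lambda>\<omega>. max 0 (real_of_int (Y \<omega>) - x))"
proof -
  let ?f = "\<lambda>\<omega> y. indicator {x..} y * indicator {y<..} (real_of_int (Y \<omega>)) :: ennreal"
  interpret P: pair_sigma_finite M "lborel :: real measure" by (rule lborel_pair)
  have mu: "ennreal (mu_plus M Y y) = (\<integral>\<^sup>+\<omega>. indicator {y<..} (real_of_int (Y \<omega>)) \<partial>M)" for y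
  proof -
    have "{\<omega> \<in> space M. real_of_int (Y \<omega>) > y} \<in> events" by measurable
    hence "emeasure M {\<omega> \<in> space M. real_of_int (Y \<omega>) > y} = (\<integral>\<^sup>+\<omega>. indicator {\<omega> \<in> space M. real_of_int (Y \<omega>) > y} \<omega> \<partial>M)"
      by simp
    also have "\<dots> = (\<integral>\<^sup>+\<omega>. indicator {y<..} (real_of_int (Y \<omega>)) \<partial>M)"
      by (rule nn_integral_cong) (auto simp: indicator_def)
    finally show ?thesis by (simp add: mu_plus_def emeasure_eq_measure)
  qed
  have m: "case_prod ?f \<in> borel_measurable (M \<Otimes>\<^sub>M lborel)"
  proof -
    have "case_prod ?f = (\<lambda>p. if x \<le> snd p \<and> snd p < real_of_int (Y (fst p)) then 1 else 0)"
      by (auto simp: indicator_def fun_eq_iff)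
    also have "\<dots> \<in> borel_measurable (M \<Otimes>\<^sub>M lborel)" by measurable
    finally show ?thesis .
  qed
  have mum: "mu_plus M Y \<in> borel_measurable borel"
  proof -
    have "antimono (mu_plus M Y)" unfolding antimono_def mu_plus_def by (auto intro!: finite_measure_mono)
    hence "mono (\<lambda>y. - mu_plus M Y y)" by (auto simp: mono_def antimono_def)
    from borel_measurable_uminus[OF borel_measurable_mono[OF this]] show ?thesis by simp
  qed
  have "(\<integral>\<^sup>+y. ennreal (indicator {x..} y * mu_plus M Y y) \<partial>lborel) = (\<integral>\<^sup>+y. (\<integral>\<^sup>+\<omega>. ?f \<omega> y \<partial>M) \<partial>lborel)"
  proof (rule nn_integral_cong)
    fix y :: real
    have "ennreal (indicator {x..} y * mu_plus M Y y) = indicator {x..} y * ennreal (mu_plus M Y y)"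
      by (auto simp: indicator_def)
    also have "\<dots> = (\<integral>\<^sup>+\<omega>. ?f \<omega> y \<partial>M)" unfolding mu by (intro nn_integral_cmult[symmetric]) measurable
    finally show "ennreal (indicator {x..} y * mu_plus M Y y) = (\<integral>\<^sup>+\<omega>. ?f \<omega> y \<partial>M)" .
  qed
  also have "\<dots> = (\<integral>\<^sup>+\<omega>. (\<integral>\<^sup>+y. ?f \<omega> y \<partial>lborel) \<partial>M)" by (rule P.Fubini'[OF m])
  also have "\<dots> = (\<integral>\<^sup>+\<omega>. ennreal (max 0 (real_of_int (Y \<omega>) - x)) \<partial>M)"
  proof (rule nn_integral_cong)
    fix \<omega>
    have "(\<integral>\<^sup>+y. ?f \<omega> y \<partial>lborel) = (\<integral>\<^sup>+y. indicator {x..<real_of_int (Y \<omega>)} y \<partial>lborel)"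
      by (rule nn_integral_cong) (auto simp: indicator_def)
    also have "\<dots> = emeasure lborel {x..<real_of_int (Y \<omega>)}" by simp
    also have "\<dots> = ennreal (max 0 (real_of_int (Y \<omega>) - x))"
      by (cases "x \<le> real_of_int (Y \<omega>)") (auto simp: max_def)
    finally show "(\<integral>\<^sup>+y. ?f \<omega> y \<partial>lborel) = ennreal (max 0 (real_of_int (Y \<omega>) - x))" .
  qed
  also have "\<dots> = ennreal (expectation (\<lambda>\<omega>. max 0 (real_of_int (Y \<omega>) - x)))"
    using Y_int by (intro nn_integral_eq_integral) auto
  finally have "(\<integral>\<^sup>+y. ennreal (indicator {x..} y * mu_plus M Y y) \<partial>lborel) = ennreal (expectation (\<lambda>\<omega>. max 0 (real_of_int (Y \<omega>) - x)))" .
  moreover have "eta_plus M Y x = enn2real (\<integral>\<^sup>+y. ennreal (indicator {x..} y * mu_plus M Y y) \<partial>lborel)"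
    unfolding eta_plus_def set_lebesgue_integral_def real_scaleR_def using mum
    by (intro integral_eq_nn_integral) (auto simp: mu_plus_def)
  moreover have "0 \<le> expectation (\<lambda>\<omega>. max 0 (real_of_int (Y \<omega>) - x))" by (rule integral_nonneg_AE) simp
  ultimately show ?thesis by simp
qed

lemma nn_integral_huber:
  assumes "0 \<le> x"
  shows "(\<integral>\<^sup>+s. indicator {0..x} s * ennreal (max 0 (z - s)) \<partial>lborel) = ennreal (huber x (max 0 z))"
proof -
  define u where "u = min (max 0 z) x"
  have u: "0 \<le> u" using assms by (simp add: u_def)
  have "(\<integral>\<^sup>+s. indicator {0..x} s * ennreal (max 0 (z - s)) \<partial>lborel) = (\<integral>\<^sup>+s. ennreal (max 0 z - s) * indicator {0..u} s \<partial>lborel)"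
    by (rule nn_integral_cong) (auto simp: indicator_def u_def max_def min_def split: if_splits)
  also have "\<dots> = ennreal ((max 0 z * u - u\<^sup>2 / 2) - (max 0 z * 0 - 0\<^sup>2 / 2))"
  proof (rule nn_integral_FTC_Icc)
    show "(\<lambda>s. max 0 z - s) \<in> borel_measurable borel" by measurable
    show "((\<lambda>s. max 0 z * s - s\<^sup>2 / 2) has_real_derivative (max 0 z - s)) (at s)" for s
      by (auto intro!: derivative_eq_intros)
    show "0 \<le> max 0 z - s" if "s \<in> {0..u}" for s using that by (auto simp: u_def)
    show "0 \<le> u" by (rule u)
  qed
  finally show ?thesis by (simp add: huber_def u_def)
qed

lemma m_plus_eq:
  assumes x: "0 \<le> x"
  shows "m_plus M Y x = expectation (\<lambda>\<omega>. huber x (max 0 (real_of_int (Y \<omega>))))"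
proof -
  let ?f = "\<lambda>\<omega> s. indicator {0..x} s * ennreal (max 0 (real_of_int (Y \<omega>) - s))"
  interpret P: pair_sigma_finite M "lborel :: real measure" by (rule lborel_pair)
  have m: "case_prod ?f \<in> borel_measurable (M \<Otimes>\<^sub>M lborel)" by measurable
  have etam: "eta_plus M Y \<in> borel_measurable borel"
    unfolding eta_plus_eq[abs_def] by measurable
  have eta0: "0 \<le> eta_plus M Y s" for s unfolding eta_plus_eq by (rule integral_nonneg_AE) simp
  have "(\<integral>\<^sup>+s. ennreal (indicator {0..x} s * eta_plus M Y s) \<partial>lborel) = (\<integral>\<^sup>+s. (\<integral>\<^sup>+\<omega>. ?f \<omega> s \<partial>M) \<partial>lborel)"
  proof (rule nn_integral_cong)
    fix s :: real
    have "ennreal (indicator {0..x} s * eta_plus M Y s) = indicator {0..x} s * ennreal (eta_plus M Y s)"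
      by (auto simp: indicator_def)
    also have "ennreal (eta_plus M Y s) = (\<integral>\<^sup>+\<omega>. ennreal (max 0 (real_of_int (Y \<omega>) - s)) \<partial>M)"
      unfolding eta_plus_eq using Y_int by (intro nn_integral_eq_integral[symmetric]) auto
    also have "indicator {0..x} s * \<dots> = (\<integral>\<^sup>+\<omega>. ?f \<omega> s \<partial>M)" by (intro nn_integral_cmult[symmetric]) measurable
    finally show "ennreal (indicator {0..x} s * eta_plus M Y s) = (\<integral>\<^sup>+\<omega>. ?f \<omega> s \<partial>M)" .
  qed
  also have "\<dots> = (\<integral>\<^sup>+\<omega>. (\<integral>\<^sup>+s. ?f \<omega> s \<partial>lborel) \<partial>M)" by (rule P.Fubini'[OF m])
  also have "\<dots> = (\<integral>\<^sup>+\<omega>. ennreal (huber x (max 0 (real_of_int (Y \<omega>)))) \<partial>M)"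
    unfolding nn_integral_huber[OF x] ..
  finally have "(\<integral>\<^sup>+s. ennreal (indicator {0..x} s * eta_plus M Y s) \<partial>lborel) = (\<integral>\<^sup>+\<omega>. ennreal (huber x (max 0 (real_of_int (Y \<omega>)))) \<partial>M)" .
  moreover have "m_plus M Y x = enn2real (\<integral>\<^sup>+s. ennreal (indicator {0..x} s * eta_plus M Y s) \<partial>lborel)"
    unfolding m_plus_def set_lebesgue_integral_def real_scaleR_def using etam eta0
    by (intro integral_eq_nn_integral) auto
  moreover have "expectation (\<lambda>\<omega>. huber x (max 0 (real_of_int (Y \<omega>)))) = enn2real (\<integral>\<^sup>+\<omega>. ennreal (huber x (max 0 (real_of_int (Y \<omega>)))) \<partial>M)"
    using huber_nonneg[OF x] unfolding huber_def by (intro integral_eq_nn_integral) auto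
  ultimately show ?thesis by simp
qed

lemma m_plus_reg2_bounds:
  assumes x: "0 < x"
  shows "reg2 M (\<lambda>\<omega>. max 0 (real_of_int (Y \<omega>))) (inverse x) \<le> 2 * m_plus M Y x"
    "m_plus M Y x \<le> 2 * reg2 M (\<lambda>\<omega>. max 0 (real_of_int (Y \<omega>))) (inverse x)"
proof -
  let ?Z = "\<lambda>\<omega>. max 0 (real_of_int (Y \<omega>))"
  have i1: "integrable M (\<lambda>\<omega>. (?Z \<omega>)\<^sup>2 / (1 + inverse x * ?Z \<omega>))"
    by (rule integrable_frac2) (use Y_int x in auto)
  have i2: "integrable M (\<lambda>\<omega>. huber x (?Z \<omega>))"
  proof (rule Bochner_Integration.integrable_bound[OF integrable_mult_right[OF i1, of 2]])
    show "(\<lambda>\<omega>. huber x (?Z \<omega>)) \<in> borel_measurable M" unfolding huber_def by measurable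
    show "AE \<omega> in M. norm (huber x (?Z \<omega>)) \<le> norm (2 * ((?Z \<omega>)\<^sup>2 / (1 + inverse x * ?Z \<omega>)))"
    proof (rule AE_I2)
      fix \<omega>
      have "\<bar>huber x (?Z \<omega>)\<bar> \<le> 2 * ((?Z \<omega>)\<^sup>2 / (1 + inverse x * ?Z \<omega>))"
        using huber_bounds(2)[OF x, of "?Z \<omega>"] huber_nonneg[of x "?Z \<omega>"] x by simp
      thus "norm (huber x (?Z \<omega>)) \<le> norm (2 * ((?Z \<omega>)\<^sup>2 / (1 + inverse x * ?Z \<omega>)))" unfolding real_norm_def by linarith
    qed
  qed
  have "reg2 M ?Z (inverse x) \<le> expectation (\<lambda>\<omega>. 2 * huber x (?Z \<omega>))"
    unfolding reg2_def using huber_bounds(1)[OF x] by (intro integral_mono i1 integrable_mult_right i2) auto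
  thus "reg2 M ?Z (inverse x) \<le> 2 * m_plus M Y x" using m_plus_eq[of x] x by simp
  have "expectation (\<lambda>\<omega>. huber x (?Z \<omega>)) \<le> expectation (\<lambda>\<omega>. 2 * ((?Z \<omega>)\<^sup>2 / (1 + inverse x * ?Z \<omega>)))"
    using huber_bounds(2)[OF x] by (intro integral_mono i1 integrable_mult_right i2) auto
  thus "m_plus M Y x \<le> 2 * reg2 M ?Z (inverse x)" unfolding reg2_def integral_mult_right_zero using m_plus_eq[of x] x by simp
qed

end

text \<open>At \<open>x = 1/t\<close> each integrated tail agrees with its regularised moment up to
  a factor 2 either way, hence the quotients up to 4. The negative part is the positive part of the
  reflected step.\<close>

lemma ratio_transfer:
  fixes Y :: "'a \<Rightarrow> int"
  assumes Y: "Y \<in> measurable M (count_space UNIV)" "integrable M (\<lambda>\<omega>. real_of_int (Y \<omega>))"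
    and lim: "((\<lambda>x. m_plus M Y x / m_total M Y x) \<longlongrightarrow> 0) at_top"
  shows "((\<lambda>t. reg2 M (\<lambda>\<omega>. max 0 (real_of_int (Y \<omega>))) t / reg2 M (\<lambda>\<omega>. \<bar>real_of_int (Y \<omega>)\<bar>) t) \<longlongrightarrow> 0) (at_right 0)"
proof -
  let ?p = "reg2 M (\<lambda>\<omega>. max 0 (real_of_int (Y \<omega>)))" and ?m = "reg2 M (\<lambda>\<omega>. max 0 (- real_of_int (Y \<omega>)))"
    and ?a = "reg2 M (\<lambda>\<omega>. \<bar>real_of_int (Y \<omega>)\<bar>)"
  have Y': "(\<lambda>\<omega>. - Y \<omega>) \<in> measurable M (count_space UNIV)" "integrable M (\<lambda>\<omega>. real_of_int (- Y \<omega>))"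
    using Y by (auto intro: measurable_compose[OF Y(1)])
  have split: "?a t = ?p t + ?m t" if "t > 0" for t
  proof -
    have "?a t = (\<integral>\<omega>. (max 0 (real_of_int (Y \<omega>)))\<^sup>2 / (1 + t * max 0 (real_of_int (Y \<omega>))) +
        (max 0 (- real_of_int (Y \<omega>)))\<^sup>2 / (1 + t * max 0 (- real_of_int (Y \<omega>))) \<partial>M)"
      unfolding reg2_def by (rule Bochner_Integration.integral_cong) (auto simp: max_def)
    also have "\<dots> = ?p t + ?m t"
      unfolding reg2_def using Y(2) that by (intro Bochner_Integration.integral_add integrable_frac2) auto
    finally show ?thesis .
  qed
  have "((\<lambda>x. ?p (inverse x) / ?a (inverse x)) \<longlongrightarrow> 0) at_top"
  proof (rule tendsto_sandwich[OF _ _ tendsto_const])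
    show "((\<lambda>x. 4 * (m_plus M Y x / m_total M Y x)) \<longlongrightarrow> 0) at_top" using tendsto_mult_right_zero[OF lim, of 4] .
    show "\<forall>\<^sub>F x in at_top. 0 \<le> ?p (inverse x) / ?a (inverse x)"
      using eventually_gt_at_top[of 0]
      by eventually_elim (intro divide_nonneg_nonneg reg2_nonneg; use Y(2) in auto)
    show "\<forall>\<^sub>F x in at_top. ?p (inverse x) / ?a (inverse x) \<le> 4 * (m_plus M Y x / m_total M Y x)"
      using eventually_gt_at_top[of 0]
    proof eventually_elim
      case (elim x)
      define p m where "p = ?p (inverse x)" and "m = ?m (inverse x)"
      have a: "?a (inverse x) = p + m" unfolding p_def m_def by (rule split) (use elim in simp)
      have nn: "0 \<le> p" "0 \<le> m" unfolding p_def m_def using Y(2) elim by (auto intro!: reg2_nonneg)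
      have b: "p \<le> 2 * m_plus M Y x" "m_plus M Y x \<le> 2 * p" "m \<le> 2 * m_minus M Y x" "m_minus M Y x \<le> 2 * m"
        using m_plus_reg2_bounds[OF Y elim] m_plus_reg2_bounds[OF Y' elim] by (auto simp: p_def m_def m_minus_eq_m_plus)
      show ?case
      \<comment> \<open>In the degenerate case the left quotient is a division by zero and has the
        value 0.\<close>
      proof (cases "p + m = 0")
        case True
        have "0 \<le> m_plus M Y x / m_total M Y x" unfolding m_total_def using b nn by (intro divide_nonneg_nonneg) auto
        thus ?thesis using True a by simp
      next
        case False
        hence s: "p + m > 0" using nn by simp
        have mt: "m_total M Y x = m_plus M Y x + m_minus M Y x" by (simp add: m_total_def)
        have t: "m_total M Y x > 0" using mt b s by linarith
        have "m_total M Y x / 2 \<le> p + m" using mt b by linarith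
        have "p / (p + m) \<le> 2 * m_plus M Y x / (m_total M Y x / 2)"
          using b nn t s \<open>m_total M Y x / 2 \<le> p + m\<close> by (intro frac_le) auto
        thus ?thesis unfolding a p_def[symmetric] by simp
      qed
    qed
  qed
  thus ?thesis by (simp add: filterlim_at_right_to_top)
qed

end

section \<open>The random walk\<close>

context prob_space
begin

context
  fixes X :: "nat \<Rightarrow> 'a \<Rightarrow> int"
  assumes iid: "iid M X"
begin

lemma iid_meas [measurable]: "X n \<in> measurable M (count_space UNIV)"
  using iid unfolding iid_def indep_vars_def by auto

lemma walk_meas [measurable]: "walk X n \<in> measurable M (count_space UNIV)"
proof -
  have "(\<lambda>\<omega>. real_of_int (X i \<omega>)) \<in> borel_measurable M" for i
    by (rule measurable_compose[OF iid_meas]) simp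
  hence "(\<lambda>\<omega>. real_of_int (walk X n \<omega>)) \<in> borel_measurable M"
    unfolding walk_def[abs_def] of_int_sum by (intro borel_measurable_sum)
  from measurable_sets[OF this, of "{real_of_int k}" for k]
  have "walk X n -` {k} \<inter> space M \<in> events" for k by (simp add: vimage_def)
  thus ?thesis by (simp add: measurable_count_space_eq2_countable)
qed

lemma cis_walk: "(\<integral>\<omega>. cis (t * real_of_int (walk X n \<omega>)) \<partial>M) = (\<integral>\<omega>. cis (t * real_of_int (X 0 \<omega>)) \<partial>M) ^ n"
proof -
  have c: "char (distr M borel Z) t = (\<integral>\<omega>. cis (t * Z \<omega>) \<partial>M)" if [measurable]: "Z \<in> borel_measurable M" for Z
    by (simp add: char_def integral_distr cis_conv_exp)
  have [measurable]: "(\<lambda>\<omega>. real_of_int (X i \<omega>)) \<in> borel_measurable M" for i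
    by (rule measurable_compose[OF iid_meas]) simp
  have [measurable]: "(\<lambda>\<omega>. real_of_int (walk X n \<omega>)) \<in> borel_measurable M"
    by (rule measurable_compose[OF walk_meas]) simp
  have ident: "(\<integral>\<omega>. cis (t * real_of_int (X i \<omega>)) \<partial>M) = (\<integral>\<omega>. cis (t * real_of_int (X 0 \<omega>)) \<partial>M)" for i
  proof -
    have "(\<integral>\<omega>. cis (t * real_of_int (X i \<omega>)) \<partial>M) = (\<integral>k. cis (t * real_of_int k) \<partial>distr M (count_space UNIV) (X i))"
      by (rule integral_distr[symmetric]) auto
    also have "\<dots> = (\<integral>k. cis (t * real_of_int k) \<partial>distr M (count_space UNIV) (X 0))"
      using iid unfolding iid_def by metis
    also have "\<dots> = (\<integral>\<omega>. cis (t * real_of_int (X 0 \<omega>)) \<partial>M)" by (rule integral_distr) auto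
    finally show ?thesis .
  qed
  have "indep_vars (\<lambda>_. count_space UNIV) X {1..n}"
    using iid unfolding iid_def by (auto intro: indep_vars_subset)
  hence "indep_vars (\<lambda>_. borel) (\<lambda>i \<omega>. real_of_int (X i \<omega>)) {1..n}" by (rule indep_vars_compose2) simp
  from char_distr_sum[OF this, of t]
  have "char (distr M borel (\<lambda>\<omega>. real_of_int (walk X n \<omega>))) t = (\<Prod>i=1..n. char (distr M borel (\<lambda>\<omega>. real_of_int (X i \<omega>))) t)"
    by (simp add: walk_def)
  moreover have "char (distr M borel (\<lambda>\<omega>. real_of_int (X i \<omega>))) t = (\<integral>\<omega>. cis (t * real_of_int (X 0 \<omega>)) \<partial>M)" for i
    using ident[of i] by (subst c) auto
  moreover have "char (distr M borel (\<lambda>\<omega>. real_of_int (walk X n \<omega>))) t = (\<integral>\<omega>. cis (t * real_of_int (walk X n \<omega>)) \<partial>M)"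
    by (rule c) measurable
  ultimately show ?thesis by simp
qed

text \<open>Fubini, after which orthogonality of the cosines on the half circle picks out the
  event.\<close>

lemma prob_walk: "prob {\<omega> \<in> space M. walk X n \<omega> = k}
    = (1 / pi) * (\<integral>t. Re ((\<integral>\<omega>. cis (t * real_of_int (X 0 \<omega>)) \<partial>M) ^ n * cis (- (of_int k * t))) \<partial>LL)"
proof -
  interpret L: finite_measure LL by (rule finite_measure_LL)
  interpret XL: pair_sigma_finite M LL by (intro pair_sigma_finite.intro sigma_finite_measure_axioms L.sigma_finite_measure_axioms)
  interpret P: finite_measure "M \<Otimes>\<^sub>M LL" by (intro finite_measure_pair_measure finite_measure_axioms L.finite_measure_axioms)
  have wm [measurable]: "(\<lambda>\<omega>. real_of_int (walk X n \<omega>)) \<in> borel_measurable M"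
    by (rule measurable_compose[OF walk_meas]) simp
  let ?f = "\<lambda>\<omega> t. cos (of_int (walk X n \<omega> - k) * t)"
  have m: "case_prod ?f \<in> borel_measurable (M \<Otimes>\<^sub>M LL)"
  proof -
    have [measurable]: "(\<lambda>x. x) \<in> borel_measurable LL" by (rule LL_meas) simp
    have "(\<lambda>p. cos ((real_of_int (walk X n (fst p)) - of_int k) * snd p)) \<in> borel_measurable (M \<Otimes>\<^sub>M LL)"
      by (intro borel_measurable_times borel_measurable_diff measurable_compose[OF _ borel_measurable_continuous_onI[of cos]]
          measurable_compose[OF measurable_fst wm] measurable_compose[OF measurable_snd, of "\<lambda>x. x"]) (auto intro: continuous_intros)
    thus ?thesis by (simp add: case_prod_beta')
  qed
  have i: "integrable (M \<Otimes>\<^sub>M LL) (case_prod ?f)"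
    by (rule P.integrable_const_bound[OF AE_I2 m, of 1]) (simp only: case_prod_beta' real_norm_def abs_cos_le_one)
  have pt: "Re ((\<integral>\<omega>. cis (t * real_of_int (X 0 \<omega>)) \<partial>M) ^ n * cis (- (of_int k * t))) = (\<integral>\<omega>. ?f \<omega> t \<partial>M)" for t
  proof -
    have ic: "integrable M (\<lambda>\<omega>. cis (t * real_of_int (walk X n \<omega>)))"
      by (rule integrable_const_bound[where B=1]) (auto simp: borel_measurable_complex_iff)
    have "Re ((\<integral>\<omega>. cis (t * real_of_int (X 0 \<omega>)) \<partial>M) ^ n * cis (- (of_int k * t)))
        = Re (\<integral>\<omega>. cis (t * real_of_int (walk X n \<omega>)) * cis (- (of_int k * t)) \<partial>M)"
      unfolding cis_walk[symmetric] integral_mult_left_zero ..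
    also have "\<dots> = (\<integral>\<omega>. Re (cis (t * real_of_int (walk X n \<omega>)) * cis (- (of_int k * t))) \<partial>M)"
      using ic by (intro integral_Re[symmetric] integrable_mult_left)
    also have "\<dots> = (\<integral>\<omega>. ?f \<omega> t \<partial>M)"
      unfolding cis_mult cis.sel by (intro Bochner_Integration.integral_cong refl arg_cong[where f=cos]) (simp add: algebra_simps)
    finally show ?thesis .
  qed
  have "(\<integral>t. (\<integral>\<omega>. ?f \<omega> t \<partial>M) \<partial>LL) = (\<integral>\<omega>. (\<integral>t. ?f \<omega> t \<partial>LL) \<partial>M)" by (rule XL.Fubini_integral[OF i])
  also have "\<dots> = (\<integral>\<omega>. pi * indicator {\<omega> \<in> space M. walk X n \<omega> = k} \<omega> \<partial>M)"
    by (rule Bochner_Integration.integral_cong[OF refl]) (simp only: LL_integral_cos, auto simp: indicator_def)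
  also have "\<dots> = pi * prob {\<omega> \<in> space M. walk X n \<omega> = k}"
  proof -
    have "{\<omega> \<in> space M. walk X n \<omega> = k} \<in> events" by measurable
    thus ?thesis by simp
  qed
  finally show ?thesis unfolding pt by simp
qed

text \<open>If the characteristic function were 1 at \<open>t\<close>, then
  \<open>cos (t * walk X n)\<close> would be 1 almost surely for every \<open>n\<close>, whereas
  some \<open>n\<close> gives the value 1 of the walk positive probability and
  \<open>cos t < 1\<close>.\<close>

lemma irreducible_nonlattice:
  assumes irr: "irreducible_walk M X" and t: "0 < t" "t \<le> pi"
  shows "(\<integral>\<omega>. cis (t * real_of_int (X 0 \<omega>)) \<partial>M) \<noteq> 1"
proof
  assume eq: "(\<integral>\<omega>. cis (t * real_of_int (X 0 \<omega>)) \<partial>M) = 1"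
  obtain n where n: "prob {\<omega> \<in> space M. 0 + walk X n \<omega> = 1} > 0" using irr unfolding irreducible_walk_def by blast
  have wm [measurable]: "(\<lambda>\<omega>. real_of_int (walk X n \<omega>)) \<in> borel_measurable M"
    by (rule measurable_compose[OF walk_meas]) simp
  have ic: "integrable M (\<lambda>\<omega>. cis (t * real_of_int (walk X n \<omega>)))"
    by (rule integrable_const_bound[where B=1]) (auto simp: borel_measurable_complex_iff)
  have "(\<integral>\<omega>. cis (t * real_of_int (walk X n \<omega>)) \<partial>M) = 1" unfolding cis_walk eq by simp
  hence "expectation (\<lambda>\<omega>. cos (t * real_of_int (walk X n \<omega>))) = 1" using integral_Re[OF ic] by simp
  moreover have icos: "integrable M (\<lambda>\<omega>. cos (t * real_of_int (walk X n \<omega>)))" using integrable_Re[OF ic] by simp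
  ultimately have "expectation (\<lambda>\<omega>. 1 - cos (t * real_of_int (walk X n \<omega>))) = 0"
    by (simp add: prob_space)
  moreover have "integrable M (\<lambda>\<omega>. 1 - cos (t * real_of_int (walk X n \<omega>)))" using icos by simp
  ultimately have "AE \<omega> in M. 1 - cos (t * real_of_int (walk X n \<omega>)) = 0"
    by (subst (asm) integral_nonneg_eq_0_iff_AE) auto
  hence "AE \<omega> in M. \<not> (0 + walk X n \<omega> = 1)"
  proof eventually_elim
    case (elim \<omega>)
    have "cos t < cos 0" using t by (intro cos_monotone_0_pi) auto
    thus ?case using elim by auto
  qed
  moreover have "{\<omega> \<in> space M. 0 + walk X n \<omega> = 1} \<in> events" by measurable
  ultimately have "prob {\<omega> \<in> space M. 0 + walk X n \<omega> = 1} = 0" by (subst prob_eq_0) auto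
  thus False using n by simp
qed

end

end

theorem corollary54:
  fixes M :: "'a measure" and X :: "nat \<Rightarrow> 'a \<Rightarrow> int"
  assumes "prob_space M"
    and "iid M X"
    and "irreducible_walk M X"
    and "integrable M (\<lambda>\<omega>. real_of_int (X 0 \<omega>))"
    and "(\<integral>\<omega>. real_of_int (X 0 \<omega>) \<partial>M) = 0"
    and "(\<integral>\<^sup>+\<omega>. ennreal ((real_of_int (X 0 \<omega>))\<^sup>2) \<partial>M) = \<infinity>"
    and "measure M {\<omega> \<in> space M. X 0 \<omega> \<ge> 2} > 0"
    and "((\<lambda>x. m_plus M (X 0) x / m_total M (X 0) x) \<longlongrightarrow> 0) at_top"
  shows "asymp_increasing (\<lambda>x. potential M X x) \<and> asymp_increasing (\<lambda>x. potential M X (- x))"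
proof -
  interpret prob_space M by (rule assms(1))
  note X_meas [measurable] = iid_meas[OF assms(2)]
  have "prob {\<omega> \<in> space M. X 0 \<omega> \<ge> 2} \<le> prob {\<omega> \<in> space M. X 0 \<omega> \<ge> 1}"
    by (rule finite_measure_mono) auto
  hence pos: "prob {\<omega> \<in> space M. X 0 \<omega> \<ge> 1} > 0" using assms(7) by simp
  interpret S: step M "X 0"
    by unfold_locales
      (fact X_meas assms(4-6) pos ratio_transfer[OF X_meas assms(4,8)] irreducible_nonlattice[OF assms(2,3)])+
  \<comment> \<open>The inversion integrals become actual walk probabilities here, so the series
    defining \<open>potential\<close> is the one summed by \<open>step_prob_sums\<close>.\<close>
  have "S.step_prob n k = prob {\<omega> \<in> space M. walk X n \<omega> = k}" for n k
    unfolding S.step_prob_def S.\<phi>_def prob_walk[OF assms(2)] ..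
  hence pot: "potential M X = S.pot"
    unfolding potential_def by (intro ext) (simp add: sums_unique[OF S.step_prob_sums])
  interpret A: potential_like S.pot by (rule S.potential_like_pot)
  show ?thesis unfolding pot using A.increasing_right A.increasing_left by simp
qed

end
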